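(* Let $\Bbbk$ be a field, and let $A=NC_W({\bf d})$ be a generalized nil-Coxeter algebra over $\Bbbk$ (with nonempty finite index set $I$) such that the maximal ideal $\mathfrak{m}$ generated by $\{T_i:i\in I\}$ is nilpotent. Regard $A$ as a cocommutative algebra via $\Delta(T_i)=T_i\otimes T_i$. For an $A$-module $M$ put $\operatorname{Prim}(M):=\{m\in M:T_im=0\ \forall i\in I\}$. Let $V$ be an $A$-module and $\kappa=\kappa_V\oplus\kappa_A:V\wedge V\to V\oplus A$ a $\Bbbk$-linear map. (1) If $\dim_\Bbbk V\le2$, then $\mathscr{H}_{0,\kappa}$ has the PBW property if and only if $\operatorname{im}\kappa_V\subset\operatorname{Prim}(V)$ and $\operatorname{im}\kappa_A\subset\operatorname{Prim}(A^{mult})$. (2) If $\dim_\Bbbk V>2$ and $\kappa_V\equiv0$, then $\mathscr{H}_{0,\kappa_A}$ has the PBW property if and only if $\kappa_A\equiv0$.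
   Context: Coxeter matrix: a symmetric matrix $(a_{ij})_{i,j\in I}$ indexed by a finite set $I$ with $a_{ii}=1$ and $2\le a_{ij}\le\infty$ for $i\ne j$; $W$ is the associated Coxeter group. For integers $d_i\ge2$, the generalized nil-Coxeter algebra $NC_W({\bf d})$ is the unital $\Bbbk$-algebra generated by $T_i$, $i\in I$, with relations $T_iT_jT_i\cdots=T_jT_iT_j\cdots$ ($a_{ij}$ factors on each side, $i\neq j$; no relation if $a_{ij}=\infty$) and $T_i^{d_i}=0$. The map $T_i\mapsto T_i\otimes T_i$ extends to a coassociative, cocommutative algebra map $\Delta:A\to A\otimes A$ with $\Delta(1)=1\otimes1$. $A^{mult}$ is $A$ as a left module over itself by left multiplication. Sweedler notation: $\Delta(a)=\sum a_{(1)}\otimes a_{(2)}$. $V\wedge V\subset V\otimes V$ is the span of the $v\wedge v'=v\otimes v'-v'\otimes v$; $\kappa(v,v')=\kappa(v\wedge v')$. $\mathscr{H}_{0,\kappa}$ is the quotient of the tensor algebra $T(V\oplus A)$ by the multiplication in $A$ (with $1_A$ the unit) and by the relations $av=\sum a_{(1)}(v)a_{(2)}$ and $vv'-v'v=\kappa(v,v')$ for $a\in A$, $v,v'\in V$; $\mathscr{H}_{0,\kappa_A}$ is the case $\kappa_V\equiv0$. It is filtered by $\deg A=0$, $\deg V=1$, and has the PBW property if the natural surjection from the smash product $\mathscr{H}_{0,0}=\mathrm{Sym}(V)\rtimes A$ (the case $\kappa=0$; as a vector space $\mathrm{Sym}(V)\otimes A$) onto its associated graded algebra is an isomorphism; equivalently,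 the products of ordered monomials in a totally ordered basis of $V$ with basis elements of $A$ form a basis of $\mathscr{H}_{0,\kappa}$. *)

theory Defs
  imports
    "HOL-Algebra.QuotRing"
    "HOL-Library.Poly_Mapping"
    "HOL-Library.Extended_Nat"
begin

section \<open>Rings carried by a type\<close>

definition type_ring :: "'r::ring_1 ring" where
  "type_ring = \<lparr>carrier = UNIV, monoid.mult = (\<lambda>x y. x * y), one = 1, ring.zero = 0, add = (+)\<rparr>"


section \<open>Free algebras\<close>

text \<open>Words over an alphabet. The monoid operation is written additively because
  the convolution product on \<^typ>\<open>'x \<Rightarrow>\<^sub>0 'k\<close> is set up for additive monoids; it is
  concatenation and is not commutative. Thus \<open>'x word \<Rightarrow>\<^sub>0 'k\<close> is the free
  associative unital algebra on \<open>'x\<close>, with scalars embedded by \<open>Poly_Mapping.single 0\<close>.\<close>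

datatype 'x word = Word "'x list"

instantiation word :: (type) monoid_add
begin

definition zero_word :: "'a word" where "0 = Word []"

fun plus_word :: "'a word \<Rightarrow> 'a word \<Rightarrow> 'a word" where
  "Word u + Word v = Word (u @ v)"

instance
proof
  fix a b c :: "'a word"
  show "a + b + c = a + (b + c)" by (cases a; cases b; cases c) simp
  show "0 + a = a" "a + 0 = a" by (cases a; simp add: zero_word_def)+
qed

end

type_synonym ('x, 'k) free_alg = "'x word \<Rightarrow>\<^sub>0 'k"

definition word_elt :: "'x list \<Rightarrow> ('x, 'k::field) free_alg" where
  "word_elt u = Poly_Mapping.single (Word u) 1"

abbreviation letter :: "'x \<Rightarrow> ('x, 'k::field) free_alg" where
  "letter x \<equiv> word_elt [x]"

abbreviation scalar :: "'k::field \<Rightarrow> ('m::monoid_add \<Rightarrow>\<^sub>0 'k)" where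
  "scalar c \<equiv> Poly_Mapping.single 0 c"


section \<open>Generalized nil-Coxeter algebras\<close>

definition coxeter_matrix :: "('i \<Rightarrow> 'i \<Rightarrow> enat) \<Rightarrow> bool" where
  "coxeter_matrix m \<longleftrightarrow>
     (\<forall>i j. m i j = m j i) \<and> (\<forall>i. m i i = 1) \<and> (\<forall>i j. i \<noteq> j \<longrightarrow> 2 \<le> m i j)"

fun alternating :: "nat \<Rightarrow> 'i \<Rightarrow> 'i \<Rightarrow> 'i list" where
  "alternating 0 i j = []"
| "alternating (Suc n) i j = i # alternating n j i"

inductive_set nil_coxeter_rels ::
    "('i \<Rightarrow> 'i \<Rightarrow> enat) \<Rightarrow> ('i \<Rightarrow> nat) \<Rightarrow> ('i, 'k::field) free_alg set"
  for m :: "'i \<Rightarrow> 'i \<Rightarrow> enat" and d :: "'i \<Rightarrow> nat" where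
  braid: "i \<noteq> j \<Longrightarrow> m i j = enat n \<Longrightarrow>
     word_elt (alternating n i j) - word_elt (alternating n j i) \<in> nil_coxeter_rels m d"
| nilpotent: "word_elt (replicate (d i) i) \<in> nil_coxeter_rels m d"

definition nil_coxeter_ideal ::
    "('i \<Rightarrow> 'i \<Rightarrow> enat) \<Rightarrow> ('i \<Rightarrow> nat) \<Rightarrow> ('i, 'k::field) free_alg set" where
  "nil_coxeter_ideal m d = Idl\<^bsub>type_ring\<^esub> (nil_coxeter_rels m d)"

definition NC ::
    "('i \<Rightarrow> 'i \<Rightarrow> enat) \<Rightarrow> ('i \<Rightarrow> nat) \<Rightarrow> ('i, 'k::field) free_alg set ring" where
  "NC m d = type_ring Quot (nil_coxeter_ideal m d)"

locale k_algebra = vector_space sA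
  for sA :: "'k::field \<Rightarrow> 'a::ring_1 \<Rightarrow> 'a" +
  assumes scale_mult_left: "sA c (a * b) = sA c a * b"
    and scale_mult_right: "sA c (a * b) = a * sA c b"

text \<open>The algebra depends on the matrix \<open>m\<close> and the exponents \<open>d\<close>, so it cannot itself be a
  HOL type. We say instead that a \<open>'k\<close>-algebra on a type \<open>'a\<close>, with a marked family \<open>T\<close>
  of elements, is a copy of it: some ring isomorphism from \<^const>\<open>NC\<close> is compatible with the
  generators and with the scalars.\<close>

definition is_nil_coxeter_algebra ::
    "('i \<Rightarrow> 'i \<Rightarrow> enat) \<Rightarrow> ('i \<Rightarrow> nat) \<Rightarrow> ('k::field \<Rightarrow> 'a::ring_1 \<Rightarrow> 'a) \<Rightarrow> ('i \<Rightarrow> 'a) \<Rightarrow> bool"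
  where
  "is_nil_coxeter_algebra m d sA T \<longleftrightarrow> k_algebra sA \<and>
     (\<exists>\<phi> \<in> ring_iso (NC m d :: ('i, 'k) free_alg set ring) type_ring.
        (\<forall>i. \<phi> (nil_coxeter_ideal m d +>\<^bsub>type_ring\<^esub> letter i) = T i) \<and>
        (\<forall>c. \<phi> (nil_coxeter_ideal m d +>\<^bsub>type_ring\<^esub> scalar c) = sA c 1))"

definition nilpotent_ideal :: "'a::ring_1 set \<Rightarrow> bool" where
  "nilpotent_ideal J \<longleftrightarrow> (\<exists>n. \<forall>xs. length xs = n \<longrightarrow> set xs \<subseteq> J \<longrightarrow> prod_list xs = 0)"


section \<open>The tensor square and the coproduct\<close>

text \<open>Pairs of elements of \<open>'a\<close>, as a monoid under componentwise multiplication (again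
  written additively). The linear span \<open>'a pure_tensor \<Rightarrow>\<^sub>0 'k\<close> of the symbols \<open>x \<otimes> y\<close> is then an
  algebra with \<open>(x \<otimes> y) (x' \<otimes> y') = x x' \<otimes> y y'\<close>, and the span of the bilinearity
  relators is an ideal of it, so that the quotient is \<open>A \<otimes> A\<close>.\<close>

datatype 'a pure_tensor = Tens (left: 'a) (right: 'a)

instantiation pure_tensor :: (monoid_mult) monoid_add
begin

definition zero_pure_tensor :: "'a pure_tensor" where "0 = Tens 1 1"

definition plus_pure_tensor :: "'a pure_tensor \<Rightarrow> 'a pure_tensor \<Rightarrow> 'a pure_tensor" where
  "p + q = Tens (left p * left q) (right p * right q)"

instance
  by standard (simp_all add: zero_pure_tensor_def plus_pure_tensor_def mult.assoc)

end

abbreviation pure :: "'a::ring_1 \<Rightarrow> 'a \<Rightarrow> ('a pure_tensor \<Rightarrow>\<^sub>0 'k::field)" where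
  "pure x y \<equiv> Poly_Mapping.single (Tens x y) 1"

inductive_set bilinear_rels :: "('k::field \<Rightarrow> 'a::ring_1 \<Rightarrow> 'a) \<Rightarrow> ('a pure_tensor \<Rightarrow>\<^sub>0 'k) set"
  for sA :: "'k::field \<Rightarrow> 'a::ring_1 \<Rightarrow> 'a" where
  "pure (x + x') y - pure x y - pure x' y \<in> bilinear_rels sA"
| "pure x (y + y') - pure x y - pure x y' \<in> bilinear_rels sA"
| "pure (sA c x) y - scalar c * pure x y \<in> bilinear_rels sA"
| "pure x (sA c y) - scalar c * pure x y \<in> bilinear_rels sA"

definition bilinear_ideal :: "('k::field \<Rightarrow> 'a::ring_1 \<Rightarrow> 'a) \<Rightarrow> ('a pure_tensor \<Rightarrow>\<^sub>0 'k) set" where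
  "bilinear_ideal sA = Idl\<^bsub>type_ring\<^esub> (bilinear_rels sA)"

definition tensor_square :: "('k::field \<Rightarrow> 'a::ring_1 \<Rightarrow> 'a) \<Rightarrow> ('a pure_tensor \<Rightarrow>\<^sub>0 'k) set ring" where
  "tensor_square sA = type_ring Quot (bilinear_ideal sA)"

text \<open>The \<open>'k\<close>-algebra map \<open>A \<rightarrow> A \<otimes> A\<close> with \<open>T i \<mapsto> T i \<otimes> T i\<close>; the \<open>T i\<close> generate
  \<open>A\<close>, so there is only one.\<close>

definition is_coproduct ::
    "('k::field \<Rightarrow> 'a::ring_1 \<Rightarrow> 'a) \<Rightarrow> ('i \<Rightarrow> 'a) \<Rightarrow> ('a \<Rightarrow> ('a pure_tensor \<Rightarrow>\<^sub>0 'k) set) \<Rightarrow> bool" where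
  "is_coproduct sA T \<Delta> \<longleftrightarrow>
     \<Delta> \<in> ring_hom type_ring (tensor_square sA) \<and>
     (\<forall>c a. \<Delta> (sA c a) =
        (bilinear_ideal sA +>\<^bsub>type_ring\<^esub> scalar c) \<otimes>\<^bsub>tensor_square sA\<^esub> \<Delta> a) \<and>
     (\<forall>i. \<Delta> (T i) = bilinear_ideal sA +>\<^bsub>type_ring\<^esub> pure (T i) (T i))"


section \<open>Modules and bilinear forms\<close>

locale algebra_module = k_algebra sA + V: vector_space sV
  for sA :: "'k::field \<Rightarrow> 'a::ring_1 \<Rightarrow> 'a"
    and sV :: "'k \<Rightarrow> 'v::ab_group_add \<Rightarrow> 'v" +
  fixes act :: "'a \<Rightarrow> 'v \<Rightarrow> 'v"
  assumes act_add_left: "act (a + b) v = act a v + act b v"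
    and act_scale_left: "act (sA c a) v = sV c (act a v)"
    and act_add_right: "act a (v + w) = act a v + act a w"
    and act_scale_right: "act a (sV c v) = sV c (act a v)"
    and act_one: "act 1 v = v"
    and act_mult: "act (a * b) v = act a (act b v)"

definition Prim :: "('i \<Rightarrow> 'a) \<Rightarrow> ('a \<Rightarrow> 'm \<Rightarrow> 'm::zero) \<Rightarrow> 'm set" where
  "Prim T act = {x. \<forall>i. act (T i) x = 0}"

text \<open>Over any field, \<open>v \<wedge> v' \<mapsto> v \<otimes> v' - v' \<otimes> v\<close> identifies the exterior square of \<open>V\<close>
  with the subspace \<open>V \<wedge> V\<close> of \<open>V \<otimes> V\<close>. A linear map \<open>\<kappa>\<close> on \<open>V \<wedge> V\<close> is thus the
  same thing as the alternating bilinear map \<open>\<kappa>(v, v') = \<kappa>(v \<wedge> v')\<close>.\<close>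

definition alternating_bilinear ::
    "('k::field \<Rightarrow> 'v::ab_group_add \<Rightarrow> 'v) \<Rightarrow> ('k \<Rightarrow> 'w::ab_group_add \<Rightarrow> 'w) \<Rightarrow> ('v \<Rightarrow> 'v \<Rightarrow> 'w) \<Rightarrow> bool"
  where
  "alternating_bilinear sV sW \<kappa> \<longleftrightarrow>
     (\<forall>v. Vector_Spaces.linear sV sW (\<lambda>v'. \<kappa> v v')) \<and> (\<forall>v'. Vector_Spaces.linear sV sW (\<lambda>v. \<kappa> v v')) \<and> (\<forall>v. \<kappa> v v = 0)"

text \<open>The image of the linear map on \<open>V \<wedge> V\<close>, which is spanned by the \<open>v \<wedge> v'\<close>.\<close>

definition wedge_image ::
    "('k::field \<Rightarrow> 'w::ab_group_add \<Rightarrow> 'w) \<Rightarrow> ('v \<Rightarrow> 'v \<Rightarrow> 'w) \<Rightarrow> 'w set" where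
  "wedge_image sW \<kappa> = Modules.module.span sW {\<kappa> v v' | v v'. True}"

text \<open>\<^const>\<open>vector_space.dim\<close> is \<open>0\<close> on infinite-dimensional spaces, hence a separate
  notion for \<open>dim V \<le> n\<close>.\<close>

definition dim_at_most :: "('k::field \<Rightarrow> 'v::ab_group_add \<Rightarrow> 'v) \<Rightarrow> nat \<Rightarrow> bool" where
  "dim_at_most sV n \<longleftrightarrow> (\<exists>B. \<not> Modules.module.dependent sV B \<and> Modules.module.span sV B = UNIV \<and>
     finite B \<and> card B \<le> n)"


section \<open>The algebras \<open>H\<^sub>0\<^sub>,\<^sub>\<kappa>\<close>\<close>

text \<open>The tensor algebra of \<open>V \<oplus> A\<close>: the free algebra on the set \<open>V \<times> A\<close> modulo the
  linear relations of \<open>V \<oplus> A\<close>.\<close>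

inductive_set linear_rels ::
    "('k::field \<Rightarrow> 'a::ring_1 \<Rightarrow> 'a) \<Rightarrow> ('k \<Rightarrow> 'v::ab_group_add \<Rightarrow> 'v) \<Rightarrow> ('v \<times> 'a, 'k) free_alg set"
  for sA :: "'k::field \<Rightarrow> 'a::ring_1 \<Rightarrow> 'a" and sV :: "'k \<Rightarrow> 'v::ab_group_add \<Rightarrow> 'v" where
  "letter (v + v', a + a') - letter (v, a) - letter (v', a') \<in> linear_rels sA sV"
| "letter (sV c v, sA c a) - scalar c * letter (v, a) \<in> linear_rels sA sV"

definition linear_ideal ::
    "('k::field \<Rightarrow> 'a::ring_1 \<Rightarrow> 'a) \<Rightarrow> ('k \<Rightarrow> 'v::ab_group_add \<Rightarrow> 'v) \<Rightarrow> ('v \<times> 'a, 'k) free_alg set"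
  where "linear_ideal sA sV = Idl\<^bsub>type_ring\<^esub> (linear_rels sA sV)"

definition tensor_algebra ::
    "('k::field \<Rightarrow> 'a::ring_1 \<Rightarrow> 'a) \<Rightarrow> ('k \<Rightarrow> 'v::ab_group_add \<Rightarrow> 'v) \<Rightarrow>
     ('v \<times> 'a, 'k) free_alg set ring" where
  "tensor_algebra sA sV = type_ring Quot (linear_ideal sA sV)"

abbreviation letV :: "'v \<Rightarrow> ('v \<times> 'a::zero, 'k::field) free_alg" where
  "letV v \<equiv> letter (v, 0)"

abbreviation letA :: "'a \<Rightarrow> ('v::zero \<times> 'a, 'k::field) free_alg" where
  "letA a \<equiv> letter (0, a)"

text \<open>The relators, as representatives in the free algebra. In \<open>sweedler\<close>, \<open>p\<close> is any
  representative \<open>\<Sum> c\<^sub>j (x\<^sub>j \<otimes> y\<^sub>j)\<close> of \<open>\<Delta> a\<close>, and the relation reads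
  \<open>a v = \<Sum> c\<^sub>j x\<^sub>j(v) y\<^sub>j\<close>.\<close>

inductive_set H_rels ::
    "('a::ring_1 \<Rightarrow> 'v::ab_group_add \<Rightarrow> 'v) \<Rightarrow> ('a \<Rightarrow> ('a pure_tensor \<Rightarrow>\<^sub>0 'k::field) set) \<Rightarrow>
     ('v \<Rightarrow> 'v \<Rightarrow> 'v) \<Rightarrow> ('v \<Rightarrow> 'v \<Rightarrow> 'a) \<Rightarrow> ('v \<times> 'a, 'k) free_alg set"
  for act :: "'a::ring_1 \<Rightarrow> 'v::ab_group_add \<Rightarrow> 'v" and \<Delta> :: "'a \<Rightarrow> ('a pure_tensor \<Rightarrow>\<^sub>0 'k::field) set"
    and \<kappa>V :: "'v \<Rightarrow> 'v \<Rightarrow> 'v" and \<kappa>A :: "'v \<Rightarrow> 'v \<Rightarrow> 'a" where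
  unit: "letA 1 - 1 \<in> H_rels act \<Delta> \<kappa>V \<kappa>A"
| mult: "letA a * letA b - letA (a * b) \<in> H_rels act \<Delta> \<kappa>V \<kappa>A"
| sweedler: "p \<in> \<Delta> a \<Longrightarrow>
     letA a * letV v -
       (\<Sum>t \<in> Poly_Mapping.keys p. scalar (Poly_Mapping.lookup p t) * letV (act (left t) v) * letA (right t))
     \<in> H_rels act \<Delta> \<kappa>V \<kappa>A"
| commutator: "letV v * letV v' - letV v' * letV v - letter (\<kappa>V v v', \<kappa>A v v')
     \<in> H_rels act \<Delta> \<kappa>V \<kappa>A"

definition H_ideal ::
    "('k::field \<Rightarrow> 'a::ring_1 \<Rightarrow> 'a) \<Rightarrow> ('k \<Rightarrow> 'v::ab_group_add \<Rightarrow> 'v) \<Rightarrow> ('a \<Rightarrow> 'v \<Rightarrow> 'v) \<Rightarrow>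
     ('a \<Rightarrow> ('a pure_tensor \<Rightarrow>\<^sub>0 'k) set) \<Rightarrow> ('v \<Rightarrow> 'v \<Rightarrow> 'v) \<Rightarrow> ('v \<Rightarrow> 'v \<Rightarrow> 'a) \<Rightarrow>
     ('v \<times> 'a, 'k) free_alg set set" where
  "H_ideal sA sV act \<Delta> \<kappa>V \<kappa>A =
     Idl\<^bsub>tensor_algebra sA sV\<^esub>
       ((\<lambda>r. linear_ideal sA sV +>\<^bsub>type_ring\<^esub> r) ` H_rels act \<Delta> \<kappa>V \<kappa>A)"

definition H_alg ::
    "('k::field \<Rightarrow> 'a::ring_1 \<Rightarrow> 'a) \<Rightarrow> ('k \<Rightarrow> 'v::ab_group_add \<Rightarrow> 'v) \<Rightarrow> ('a \<Rightarrow> 'v \<Rightarrow> 'v) \<Rightarrow>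
     ('a \<Rightarrow> ('a pure_tensor \<Rightarrow>\<^sub>0 'k) set) \<Rightarrow> ('v \<Rightarrow> 'v \<Rightarrow> 'v) \<Rightarrow> ('v \<Rightarrow> 'v \<Rightarrow> 'a) \<Rightarrow>
     ('v \<times> 'a, 'k) free_alg set set ring" where
  "H_alg sA sV act \<Delta> \<kappa>V \<kappa>A = tensor_algebra sA sV Quot (H_ideal sA sV act \<Delta> \<kappa>V \<kappa>A)"

definition H_cls ::
    "('k::field \<Rightarrow> 'a::ring_1 \<Rightarrow> 'a) \<Rightarrow> ('k \<Rightarrow> 'v::ab_group_add \<Rightarrow> 'v) \<Rightarrow> ('a \<Rightarrow> 'v \<Rightarrow> 'v) \<Rightarrow>
     ('a \<Rightarrow> ('a pure_tensor \<Rightarrow>\<^sub>0 'k) set) \<Rightarrow> ('v \<Rightarrow> 'v \<Rightarrow> 'v) \<Rightarrow> ('v \<Rightarrow> 'v \<Rightarrow> 'a) \<Rightarrow>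
     ('v \<times> 'a, 'k) free_alg \<Rightarrow> ('v \<times> 'a, 'k) free_alg set set" where
  "H_cls sA sV act \<Delta> \<kappa>V \<kappa>A x =
     H_ideal sA sV act \<Delta> \<kappa>V \<kappa>A +>\<^bsub>tensor_algebra sA sV\<^esub>
       (linear_ideal sA sV +>\<^bsub>type_ring\<^esub> x)"


section \<open>Filtrations, associated graded rings and the PBW property\<close>

text \<open>The smallest ring filtration of \<open>R\<close> in which the elements of \<open>A0\<close> have degree \<open>0\<close> and
  those of \<open>V1\<close> have degree \<open>1\<close>.\<close>

inductive filt :: "('h, 'm) ring_scheme \<Rightarrow> 'h set \<Rightarrow> 'h set \<Rightarrow> nat \<Rightarrow> 'h \<Rightarrow> bool"
  for R :: "('h, 'm) ring_scheme" (structure) and A0 V1 :: "'h set" where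
  "filt R A0 V1 0 \<one>"
| "x \<in> A0 \<Longrightarrow> filt R A0 V1 0 x"
| "x \<in> V1 \<Longrightarrow> filt R A0 V1 1 x"
| "filt R A0 V1 n x \<Longrightarrow> filt R A0 V1 (Suc n) x"
| "filt R A0 V1 n x \<Longrightarrow> filt R A0 V1 n (\<ominus> x)"
| "filt R A0 V1 n x \<Longrightarrow> filt R A0 V1 n y \<Longrightarrow> filt R A0 V1 n (x \<oplus> y)"
| "filt R A0 V1 n x \<Longrightarrow> filt R A0 V1 k y \<Longrightarrow> filt R A0 V1 (n + k) (x \<otimes> y)"

definition below :: "('h, 'm) ring_scheme \<Rightarrow> (nat \<Rightarrow> 'h set) \<Rightarrow> nat \<Rightarrow> 'h set" where
  "below R F n = (case n of 0 \<Rightarrow> {\<zero>\<^bsub>R\<^esub>} | Suc k \<Rightarrow> F k)"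

text \<open>The associated graded ring of a filtration \<open>F 0 \<subseteq> F 1 \<subseteq> \<dots>\<close> of \<open>R\<close>: its elements are the
  finitely supported families of cosets \<open>g n \<in> F n / F (n - 1)\<close>, where \<open>F (-1) = {0}\<close>.\<close>

definition gr :: "('h, 'm) ring_scheme \<Rightarrow> (nat \<Rightarrow> 'h set) \<Rightarrow> (nat \<Rightarrow> 'h set) ring" where
  "gr R F =
     \<lparr>carrier = {g. (\<forall>n. \<exists>x \<in> F n. g n = below R F n +>\<^bsub>R\<^esub> x) \<and> finite {n. g n \<noteq> below R F n}},
      monoid.mult = (\<lambda>g h n.
        {(\<Oplus>\<^bsub>R\<^esub>i\<in>{..n}. x i \<otimes>\<^bsub>R\<^esub> y (n - i)) \<oplus>\<^bsub>R\<^esub> z | x y z.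
           (\<forall>i\<le>n. x i \<in> g i \<and> y i \<in> h i) \<and> z \<in> below R F n}),
      one = (\<lambda>n. if n = 0 then below R F 0 +>\<^bsub>R\<^esub> \<one>\<^bsub>R\<^esub> else below R F n),
      ring.zero = below R F,
      add = (\<lambda>g h n. g n <+>\<^bsub>R\<^esub> h n)\<rparr>"

definition gr_symbol ::
    "('h, 'm) ring_scheme \<Rightarrow> (nat \<Rightarrow> 'h set) \<Rightarrow> nat \<Rightarrow> 'h \<Rightarrow> (nat \<Rightarrow> 'h set)" where
  "gr_symbol R F n x = (\<lambda>k. if k = n then below R F n +>\<^bsub>R\<^esub> x else below R F k)"

definition H_filt ::
    "('k::field \<Rightarrow> 'a::ring_1 \<Rightarrow> 'a) \<Rightarrow> ('k \<Rightarrow> 'v::ab_group_add \<Rightarrow> 'v) \<Rightarrow> ('a \<Rightarrow> 'v \<Rightarrow> 'v) \<Rightarrow>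
     ('a \<Rightarrow> ('a pure_tensor \<Rightarrow>\<^sub>0 'k) set) \<Rightarrow> ('v \<Rightarrow> 'v \<Rightarrow> 'v) \<Rightarrow> ('v \<Rightarrow> 'v \<Rightarrow> 'a) \<Rightarrow>
     nat \<Rightarrow> ('v \<times> 'a, 'k) free_alg set set set" where
  "H_filt sA sV act \<Delta> \<kappa>V \<kappa>A n =
     {x. filt (H_alg sA sV act \<Delta> \<kappa>V \<kappa>A)
           (range (\<lambda>a. H_cls sA sV act \<Delta> \<kappa>V \<kappa>A (letA a)))
           (range (\<lambda>v. H_cls sA sV act \<Delta> \<kappa>V \<kappa>A (letV v))) n x}"

text \<open>The natural map from \<open>H\<^sub>0\<^sub>,\<^sub>0\<close> to the associated graded ring is the ring homomorphism
  that sends \<open>a\<close> to its class in degree \<open>0\<close> and \<open>v\<close> to its class in degree \<open>1\<close>. These elements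
  generate \<open>H\<^sub>0\<^sub>,\<^sub>0\<close>, so this condition says that the natural map is an isomorphism; it is
  linear over the field since the scalars are the multiples of \<open>1\<^sub>A\<close>.\<close>

definition PBW ::
    "('k::field \<Rightarrow> 'a::ring_1 \<Rightarrow> 'a) \<Rightarrow> ('k \<Rightarrow> 'v::ab_group_add \<Rightarrow> 'v) \<Rightarrow> ('a \<Rightarrow> 'v \<Rightarrow> 'v) \<Rightarrow>
     ('a \<Rightarrow> ('a pure_tensor \<Rightarrow>\<^sub>0 'k) set) \<Rightarrow> ('v \<Rightarrow> 'v \<Rightarrow> 'v) \<Rightarrow> ('v \<Rightarrow> 'v \<Rightarrow> 'a) \<Rightarrow> bool" where
  "PBW sA sV act \<Delta> \<kappa>V \<kappa>A \<longleftrightarrow>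
     (let smash_cls = H_cls sA sV act \<Delta> (\<lambda>_ _. 0) (\<lambda>_ _. 0);
          cls = H_cls sA sV act \<Delta> \<kappa>V \<kappa>A;
          H = H_alg sA sV act \<Delta> \<kappa>V \<kappa>A;
          F = H_filt sA sV act \<Delta> \<kappa>V \<kappa>A
      in \<exists>\<phi> \<in> ring_iso (H_alg sA sV act \<Delta> (\<lambda>_ _. 0) (\<lambda>_ _. 0)) (gr H F).
           (\<forall>a. \<phi> (smash_cls (letA a)) = gr_symbol H F 0 (cls (letA a))) \<and>
           (\<forall>v. \<phi> (smash_cls (letV v)) = gr_symbol H F 1 (cls (letV v))))"

end

theory Submission
  imports Defs "HOL-Library.Function_Algebras" "HOL-Library.Product_Plus"
begin

text \<open>
  Write \<open>H\<close> for the deformed algebra \<open>H\<^sub>0\<^sub>,\<^sub>\<kappa>\<close>. The natural map from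
  \<open>H\<^sub>0\<^sub>,\<^sub>0\<close> to the associated graded ring of \<open>H\<close> is always a surjective homomorphism, so
  the PBW property says that no nonzero homogeneous element of \<open>H\<^sub>0\<^sub>,\<^sub>0\<close> drops to a lower
  filtration degree in \<open>H\<close> (\<open>PBW_iff_injective\<close>). For \<open>\<kappa> = 0\<close> this is clear because
  \<open>H\<^sub>0\<^sub>,\<^sub>0\<close> is graded (\<open>PBW_zero\<close>). As \<open>\<Delta> T\<^sub>i = T\<^sub>i \<otimes> T\<^sub>i\<close>, the generators satisfy
  \<open>T\<^sub>i v = T\<^sub>i(v) T\<^sub>i\<close> in \<open>H\<close>, and therefore
  \<open>T\<^sub>i \<kappa>(v, w) = \<kappa>(T\<^sub>i(v), T\<^sub>i(w)) T\<^sub>i\<close>.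

  Necessity, \<open>dim V \<le> 2\<close>. The \<open>T\<^sub>i\<close> act nilpotently on \<open>V\<close>, so their rank is at most one and the
  right-hand side vanishes. The left-hand side is
  \<open>T\<^sub>i(\<kappa>\<^sub>V(v, w)) T\<^sub>i + T\<^sub>i \<kappa>\<^sub>A(v, w)\<close>. The PBW property embeds
  \<open>(V \<otimes> A) \<oplus> A\<close> into \<open>H\<close>, so both terms vanish (\<open>PBW_kappa_primitive\<close>).

  Necessity, \<open>dim V > 2\<close> and \<open>\<kappa>\<^sub>V = 0\<close>. The Jacobi identity for the commutator gives
  \<open>\<kappa>(v\<^sub>1, v\<^sub>2) v\<^sub>3 + \<dots> = v\<^sub>3 \<kappa>(v\<^sub>1, v\<^sub>2) + \<dots>\<close> (cyclic sums). The nonzero words in the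
  \<open>T\<^sub>i\<close> are grouplike and form a basis of \<open>A\<close> (\<open>word_basis\<close>). Comparing coefficients at a basis
  word \<open>b\<close> yields \<open>b(u) = u\<close> for \<open>u = r\<^sub>b(\<kappa>(v\<^sub>1, v\<^sub>2)) v\<^sub>3 + \<dots>\<close>, where \<open>r\<^sub>b\<close> is the
  coefficient (\<open>PBW_jacobi\<close>). A word \<open>b \<noteq> 1\<close> is nilpotent, so \<open>u = 0\<close>. Since some \<open>v\<^sub>3\<close> lies
  outside the span of \<open>v\<^sub>1\<close> and \<open>v\<^sub>2\<close>, this leaves only a multiple of \<open>1\<close> for
  \<open>\<kappa>(v\<^sub>1, v\<^sub>2)\<close>. The multiple is zero, because by the displayed equivariance it does not change when
  \<open>v\<^sub>1, v\<^sub>2\<close> are replaced by \<open>T\<^sub>i(v\<^sub>1), T\<^sub>i(v\<^sub>2)\<close>, and \<open>T\<^sub>i\<close> is nilpotent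
  (\<open>PBW_kappaA_zero\<close>).

  Sufficiency. For \<open>dim V \<le> 1\<close> every alternating \<open>\<kappa>\<close> is zero. In dimension two there is a basis
  with \<open>T\<^sub>i(v\<^sub>1) = 0\<close>, \<open>T\<^sub>i(v\<^sub>2) = \<gamma>\<^sub>i v\<^sub>1\<close> and \<open>\<kappa>\<^sub>V(v\<^sub>1, v\<^sub>2)\<close> a multiple of \<open>v\<^sub>1\<close>
  (\<open>dim_two_basis\<close>). For such a basis \<open>H\<close> acts on formal sums of \<open>v\<^sub>1\<^sup>i v\<^sub>2\<^sup>j a\<close> by explicit
  formulas (\<open>plane_representation\<close>), and the monomial \<open>v\<^sub>1\<^sup>i v\<^sub>2\<^sup>j a\<close> of \<open>H\<close> sends \<open>1\<close> to the
  formal monomial of the same name. Hence a nonzero combination of monomials of degree \<open>n\<close> does not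
  lie in lower filtration degree (\<open>PBW_plane\<close>).
\<close>

section \<open>Two-sided ideals and iterated quotients\<close>

locale two_sided =
  fixes I :: "'r::ring_1 set"
  assumes zero_mem: "0 \<in> I"
    and add_mem: "\<lbrakk>x \<in> I; y \<in> I\<rbrakk> \<Longrightarrow> x + y \<in> I"
    and mult_mem_left: "x \<in> I \<Longrightarrow> r * x \<in> I"
    and mult_mem_right: "x \<in> I \<Longrightarrow> x * r \<in> I"
begin

lemma uminus_mem: "x \<in> I \<Longrightarrow> - x \<in> I"
  using mult_mem_left[of x "-1"] by simp

lemma diff_mem: "\<lbrakk>x \<in> I; y \<in> I\<rbrakk> \<Longrightarrow> x - y \<in> I"
  using add_mem[OF _ uminus_mem, of x y] by simp

lemma sum_mem: "(\<And>i. i \<in> S \<Longrightarrow> f i \<in> I) \<Longrightarrow> sum f S \<in> I"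
  by (induction S rule: infinite_finite_induct) (auto intro: zero_mem add_mem)

definition equ :: "'r \<Rightarrow> 'r \<Rightarrow> bool" (infix "\<approx>" 50) where
  "x \<approx> y \<longleftrightarrow> x - y \<in> I"

lemma equ_zero_iff: "x \<approx> 0 \<longleftrightarrow> x \<in> I"
  by (simp add: equ_def)

lemma equ_refl [simp]: "x \<approx> x"
  by (simp add: equ_def zero_mem)

lemma equ_sym: "x \<approx> y \<Longrightarrow> y \<approx> x"
  using uminus_mem[of "x - y"] by (simp add: equ_def)

lemma equ_trans [trans]: "\<lbrakk>x \<approx> y; y \<approx> z\<rbrakk> \<Longrightarrow> x \<approx> z"
  using add_mem[of "x - y" "y - z"] by (simp add: equ_def)

lemma equ_add: "\<lbrakk>x \<approx> x'; y \<approx> y'\<rbrakk> \<Longrightarrow> x + y \<approx> x' + y'"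
  using add_mem[of "x - x'" "y - y'"] by (simp add: equ_def algebra_simps)

lemma equ_diff: "\<lbrakk>x \<approx> x'; y \<approx> y'\<rbrakk> \<Longrightarrow> x - y \<approx> x' - y'"
  using diff_mem[of "x - x'" "y - y'"] by (simp add: equ_def algebra_simps)

lemma equ_sum: "(\<And>i. i \<in> S \<Longrightarrow> f i \<approx> g i) \<Longrightarrow> sum f S \<approx> sum g S"
  unfolding equ_def sum_subtractf[symmetric] by (rule sum_mem)

lemma equ_mult: "\<lbrakk>x \<approx> x'; y \<approx> y'\<rbrakk> \<Longrightarrow> x * y \<approx> x' * y'"
  using add_mem[OF mult_mem_right[of "x - x'" y] mult_mem_left[of "y - y'" x']]
  by (simp add: equ_def algebra_simps)

lemma equ_mult_left: "x \<approx> x' \<Longrightarrow> r * x \<approx> r * x'"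
  by (rule equ_mult[OF equ_refl])

lemma equ_mult_right: "x \<approx> x' \<Longrightarrow> x * r \<approx> x' * r"
  by (rule equ_mult[OF _ equ_refl])

lemma mem_cong: "x \<approx> y \<Longrightarrow> x \<in> I \<longleftrightarrow> y \<in> I"
  using add_mem[of "x - y" y] diff_mem[of x "x - y"] by (auto simp: equ_def)

end

lemma type_ring_simps [simp]:
  "carrier type_ring = UNIV" "x \<otimes>\<^bsub>type_ring\<^esub> y = x * y" "x \<oplus>\<^bsub>type_ring\<^esub> y = x + y"
  "\<one>\<^bsub>type_ring\<^esub> = 1" "\<zero>\<^bsub>type_ring\<^esub> = 0"
  by (simp_all add: type_ring_def)

lemma ring_type_ring: "ring (type_ring :: 'r::ring_1 ring)"
proof (rule ringI)
  show "abelian_group (type_ring :: 'r ring)"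
    by (rule abelian_groupI) (auto simp: algebra_simps intro: exI[of _ "- x" for x])
  show "Group.monoid (type_ring :: 'r ring)"
    by (rule monoidI) (auto simp: algebra_simps)
qed (auto simp: algebra_simps)

lemma a_inv_type_ring [simp]: "\<ominus>\<^bsub>type_ring\<^esub> (x :: 'r::ring_1) = - x"
proof -
  interpret R: ring "type_ring :: 'r ring" by (rule ring_type_ring)
  show ?thesis using R.minus_equality[of "- x" x] by simp
qed

lemma ideal_type_ring_iff: "ideal I type_ring \<longleftrightarrow> two_sided (I :: 'r::ring_1 set)"
proof
  assume "ideal I (type_ring :: 'r ring)"
  then interpret ideal I "type_ring :: 'r ring" .
  note sub = additive_subgroup.zero_closed[OF ideal.axioms(1)[OF ideal_axioms]]
    additive_subgroup.a_closed[OF ideal.axioms(1)[OF ideal_axioms]]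
  show "two_sided I"
    using sub I_l_closed I_r_closed by unfold_locales auto
next
  assume "two_sided I"
  then interpret two_sided I .
  interpret R: ring "type_ring :: 'r ring" by (rule ring_type_ring)
  show "ideal I (type_ring :: 'r ring)"
  proof (rule idealI)
    have inv: "inv\<^bsub>add_monoid type_ring\<^esub> x = - x" for x :: 'r
      using a_inv_type_ring[of x] by (simp add: a_inv_def)
    show "subgroup I (add_monoid type_ring)"
      by (rule subgroup.intro) (use inv in \<open>simp_all add: zero_mem add_mem uminus_mem\<close>)
  qed (auto simp: ring_type_ring mult_mem_left mult_mem_right)
qed

lemma two_sided_Idl: "two_sided (Idl\<^bsub>type_ring\<^esub> (X :: 'r::ring_1 set))"
  using ring.genideal_ideal[OF ring_type_ring, of X] by (simp add: ideal_type_ring_iff)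

lemma Idl_type_ring_minimal:
  "\<lbrakk>two_sided I; X \<subseteq> I\<rbrakk> \<Longrightarrow> Idl\<^bsub>type_ring\<^esub> X \<subseteq> (I :: 'r::ring_1 set)"
  using ring.genideal_minimal[OF ring_type_ring] by (simp add: ideal_type_ring_iff)

lemma Idl_type_ring_self: "X \<subseteq> Idl\<^bsub>type_ring\<^esub> (X :: 'r::ring_1 set)"
  using ring.genideal_self[OF ring_type_ring, of X] by simp

lemma (in ideal) rcos_eq_iff:
  "\<lbrakk>x \<in> carrier R; y \<in> carrier R\<rbrakk> \<Longrightarrow> I +> x = I +> y \<longleftrightarrow> x \<ominus> y \<in> I"
  using quotient_eq_iff_same_a_r_cos[OF ideal_axioms] by auto

lemma carrier_Quot: "carrier (R Quot I) = (\<lambda>x. I +>\<^bsub>R\<^esub> x) ` carrier R"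
  by (auto simp: FactRing_def A_RCOSETS_def' )

text \<open>Dividing first by one set of relations and then by the image of a second set is the same
  as dividing by both at once.\<close>

locale iterated_quotient =
  fixes X Y L :: "'r::ring_1 set" and S :: "'r set ring" and K :: "'r set set"
    and Q :: "'r set set ring" and cls :: "'r \<Rightarrow> 'r set set"
  defines "L \<equiv> Idl\<^bsub>type_ring\<^esub> X" and "S \<equiv> type_ring Quot L"
    and "K \<equiv> Idl\<^bsub>S\<^esub> ((\<lambda>r. L +>\<^bsub>type_ring\<^esub> r) ` Y)" and "Q \<equiv> S Quot K"
    and "cls \<equiv> \<lambda>x. K +>\<^bsub>S\<^esub> (L +>\<^bsub>type_ring\<^esub> x)"
begin

abbreviation "res x \<equiv> L +>\<^bsub>type_ring\<^esub> x"

lemma ideal_L: "ideal L type_ring"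
  unfolding L_def by (simp add: ideal_type_ring_iff two_sided_Idl)

lemma hom_L: "ring_hom_ring type_ring S res"
  unfolding S_def by (rule ideal.rcos_ring_hom_ring[OF ideal_L])

lemma carrier_S: "carrier S = range res"
  unfolding S_def by (simp add: carrier_Quot)

lemma ideal_K: "ideal K S"
  unfolding K_def
  by (rule ring.genideal_ideal) (use ring_hom_ring.axioms(2)[OF hom_L] carrier_S in auto)

lemma cls_hom: "ring_hom_ring type_ring Q cls"
proof -
  have "(\<lambda>s. K +>\<^bsub>S\<^esub> s) \<circ> res \<in> ring_hom type_ring Q"
    unfolding Q_def
    by (rule ring_hom_trans[OF ring_hom_ring.homh[OF hom_L] ideal.rcos_ring_hom[OF ideal_K]])
  then show ?thesis
    unfolding cls_def Q_def
    by (intro ring_hom_ringI2 ring_type_ring ideal.quotient_is_ring[OF ideal_K])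
       (simp add: o_def)
qed

lemma carrier_Q: "carrier Q = range cls"
  unfolding Q_def cls_def by (simp add: carrier_Quot carrier_S image_image)

lemma cls_eq_iff: "cls x = cls y \<longleftrightarrow> x - y \<in> Idl\<^bsub>type_ring\<^esub> (X \<union> Y)"
proof -
  interpret h: ring_hom_ring type_ring S res by (rule hom_L)
  interpret J: two_sided "Idl\<^bsub>type_ring\<^esub> (X \<union> Y)" by (rule two_sided_Idl)
  have XY: "X \<union> Y \<subseteq> Idl\<^bsub>type_ring\<^esub> (X \<union> Y)" by (rule Idl_type_ring_self)
  have L: "L \<subseteq> Idl\<^bsub>type_ring\<^esub> (X \<union> Y)"
    unfolding L_def by (rule Idl_type_ring_minimal[OF J.two_sided_axioms]) (use XY in auto)
  have eqL: "res x = res y \<longleftrightarrow> x - y \<in> L" for x y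
    using ideal.rcos_eq_iff[OF ideal_L, of x y] by (simp add: a_minus_def)
  have "cls x = cls y \<longleftrightarrow> res x \<ominus>\<^bsub>S\<^esub> res y \<in> K"
    unfolding cls_def by (rule ideal.rcos_eq_iff[OF ideal_K]) (auto simp: carrier_S)
  also have "res x \<ominus>\<^bsub>S\<^esub> res y = res (x - y)"
    using h.hom_add[of x "- y"] h.hom_a_inv[of y] by (simp add: a_minus_def)
  also have "res (x - y) \<in> K \<longleftrightarrow> x - y \<in> Idl\<^bsub>type_ring\<^esub> (X \<union> Y)"
  proof
    assume "res (x - y) \<in> K"
    moreover have "K \<subseteq> res ` (Idl\<^bsub>type_ring\<^esub> (X \<union> Y))"
      unfolding K_def
    proof (rule ring.genideal_minimal[OF h.S.ring_axioms])
      show "ideal (res ` (Idl\<^bsub>type_ring\<^esub> (X \<union> Y))) S"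
        unfolding S_def
        by (rule ring.ring_ideal_imp_quot_ideal[OF ring_type_ring ideal_L])
           (simp add: ideal_type_ring_iff J.two_sided_axioms)
    qed (use XY in auto)
    ultimately obtain z where "z \<in> Idl\<^bsub>type_ring\<^esub> (X \<union> Y)" "(x - y) - z \<in> L"
      using eqL by auto
    then show "x - y \<in> Idl\<^bsub>type_ring\<^esub> (X \<union> Y)"
      using J.add_mem[of "x - y - z" z] L by auto
  next
    assume xy: "x - y \<in> Idl\<^bsub>type_ring\<^esub> (X \<union> Y)"
    have "ideal {r \<in> carrier type_ring. res r \<in> K} type_ring"
      using h.ideal_vimage[OF ideal_K] .
    moreover have "res r \<in> K" if "r \<in> X" for r
    proof -
      have "r \<in> L" using that Idl_type_ring_self[of X] by (auto simp: L_def)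
      then have "res r = res 0" using eqL[of r 0] by simp
      also have "\<dots> = \<zero>\<^bsub>S\<^esub>" using h.hom_zero by simp
      finally show ?thesis
        using additive_subgroup.zero_closed[OF ideal.axioms(1)[OF ideal_K]] by simp
    qed
    moreover have "res r \<in> K" if "r \<in> Y" for r
      using ring.genideal_self[OF h.S.ring_axioms, of "res ` Y"] that
      by (auto simp: K_def carrier_S)
    ultimately have "Idl\<^bsub>type_ring\<^esub> (X \<union> Y) \<subseteq> {r. res r \<in> K}"
      by (intro Idl_type_ring_minimal) (auto simp: ideal_type_ring_iff)
    then show "res (x - y) \<in> K" using xy by auto
  qed
  finally show ?thesis .
qed

end

section \<open>Linear extension and free algebras\<close>

definition lin_ext :: "('k::field \<Rightarrow> 'w::ab_group_add \<Rightarrow> 'w) \<Rightarrow> ('t \<Rightarrow> 'w) \<Rightarrow> ('t \<Rightarrow>\<^sub>0 'k) \<Rightarrow> 'w" where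
  "lin_ext sW g x = (\<Sum>t \<in> Poly_Mapping.keys x. sW (Poly_Mapping.lookup x t) (g t))"

lemma poly_mapping_add_induct [case_names zero add_single]:
  assumes "P 0"
    and "\<And>x t c. P x \<Longrightarrow> P (x + Poly_Mapping.single t c)"
  shows "P (x :: 't \<Rightarrow>\<^sub>0 'k::field)"
proof (induction x rule: update_induct)
  case const
  then show ?case by (rule assms(1))
next
  case (update f a b)
  have "Poly_Mapping.update a b f = f + Poly_Mapping.single a b"
    using update(1) by (intro poly_mapping_eqI)
      (auto simp: lookup_update lookup_add lookup_single when_def in_keys_iff)
  then show ?case using assms(2)[OF update(3)] by simp
qed

context vector_space begin

lemma lin_ext_superset:
  assumes "finite S" "Poly_Mapping.keys x \<subseteq> S"
  shows "lin_ext scale g x = (\<Sum>t\<in>S. scale (Poly_Mapping.lookup x t) (g t))"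
  unfolding lin_ext_def using assms
  by (intro sum.mono_neutral_left) (auto simp: in_keys_iff)

lemma lin_ext_zero [simp]: "lin_ext scale g 0 = 0"
  by (simp add: lin_ext_def)

lemma lin_ext_single [simp]: "lin_ext scale g (Poly_Mapping.single t c) = scale c (g t)"
  by (cases "c = 0") (simp_all add: lin_ext_def)

lemma lin_ext_add [simp]: "lin_ext scale g (x + y) = lin_ext scale g x + lin_ext scale g y"
proof -
  let ?S = "Poly_Mapping.keys x \<union> Poly_Mapping.keys y"
  have "lin_ext scale g z = (\<Sum>t\<in>?S. scale (Poly_Mapping.lookup z t) (g t))"
    if "z \<in> {x, y, x + y}" for z
    using that keys_add[of x y] by (intro lin_ext_superset) auto
  then show ?thesis
    by (simp add: lookup_add scale_left_distrib sum.distrib)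
qed

lemma lin_ext_uminus [simp]: "lin_ext scale g (- x) = - lin_ext scale g x"
  using lin_ext_add[of g x "- x"] by (simp add: eq_neg_iff_add_eq_0 add.commute del: lin_ext_add)

lemma lin_ext_diff [simp]: "lin_ext scale g (x - y) = lin_ext scale g x - lin_ext scale g y"
  using lin_ext_add[of g x "- y"] by simp

lemma lin_ext_sum [simp]: "lin_ext scale g (sum f S) = (\<Sum>s\<in>S. lin_ext scale g (f s))"
  by (induction S rule: infinite_finite_induct) auto

lemma lin_ext_scalar_mult [simp]:
  "lin_ext scale g (scalar c * x) = scale c (lin_ext scale g (x :: 't::monoid_add \<Rightarrow>\<^sub>0 'a))"
  by (induction x rule: poly_mapping_add_induct)
     (simp_all add: distrib_left mult_single scale_right_distrib)

end

lemma scalar_mult_commute: "scalar c * x = x * scalar (c :: 'k::field)"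
  by (induction x rule: poly_mapping_add_induct)
     (simp_all add: distrib_left distrib_right mult_single mult.commute)

lemma scalar_mult_left_commute: "x * (scalar c * y) = scalar (c :: 'k::field) * (x * y)"
  using scalar_mult_commute[of c x] by (simp flip: mult.assoc)

lemma vector_space_scalar: "vector_space (\<lambda>c. (*) (scalar c :: 't::monoid_add \<Rightarrow>\<^sub>0 'k::field))"
  by unfold_locales (simp_all add: algebra_simps single_add mult_single flip: mult.assoc)

lemma word_elt_append: "word_elt (u @ w) = word_elt u * word_elt w"
  by (simp add: word_elt_def mult_single)

lemma word_elt_Nil: "word_elt [] = 1"
  by (simp add: word_elt_def flip: zero_word_def)

lemma word_elt_Cons: "word_elt (x # w) = letter x * word_elt w"
  using word_elt_append[of "[x]" w] by simp

lemma single_word: "Poly_Mapping.single (Word w) c = scalar c * word_elt w"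
  by (simp add: word_elt_def mult_single)

lemma free_alg_induct [case_names scalar add mult_letter]:
  fixes x :: "('x, 'k::field) free_alg"
  assumes scalar: "\<And>c. P (scalar c)"
    and add: "\<And>x y. \<lbrakk>P x; P y\<rbrakk> \<Longrightarrow> P (x + y)"
    and mult: "\<And>l x. P x \<Longrightarrow> P (letter l * x)"
  shows "P x"
proof (induction x rule: poly_mapping_add_induct)
  case zero
  then show ?case using scalar[of 0] by simp
next
  case (add_single x t c)
  obtain w where t: "t = Word w" by (cases t)
  have "P (scalar c * word_elt w)"
  proof (induction w)
    case Nil
    then show ?case by (simp add: word_elt_Nil scalar)
  next
    case (Cons l w)
    have "scalar c * word_elt (l # w) = letter l * (scalar c * word_elt w)"
      using scalar_mult_commute[of c "letter l"]
      by (simp add: word_elt_Cons[of l w] flip: mult.assoc)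
    then show ?case using mult[OF Cons] by simp
  qed
  then show ?case using add[OF add_single] by (simp add: t single_word)
qed

section \<open>The grading of the free algebra by degree in V\<close>

interpretation free: vector_space "\<lambda>c. (*) (scalar c :: 't::monoid_add \<Rightarrow>\<^sub>0 'k::field)"
  by (rule vector_space_scalar)

text \<open>The coefficient of \<open>t\<^sup>n\<close> in the image of a word under the homomorphism that sends
  \<open>letter (v, a)\<close> to \<open>letA a + t letV v\<close>.\<close>

fun word_component :: "nat \<Rightarrow> ('v::zero \<times> 'a::zero) list \<Rightarrow> ('v \<times> 'a, 'k::field) free_alg" where
  "word_component n [] = (if n = 0 then 1 else 0)"
| "word_component 0 (l # w) = letA (snd l) * word_component 0 w"
| "word_component (Suc n) (l # w) =
     letA (snd l) * word_component (Suc n) w + letV (fst l) * word_component n w"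

definition component ::
    "nat \<Rightarrow> ('v::zero \<times> 'a::zero, 'k::field) free_alg \<Rightarrow> ('v \<times> 'a, 'k) free_alg" where
  "component n = lin_ext (\<lambda>c. (*) (scalar c)) (\<lambda>w. word_component n (case w of Word u \<Rightarrow> u))"

lemma component_simps [simp]:
  "component n 0 = 0"
  "component n (x + y) = component n x + component n y"
  "component n (x - y) = component n x - component n y"
  "component n (- x) = - component n x"
  "component n (sum f S) = (\<Sum>s\<in>S. component n (f s))"
  "component n (scalar c * x) = scalar c * component n x"
  by (simp_all add: component_def)

lemma component_word: "component n (word_elt w) = word_component n w"
  by (simp add: component_def word_elt_def)

lemma component_one [simp]: "component n 1 = (if n = 0 then 1 else 0)"
  using component_word[of n "[]"] by (simp add: word_elt_Nil)

lemma component_scalar [simp]: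
  fixes c :: "'k::field"
  shows "component n (scalar c :: ('v::zero \<times> 'a::zero, 'k) free_alg) = (if n = 0 then scalar c else 0)"
  using component_simps(6)[of n c "1 :: ('v \<times> 'a, 'k) free_alg"] by (simp del: component_simps)

lemma component_letter_mult:
  "component 0 (letter (v, a) * x) = letA a * component 0 x"
  "component (Suc n) (letter (v, a) * x) = letA a * component (Suc n) x + letV v * component n x"
proof -
  have "component 0 (letter (v, a) * x) = letA a * component 0 x \<and>
        component (Suc n) (letter (v, a) * x) = letA a * component (Suc n) x + letV v * component n x"
  proof (induction x rule: poly_mapping_add_induct)
    case (add_single x t c)
    obtain w where t: "t = Word w" by (cases t)
    have "component m (letter (v, a) * Poly_Mapping.single t c) =
          scalar c * word_component m ((v, a) # w)" for m
      by (simp only: t single_word scalar_mult_left_commute word_elt_Cons[symmetric] component_simps component_word)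
    note single = this
    have "component m (Poly_Mapping.single t c) = scalar c * word_component m w" for m
      by (simp only: t single_word component_simps component_word)
    then show ?case
      using add_single by (simp add: distrib_left single scalar_mult_left_commute)
  qed simp
  then show "component 0 (letter (v, a) * x) = letA a * component 0 x"
    "component (Suc n) (letter (v, a) * x) = letA a * component (Suc n) x + letV v * component n x"
    by auto
qed

lemma component_letter:
  "component n (letter (v, a)) = (if n = 0 then letA a else if n = 1 then letV v else 0)"
proof (cases n)
  case 0
  then show ?thesis using component_letter_mult(1)[of v a 1] by simp
next
  case (Suc m)
  then show ?thesis
    using component_letter_mult(2)[where v = v and a = a and x = 1 and n = m]
    by (cases "m = 0") simp_all
qed

lemma component_mult: "component n (x * y) = (\<Sum>i\<le>n. component i x * component (n - i) y)"
proof (induction x arbitrary: n rule: free_alg_induct)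
  case (scalar c)
  have "(\<Sum>i\<le>n. component i (scalar c) * component (n - i) y) =
        (\<Sum>i\<le>n. if i = 0 then scalar c * component n y else 0)"
    by (rule sum.cong) auto
  then show ?case by simp
next
  case (add x x')
  then show ?case by (simp add: distrib_right sum.distrib)
next
  case (mult_letter l x)
  obtain v a where l: "l = (v, a)" by (cases l)
  show ?case
  proof (cases n)
    case 0
    then show ?thesis using mult_letter[of 0] by (simp add: l component_letter_mult mult.assoc)
  next
    case (Suc m)
    have "component n (letter l * x * y) =
        letA a * (\<Sum>i\<le>Suc m. component i x * component (Suc m - i) y) +
        letV v * (\<Sum>i\<le>m. component i x * component (m - i) y)"
      using mult_letter[of "Suc m"] mult_letter[of m]
      by (simp add: Suc l component_letter_mult mult.assoc)
    also have "\<dots> = (\<Sum>i\<le>Suc m. component i (letter l * x) * component (Suc m - i) y)"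
      unfolding sum.atMost_Suc_shift
      by (simp add: l component_letter_mult distrib_left distrib_right sum.distrib mult.assoc
            sum_distrib_left del: sum.atMost_Suc)
    finally show ?thesis by (simp only: Suc)
  qed
qed

locale H_setup = algebra_module sA sV act
  for sA :: "'k::field \<Rightarrow> 'a::ring_1 \<Rightarrow> 'a" and sV :: "'k \<Rightarrow> 'v::ab_group_add \<Rightarrow> 'v" and act +
  fixes \<Delta> :: "'a \<Rightarrow> ('a pure_tensor \<Rightarrow>\<^sub>0 'k) set"
begin

abbreviation Lin :: "('v \<times> 'a, 'k) free_alg set" where "Lin \<equiv> linear_ideal sA sV"

sublocale Lin: two_sided Lin
  unfolding linear_ideal_def by (rule two_sided_Idl)

lemma linear_rels_subset_Lin: "linear_rels sA sV \<subseteq> Lin"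
  unfolding linear_ideal_def by (rule Idl_type_ring_self)

lemma letter_add: "Lin.equ (letter (v + v', a + a')) (letter (v, a) + letter (v', a'))"
  using linear_rels_subset_Lin linear_rels.intros(1)[of v v' a a'] by (auto simp: Lin.equ_def diff_diff_eq)

lemma letter_scale: "Lin.equ (letter (sV c v, sA c a)) (scalar c * letter (v, a))"
  using linear_rels_subset_Lin linear_rels.intros(2) unfolding Lin.equ_def by blast

lemma letter_split: "Lin.equ (letter (v, a)) (letV v + letA a)"
  using letter_add[of v 0 0 a] by simp

lemma letA_add: "Lin.equ (letA (a + b)) (letA a + letA b)"
  using letter_add[of 0 0 a b] by simp

lemma letV_add: "Lin.equ (letV (v + w)) (letV v + letV w)"
  using letter_add[of v w 0 0] by simp

lemma letA_scale: "Lin.equ (letA (sA c a)) (scalar c * letA a)"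
  using letter_scale[of c 0 a] by simp

lemma letV_scale: "Lin.equ (letV (sV c v)) (scalar c * letV v)"
  using letter_scale[of c v 0] by simp

lemma letter_zero: "letter (0, 0) \<in> Lin"
  using letter_add[of 0 0 0 0] Lin.uminus_mem by (fastforce simp: Lin.equ_def)

lemma letA_sum: "Lin.equ (letA (sum f S)) (\<Sum>s\<in>S. letA (f s))"
proof (induction S rule: infinite_finite_induct)
  case (insert s S)
  then show ?case
    using Lin.equ_trans[OF letA_add Lin.equ_add[OF Lin.equ_refl insert(3)]] by simp
qed (simp_all add: letter_zero Lin.equ_zero_iff)

text \<open>Setting \<open>t = 1\<close> sends \<open>letter (v, a)\<close> to \<open>letA a + letV v\<close>, which differs from it by a linear
  relation. The bound makes sure that finitely many components are involved.\<close>

lemma component_sum_equ: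
  "\<exists>N. \<forall>M\<ge>N. component (Suc M) x = 0 \<and> Lin.equ x (\<Sum>n\<le>M. component n x)"
proof (induction x rule: free_alg_induct)
  case (scalar c)
  have "(\<Sum>n\<le>M. component n (scalar c)) = (\<Sum>n\<le>M. if n = 0 then scalar c else 0)" for M
    by (rule sum.cong) auto
  then show ?case by (intro exI[of _ 0]) simp
next
  case (add x y)
  then obtain N N' where
    N: "\<And>M. M \<ge> N \<Longrightarrow> component (Suc M) x = 0"
      "\<And>M. M \<ge> N \<Longrightarrow> Lin.equ x (\<Sum>n\<le>M. component n x)" and
    N': "\<And>M. M \<ge> N' \<Longrightarrow> component (Suc M) y = 0"
      "\<And>M. M \<ge> N' \<Longrightarrow> Lin.equ y (\<Sum>n\<le>M. component n y)"
    by blast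
  show ?case
    unfolding component_simps sum.distrib
    using N N' by (intro exI[of _ "max N N'"] allI impI conjI Lin.equ_add) auto
next
  case (mult_letter l x)
  obtain v a where l: "l = (v, a)" by (cases l)
  obtain N where N: "\<And>M. M \<ge> N \<Longrightarrow> component (Suc M) x = 0"
    "\<And>M. M \<ge> N \<Longrightarrow> Lin.equ x (\<Sum>n\<le>M. component n x)"
    using mult_letter by blast
  show ?case
  proof (intro exI[of _ "Suc N"] allI impI conjI)
    fix M assume "Suc N \<le> M"
    then obtain M' where M: "M = Suc M'" "N \<le> M'" by (cases M) auto
    show "component (Suc M) (letter l * x) = 0"
      using N(1)[of M] N(1)[of M'] M by (simp add: l component_letter_mult)
    have "Lin.equ (letter l * x) ((letV v + letA a) * x)"
      unfolding l by (rule Lin.equ_mult_right[OF letter_split])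
    also have "(letV v + letA a) * x = letA a * x + letV v * x"
      by (simp add: distrib_right)
    also have "Lin.equ \<dots> (letA a * (\<Sum>n\<le>M. component n x) + letV v * (\<Sum>n\<le>M'. component n x))"
      using N(2)[of M] N(2)[of M'] M by (intro Lin.equ_add Lin.equ_mult_left) auto
    also have "\<dots> = (\<Sum>n\<le>M. component n (letter l * x))"
      unfolding M(1) sum.atMost_Suc_shift
      by (simp add: l component_letter_mult distrib_left sum.distrib sum_distrib_left)
    finally show "Lin.equ (letter l * x) (\<Sum>n\<le>M. component n (letter l * x))" .
  qed
qed

text \<open>The components of a linear relation are the linear relations for its \<open>A\<close>-part and for its
  \<open>V\<close>-part, so the tensor algebra inherits the grading.\<close>

lemma component_Lin:
  assumes "x \<in> Lin" shows "component n x \<in> Lin"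
proof -
  let ?S = "{x. \<forall>n. component n x \<in> Lin}"
  have "two_sided ?S"
    by unfold_locales
       (auto simp: component_mult Lin.zero_mem intro!: Lin.sum_mem
         intro: Lin.add_mem Lin.mult_mem_left Lin.mult_mem_right)
  moreover have "linear_rels sA sV \<subseteq> ?S"
  proof safe
    fix r :: "('v \<times> 'a, 'k) free_alg" and n
    assume "r \<in> linear_rels sA sV"
    then show "component n r \<in> Lin"
    proof cases
      case (1 v v' a a')
      then show ?thesis
        using letA_add[of a a'] letV_add[of v v'] by (simp add: component_letter Lin.zero_mem Lin.equ_def diff_diff_eq)
    next
      case (2 c v a)
      then show ?thesis
        using letA_scale[of c a] letV_scale[of c v] by (simp add: component_letter Lin.zero_mem Lin.equ_def)
    qed
  qed
  ultimately have "Lin \<subseteq> ?S"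
    unfolding linear_ideal_def[of sA sV] by (rule Idl_type_ring_minimal)
  then show ?thesis using assms by auto
qed

text \<open>Homogeneity is only asked for modulo the linear relations: already \<open>letA a\<close> has the
  component \<open>letter (0, 0)\<close> in degree 1, which vanishes in the tensor algebra but not in the free
  algebra.\<close>

definition homogeneous :: "nat \<Rightarrow> ('v \<times> 'a, 'k) free_alg \<Rightarrow> bool" where
  "homogeneous k x \<longleftrightarrow> (\<forall>n. Lin.equ (component n x) (if n = k then x else 0))"

lemma homogeneous_zero: "homogeneous k 0"
  by (simp add: homogeneous_def)

lemma homogeneous_add:
  assumes "homogeneous k x" "homogeneous k y"
  shows "homogeneous k (x + y)"
  unfolding homogeneous_def component_simps
proof
  fix n
  show "Lin.equ (component n x + component n y) (if n = k then x + y else 0)"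
    using Lin.equ_add[of "component n x" "if n = k then x else 0" "component n y" "if n = k then y else 0"]
      assms[unfolded homogeneous_def, THEN spec, of n] by (cases "n = k") simp_all
qed

lemma homogeneous_diff:
  assumes "homogeneous k x" "homogeneous k y"
  shows "homogeneous k (x - y)"
  unfolding homogeneous_def component_simps
proof
  fix n
  show "Lin.equ (component n x - component n y) (if n = k then x - y else 0)"
    using Lin.equ_diff[of "component n x" "if n = k then x else 0" "component n y" "if n = k then y else 0"]
      assms[unfolded homogeneous_def, THEN spec, of n] by (cases "n = k") simp_all
qed

lemma homogeneous_sum: "(\<And>i. i \<in> S \<Longrightarrow> homogeneous k (f i)) \<Longrightarrow> homogeneous k (sum f S)"
  by (induction S rule: infinite_finite_induct)
     (simp_all add: homogeneous_zero homogeneous_add del: component_simps)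

lemma homogeneous_scalar: "homogeneous 0 (scalar c)"
  by (simp add: homogeneous_def)

lemma homogeneous_Lin: "x \<in> Lin \<Longrightarrow> homogeneous k x"
  using component_Lin by (auto simp: homogeneous_def Lin.equ_def intro: Lin.diff_mem)

lemma homogeneous_letA: "homogeneous 0 (letA a)"
  unfolding homogeneous_def
proof
  fix n show "Lin.equ (component n (letA a)) (if n = 0 then letA a else 0)"
    by (simp add: component_letter letter_zero Lin.zero_mem Lin.equ_zero_iff)
qed

lemma homogeneous_letV: "homogeneous 1 (letV v)"
  unfolding homogeneous_def
proof
  fix n show "Lin.equ (component n (letV v)) (if n = 1 then letV v else 0)"
    by (simp add: component_letter letter_zero Lin.zero_mem Lin.equ_zero_iff)
qed

lemma homogeneous_mult:
  assumes "homogeneous k x" "homogeneous l y"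
  shows "homogeneous (k + l) (x * y)"
  unfolding homogeneous_def
proof
  fix n
  have "Lin.equ (\<Sum>i\<le>n. component i x * component (n - i) y)
     (\<Sum>i\<le>n. (if i = k then x else 0) * (if n - i = l then y else 0))"
    using assms unfolding homogeneous_def by (intro Lin.equ_sum Lin.equ_mult) blast+
  also have "(\<Sum>i\<le>n. (if i = k then x else 0) * (if n - i = l then y else 0)) =
      (\<Sum>i\<le>n. if i = k then (if n = k + l then x * y else 0) else 0)"
    by (rule sum.cong) auto
  also have "\<dots> = (if n = k + l then x * y else 0)"
    by simp
  finally show "Lin.equ (component n (x * y)) (if n = k + l then x * y else 0)"
    by (simp add: component_mult)
qed

lemma homogeneous_component: "homogeneous n (component n x)"
proof (induction x arbitrary: n rule: free_alg_induct)
  case (scalar c)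
  then show ?case by (simp add: homogeneous_scalar homogeneous_zero)
next
  case (add x y)
  then show ?case by (simp add: homogeneous_add)
next
  case (mult_letter l x)
  obtain v a where l: "l = (v, a)" by (cases l)
  show ?case
    using homogeneous_mult[OF homogeneous_letA mult_letter]
      homogeneous_mult[OF homogeneous_letV mult_letter]
    by (cases n) (auto simp: l component_letter_mult intro!: homogeneous_add)
qed

end

section \<open>The PBW property in terms of homogeneous components\<close>

definition H_kernel ::
    "('k::field \<Rightarrow> 'a::ring_1 \<Rightarrow> 'a) \<Rightarrow> ('k \<Rightarrow> 'v::ab_group_add \<Rightarrow> 'v) \<Rightarrow> ('a \<Rightarrow> 'v \<Rightarrow> 'v) \<Rightarrow>
     ('a \<Rightarrow> ('a pure_tensor \<Rightarrow>\<^sub>0 'k) set) \<Rightarrow> ('v \<Rightarrow> 'v \<Rightarrow> 'v) \<Rightarrow> ('v \<Rightarrow> 'v \<Rightarrow> 'a) \<Rightarrow>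
     ('v \<times> 'a, 'k) free_alg set" where
  "H_kernel sA sV act \<Delta> \<kappa>V \<kappa>A = Idl\<^bsub>type_ring\<^esub> (linear_rels sA sV \<union> H_rels act \<Delta> \<kappa>V \<kappa>A)"

locale H_deformation = H_setup sA sV act \<Delta>
  for sA :: "'k::field \<Rightarrow> 'a::ring_1 \<Rightarrow> 'a" and sV :: "'k \<Rightarrow> 'v::ab_group_add \<Rightarrow> 'v" and act \<Delta> +
  fixes \<kappa>V :: "'v \<Rightarrow> 'v \<Rightarrow> 'v" and \<kappa>A :: "'v \<Rightarrow> 'v \<Rightarrow> 'a"
begin

abbreviation "J \<equiv> H_kernel sA sV act \<Delta> \<kappa>V \<kappa>A"
abbreviation "J0 \<equiv> H_kernel sA sV act \<Delta> (\<lambda>_ _. 0) (\<lambda>_ _. 0)"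
abbreviation "H \<equiv> H_alg sA sV act \<Delta> \<kappa>V \<kappa>A"
abbreviation "H0 \<equiv> H_alg sA sV act \<Delta> (\<lambda>_ _. 0) (\<lambda>_ _. 0)"
abbreviation "cls \<equiv> H_cls sA sV act \<Delta> \<kappa>V \<kappa>A"
abbreviation "cls0 \<equiv> H_cls sA sV act \<Delta> (\<lambda>_ _. 0) (\<lambda>_ _. 0)"
abbreviation "F \<equiv> H_filt sA sV act \<Delta> \<kappa>V \<kappa>A"

sublocale J: two_sided J
  unfolding H_kernel_def by (rule two_sided_Idl)

sublocale J0: two_sided J0
  unfolding H_kernel_def by (rule two_sided_Idl)

lemma cls_hom: "ring_hom_ring type_ring H cls"
  using iterated_quotient.cls_hom[of "linear_rels sA sV" "H_rels act \<Delta> \<kappa>V \<kappa>A"]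
  unfolding H_alg_def H_ideal_def tensor_algebra_def linear_ideal_def H_cls_def[abs_def] .

lemma carrier_H: "carrier H = range cls"
  using iterated_quotient.carrier_Q[of "linear_rels sA sV" "H_rels act \<Delta> \<kappa>V \<kappa>A"]
  unfolding H_alg_def H_ideal_def tensor_algebra_def linear_ideal_def H_cls_def[abs_def] .

lemma cls_eq_iff: "cls x = cls y \<longleftrightarrow> J.equ x y"
  using iterated_quotient.cls_eq_iff[of "linear_rels sA sV" "H_rels act \<Delta> \<kappa>V \<kappa>A"]
  unfolding J.equ_def
  unfolding H_kernel_def H_alg_def H_ideal_def tensor_algebra_def linear_ideal_def H_cls_def[abs_def] .

sublocale cls: ring_hom_ring type_ring H cls
  by (rule cls_hom)

lemma cls_simps:
  "cls 1 = \<one>\<^bsub>H\<^esub>" "cls 0 = \<zero>\<^bsub>H\<^esub>" "cls (x + y) = cls x \<oplus>\<^bsub>H\<^esub> cls y"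
  "cls (x * y) = cls x \<otimes>\<^bsub>H\<^esub> cls y" "cls (- x) = \<ominus>\<^bsub>H\<^esub> cls x"
  using cls.hom_one cls.hom_zero cls.hom_add[of x y] cls.hom_mult[of x y] cls.hom_a_inv[of x]
  by simp_all

lemma cls_sum:
  assumes "finite S" shows "cls (sum f S) = (\<Oplus>\<^bsub>H\<^esub>s\<in>S. cls (f s))"
  using assms
proof (induction S)
  case (insert s S)
  have "(\<lambda>s. cls (f s)) \<in> insert s S \<rightarrow> carrier H" by (auto simp: carrier_H)
  then show ?case using insert by (simp add: cls_simps cls.S.add.finprod_insert carrier_H)
qed (simp add: cls_simps)

lemma linear_rels_J: "linear_rels sA sV \<subseteq> J"
  and H_rels_J: "H_rels act \<Delta> \<kappa>V \<kappa>A \<subseteq> J"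
  using Idl_type_ring_self[of "linear_rels sA sV \<union> H_rels act \<Delta> \<kappa>V \<kappa>A"]
  unfolding H_kernel_def by auto

lemma Lin_J: "Lin \<subseteq> J"
  unfolding linear_ideal_def
  by (rule Idl_type_ring_minimal[OF J.two_sided_axioms linear_rels_J])

lemma Lin_equ_J: "Lin.equ x y \<Longrightarrow> J.equ x y"
  using Lin_J by (auto simp: Lin.equ_def J.equ_def)

lemma J_minimal:
  "\<lbrakk>two_sided I; linear_rels sA sV \<subseteq> I; H_rels act \<Delta> \<kappa>V \<kappa>A \<subseteq> I\<rbrakk> \<Longrightarrow> J \<subseteq> I"
  unfolding H_kernel_def by (rule Idl_type_ring_minimal) auto

lemma letA_one: "J.equ (letA 1) 1"
  unfolding J.equ_def using H_rels_J H_rels.unit by blast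

lemma letA_mult: "J.equ (letA a * letA b) (letA (a * b))"
  unfolding J.equ_def using H_rels_J H_rels.mult by blast

lemma scalar_J: "J.equ (scalar c) (letA (sA c 1))"
proof -
  have "J.equ (scalar c * 1) (scalar c * letA 1)"
    by (rule J.equ_mult_left[OF J.equ_sym[OF letA_one]])
  also have "J.equ \<dots> (letA (sA c 1))"
    by (rule J.equ_sym[OF Lin_equ_J[OF letA_scale]])
  finally show ?thesis by simp
qed

text \<open>The preimages in the free algebra of the filtration and of its predecessor, so that the
  associated graded ring can be treated through representatives.\<close>

definition Fil :: "nat \<Rightarrow> ('v \<times> 'a, 'k) free_alg set" where
  "Fil n = {x. cls x \<in> F n}"

definition Below :: "nat \<Rightarrow> ('v \<times> 'a, 'k) free_alg set" where
  "Below n = (case n of 0 \<Rightarrow> J | Suc k \<Rightarrow> Fil k)"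

lemma Fil_cong: "J.equ x y \<Longrightarrow> x \<in> Fil n \<longleftrightarrow> y \<in> Fil n"
  by (simp add: Fil_def flip: cls_eq_iff)

lemma Fil_letA: "letA a \<in> Fil 0"
  and Fil_letV: "letV v \<in> Fil 1"
  and Fil_one: "1 \<in> Fil 0"
  and Fil_Suc: "x \<in> Fil n \<Longrightarrow> x \<in> Fil (Suc n)"
  and Fil_uminus: "x \<in> Fil n \<Longrightarrow> - x \<in> Fil n"
  and Fil_add: "x \<in> Fil n \<Longrightarrow> y \<in> Fil n \<Longrightarrow> x + y \<in> Fil n"
  and Fil_mult: "x \<in> Fil n \<Longrightarrow> y \<in> Fil k \<Longrightarrow> x * y \<in> Fil (n + k)"
  unfolding Fil_def H_filt_def cls_simps mem_Collect_eq
  by (auto intro: filt.intros filt.intros(3)[unfolded One_nat_def])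

lemma Fil_mono: "x \<in> Fil m \<Longrightarrow> m \<le> n \<Longrightarrow> x \<in> Fil n"
  by (induction n) (auto simp: le_Suc_eq intro: Fil_Suc)

lemma J_Fil: "x \<in> J \<Longrightarrow> x \<in> Fil n"
  using Fil_add[OF Fil_one Fil_uminus[OF Fil_one]] Fil_mono[of 0 0 n] Fil_cong[of x 0 n]
  by (simp add: J.equ_zero_iff)

lemma Fil_diff: "x \<in> Fil n \<Longrightarrow> y \<in> Fil n \<Longrightarrow> x - y \<in> Fil n"
  using Fil_add[OF _ Fil_uminus, of x n y] by simp

lemma Fil_scalar: "scalar c \<in> Fil 0"
  using Fil_cong[OF scalar_J] Fil_letA by blast

lemma Fil_induct [consumes 1, case_names equ one letA letV Suc uminus add mult]:
  assumes "x \<in> Fil n"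
    and equ: "\<And>n x y. J.equ x y \<Longrightarrow> P n x \<Longrightarrow> P n y"
    and one: "P 0 1"
    and letA: "\<And>a. P 0 (letA a)"
    and letV: "\<And>v. P 1 (letV v)"
    and Suc: "\<And>n x. P n x \<Longrightarrow> P (Suc n) x"
    and uminus: "\<And>n x. P n x \<Longrightarrow> P n (- x)"
    and add: "\<And>n x y. P n x \<Longrightarrow> P n y \<Longrightarrow> P n (x + y)"
    and mult: "\<And>n k x y. P n x \<Longrightarrow> P k y \<Longrightarrow> P (n + k) (x * y)"
  shows "P n x"
proof -
  have "\<exists>y. X = cls y \<and> P n y"
    if "filt H (range (\<lambda>a. cls (letA a))) (range (\<lambda>v. cls (letV v))) n X" for X
    using that
  proof (induction n X)
    case (7 n x k y)
    then show ?case by (metis cls_simps(4) mult)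
  next
    case (6 n x y)
    then show ?case by (metis cls_simps(3) add)
  next
    case (5 n x)
    then show ?case by (metis cls_simps(5) uminus)
  next
    case 1
    then show ?case by (metis cls_simps(1) one)
  qed (use letA letV Suc in auto)
  then obtain y where "cls x = cls y" "P n y"
    using assms(1) by (auto simp: Fil_def H_filt_def)
  then show ?thesis using equ[of y x n] J.equ_sym by (simp add: cls_eq_iff)
qed

lemma J_Below: "x \<in> J \<Longrightarrow> x \<in> Below n"
  by (cases n) (auto simp: Below_def J_Fil)

lemma Below_Fil: "x \<in> Below n \<Longrightarrow> x \<in> Fil n"
  by (cases n) (auto simp: Below_def J_Fil Fil_Suc)

lemma Below_add: "x \<in> Below n \<Longrightarrow> y \<in> Below n \<Longrightarrow> x + y \<in> Below n"
  by (cases n) (auto simp: Below_def J.add_mem Fil_add)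

lemma Below_uminus: "x \<in> Below n \<Longrightarrow> - x \<in> Below n"
  by (cases n) (auto simp: Below_def J.uminus_mem Fil_uminus)

lemma Below_diff: "x \<in> Below n \<Longrightarrow> y \<in> Below n \<Longrightarrow> x - y \<in> Below n"
  using Below_add[OF _ Below_uminus, of x n y] by simp

lemma Below_sum: "(\<And>s. s \<in> S \<Longrightarrow> f s \<in> Below n) \<Longrightarrow> sum f S \<in> Below n"
  by (induction S rule: infinite_finite_induct) (auto intro: Below_add J_Below J.zero_mem)

lemma Below_cong: "J.equ x y \<Longrightarrow> x \<in> Below n \<longleftrightarrow> y \<in> Below n"
  using Fil_cong J.mem_cong[of x y] by (cases n) (auto simp: Below_def J.equ_def)

lemma Below_mult_left: "x \<in> Fil k \<Longrightarrow> y \<in> Below n \<Longrightarrow> x * y \<in> Below (k + n)"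
  using Fil_mult[of x k y "n - 1"]
  by (cases n) (auto simp: Below_def J.mult_mem_left intro: J_Below[unfolded Below_def])

lemma Below_mult_right: "x \<in> Below n \<Longrightarrow> y \<in> Fil k \<Longrightarrow> x * y \<in> Below (n + k)"
  using Fil_mult[of x "n - 1" y k]
  by (cases n) (auto simp: Below_def J.mult_mem_right intro: J_Below[unfolded Below_def])

lemma component_Fil: "component n x \<in> Fil n"
proof (induction x arbitrary: n rule: free_alg_induct)
  case (scalar c)
  then show ?case by (simp add: Fil_scalar J_Fil J.zero_mem)
next
  case (add x y)
  then show ?case by (simp add: Fil_add)
next
  case (mult_letter l x)
  obtain v a where l: "l = (v, a)" by (cases l)
  show ?case
    using Fil_mult[OF Fil_letA mult_letter] Fil_mult[OF Fil_letV mult_letter]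
    by (cases n) (auto simp: l component_letter_mult intro!: Fil_add)
qed

lemma homogeneous_Fil: "homogeneous n x \<Longrightarrow> x \<in> Fil n"
  using component_Fil[of n x] Fil_cong[OF Lin_equ_J, of "component n x" x n]
  unfolding homogeneous_def by presburger

lemma homogeneous_sweedler:
  "homogeneous 1 (letA a * letV v -
     (\<Sum>t \<in> Poly_Mapping.keys p. scalar (Poly_Mapping.lookup p t) * letV (act (left t) v) * letA (right t)))"
proof -
  have "homogeneous 1 (letA a * letV v)" for a v
    using homogeneous_mult[OF homogeneous_letA homogeneous_letV] by simp
  moreover have "homogeneous 1 (scalar c * letV v * letA a)" for c v a
    using homogeneous_mult[OF homogeneous_mult[OF homogeneous_scalar homogeneous_letV] homogeneous_letA]
    by simp
  ultimately show ?thesis by (intro homogeneous_diff homogeneous_sum)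
qed

text \<open>The relations of \<^const>\<open>H_alg\<close> for \<open>\<kappa> = 0\<close> are homogeneous. Components of elements of the
  kernel thus stay within any family of sets that contains these relations and is stable under
  multiplication by components. Two families matter: the kernel itself, which makes
  \<open>H\<^sub>0\<^sub>,\<^sub>0\<close> a graded algebra, and \<open>Below\<close>, which makes the map to the associated graded ring
  of \<open>H\<^sub>0\<^sub>,\<^sub>\<kappa>\<close> well defined.\<close>

lemma J0_component_mem:
  assumes "x \<in> J0"
    and add: "\<And>n x y. x \<in> D n \<Longrightarrow> y \<in> D n \<Longrightarrow> x + y \<in> D n"
    and multl: "\<And>n i x y. x \<in> D n \<Longrightarrow> component i y * x \<in> D (i + n)"
    and multr: "\<And>n i x y. x \<in> D n \<Longrightarrow> x * component i y \<in> D (n + i)"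
    and Lin: "\<And>n. Lin \<subseteq> D n"
    and rels: "\<And>r. r \<in> H_rels act \<Delta> (\<lambda>_ _. 0) (\<lambda>_ _. 0) \<Longrightarrow> \<exists>k. homogeneous k r \<and> r \<in> D k"
  shows "component n x \<in> D n"
proof -
  have sum: "sum f S \<in> D n" if "\<And>s. s \<in> S \<Longrightarrow> f s \<in> D n" for f and S :: "nat set" and n
    using that Lin[of n] Lin.zero_mem
    by (induction S rule: infinite_finite_induct) (auto intro: add)
  let ?S = "{x. \<forall>n. component n x \<in> D n}"
  have "two_sided ?S"
  proof
    show "0 \<in> ?S" using Lin Lin.zero_mem by auto
    show "x + y \<in> ?S" if "x \<in> ?S" "y \<in> ?S" for x y using that by (auto intro: add)
    show "y * x \<in> ?S" if "x \<in> ?S" for x y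
    proof safe
      fix n
      have "component i y * component (n - i) x \<in> D n" if "i \<le> n" for i
        using multl[of "component (n - i) x" "n - i" i y] \<open>x \<in> ?S\<close> that by auto
      then show "component n (y * x) \<in> D n" by (auto simp: component_mult intro!: sum)
    qed
    show "x * y \<in> ?S" if "x \<in> ?S" for x y
    proof safe
      fix n
      have "component i x * component (n - i) y \<in> D n" if "i \<le> n" for i
        using multr[of "component i x" i "n - i" y] \<open>x \<in> ?S\<close> that by auto
      then show "component n (x * y) \<in> D n" by (auto simp: component_mult intro!: sum)
    qed
  qed
  moreover have "linear_rels sA sV \<subseteq> ?S"
    using linear_rels_subset_Lin component_Lin Lin by blast
  moreover have "H_rels act \<Delta> (\<lambda>_ _. 0) (\<lambda>_ _. 0) \<subseteq> ?S"
  proof safe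
    fix r :: "('v \<times> 'a, 'k) free_alg" and n
    assume "r \<in> H_rels act \<Delta> (\<lambda>_ _. 0) (\<lambda>_ _. 0)"
    then obtain k where k: "homogeneous k r" "r \<in> D k" using rels by blast
    then have "Lin.equ (component n r) (if n = k then r else 0)"
      by (simp add: homogeneous_def)
    then have "component n r - (if n = k then r else 0) \<in> D n"
      using Lin unfolding Lin.equ_def by blast
    then show "component n r \<in> D n"
      using k(2) add[of "component n r - r" n r] by (cases "n = k") auto
  qed
  ultimately have "J0 \<subseteq> ?S"
    unfolding H_kernel_def by (intro Idl_type_ring_minimal) auto
  then show ?thesis using assms(1) by auto
qed

lemma Lin_J0: "Lin \<subseteq> J0"
  by (rule H_deformation.Lin_J) unfold_locales

lemma H_rels_J0: "H_rels act \<Delta> (\<lambda>_ _. 0) (\<lambda>_ _. 0) \<subseteq> J0"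
  by (rule H_deformation.H_rels_J) unfold_locales

lemma homogeneous_commutator:
  "homogeneous 2 (letV v * letV v' - letV v' * letV v - letter (0, 0))"
  using homogeneous_mult[OF homogeneous_letV homogeneous_letV] homogeneous_Lin[OF letter_zero]
  by (intro homogeneous_diff) (simp_all add: numeral_2_eq_2)

lemma homogeneous_H_rels0:
  "r \<in> H_rels act \<Delta> (\<lambda>_ _. 0) (\<lambda>_ _. 0) \<Longrightarrow> \<exists>k. homogeneous k r"
proof (induction rule: H_rels.induct)
  case unit
  then show ?case
    using homogeneous_diff[OF homogeneous_letA homogeneous_scalar[of 1]] by auto
next
  case (mult a b)
  then show ?case
    using homogeneous_diff[OF homogeneous_mult[OF homogeneous_letA homogeneous_letA, of a b, simplified]
        homogeneous_letA[of "a * b"]]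
    by blast
next
  case (sweedler p a v)
  then show ?case using homogeneous_sweedler by blast
next
  case (commutator v v')
  then show ?case using homogeneous_commutator by blast
qed

lemma J0_component_J0: "x \<in> J0 \<Longrightarrow> component n x \<in> J0"
  by (rule J0_component_mem[where D = "\<lambda>_. J0"])
     (use homogeneous_H_rels0 H_rels_J0 Lin_J0 in
        \<open>auto intro: J0.add_mem J0.mult_mem_left J0.mult_mem_right\<close>)

text \<open>The commutator is the only relation that the deformation changes. It is homogeneous of degree
  two, whereas the values of \<open>\<kappa>\<close> have degree at most one.\<close>

lemma J0_component_Below:
  assumes "x \<in> J0" shows "component n x \<in> Below n"
  using assms
proof (rule J0_component_mem)
  fix r :: "('v \<times> 'a, 'k) free_alg"
  assume r: "r \<in> H_rels act \<Delta> (\<lambda>_ _. 0) (\<lambda>_ _. 0)"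
  then show "\<exists>k. homogeneous k r \<and> r \<in> Below k"
  proof cases
    case (commutator v v')
    let ?l = "letter (\<kappa>V v v', \<kappa>A v v')"
    have "J.equ r ?l"
    proof -
      have "letV v * letV v' - letV v' * letV v - ?l \<in> J"
        using H_rels_J H_rels.commutator by blast
      then show ?thesis
        using J.diff_mem[OF _ subsetD[OF Lin_J letter_zero], of "letV v * letV v' - letV v' * letV v - ?l"]
        by (simp add: J.equ_def commutator diff_diff_eq add_ac)
    qed
    moreover have "?l \<in> Fil 1"
      using Fil_cong[OF Lin_equ_J[OF letter_split]] Fil_add[OF Fil_letV Fil_mono[OF Fil_letA]]
      by auto
    ultimately have "r \<in> Below 2"
      using Fil_cong by (auto simp: Below_def numeral_2_eq_2)
    then show ?thesis using homogeneous_commutator commutator by blast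
  next
    case unit
    then have "r \<in> J" using H_rels_J H_rels.unit by blast
    then show ?thesis using homogeneous_H_rels0[OF r] J_Below by blast
  next
    case (mult a b)
    then have "r \<in> J" using H_rels_J H_rels.mult by blast
    then show ?thesis using homogeneous_H_rels0[OF r] J_Below by blast
  next
    case (sweedler p a v)
    then have "r \<in> J" using H_rels_J H_rels.sweedler by blast
    then show ?thesis using homogeneous_H_rels0[OF r] J_Below by blast
  qed
qed (use Lin_J in \<open>auto intro: Below_add Below_mult_left Below_mult_right component_Fil J_Below\<close>)

lemma J0_from_components: "(\<And>n. component n x \<in> J0) \<Longrightarrow> x \<in> J0"
  using component_sum_equ[of x] Lin_J0 J0.sum_mem[of _ "\<lambda>n. component n x"] J0.mem_cong[of x]
  unfolding Lin.equ_def J0.equ_def by blast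

text \<open>The element of the \<open>n\<close>-th graded piece that is represented by \<open>x\<close>.\<close>

definition Coset :: "nat \<Rightarrow> ('v \<times> 'a, 'k) free_alg \<Rightarrow> ('v \<times> 'a, 'k) free_alg set set set" where
  "Coset n x = cls ` {y. y - x \<in> Below n}"

lemma cls_mem_Coset: "cls y \<in> Coset n x \<longleftrightarrow> y - x \<in> Below n"
proof
  assume "cls y \<in> Coset n x"
  then obtain z where z: "cls y = cls z" "z - x \<in> Below n" by (auto simp: Coset_def)
  then have "y - z \<in> Below n" using J_Below by (simp add: cls_eq_iff J.equ_def)
  then show "y - x \<in> Below n" using Below_add[OF _ z(2)] by force
qed (auto simp: Coset_def)

lemma Coset_eq_iff: "Coset n x = Coset n y \<longleftrightarrow> x - y \<in> Below n"
proof
  assume "Coset n x = Coset n y"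
  moreover have "cls x \<in> Coset n x" by (simp add: cls_mem_Coset J_Below J.zero_mem)
  ultimately show "x - y \<in> Below n" by (simp add: cls_mem_Coset)
next
  assume xy: "x - y \<in> Below n"
  have "z - x \<in> Below n \<longleftrightarrow> z - y \<in> Below n" for z
    using Below_add[OF _ xy, of "z - x"] Below_diff[OF _ xy, of "z - y"] by auto
  then show "Coset n x = Coset n y" by (simp add: Coset_def)
qed

lemma cls_closed: "cls x \<in> carrier H"
  by (simp add: carrier_H)

lemma F_eq: "F n = cls ` Fil n"
proof -
  have "X \<in> carrier H"
    if "filt H (range (\<lambda>a. cls (letA a))) (range (\<lambda>v. cls (letV v))) k X" for k X
    using that by induction (auto simp: cls_closed)
  then have "F n \<subseteq> range cls"
    by (auto simp: H_filt_def carrier_H)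
  then show ?thesis by (auto simp: Fil_def)
qed

lemma below_eq: "below H F n = Coset n 0"
proof (cases n)
  case 0
  then show ?thesis
    using cls_eq_iff[of _ 0]
    by (auto simp: below_def Coset_def Below_def cls_simps J.equ_zero_iff intro: J.zero_mem)
next
  case (Suc k)
  then show ?thesis by (auto simp: below_def Coset_def Below_def F_eq)
qed

lemma r_coset_Coset: "Coset n z +>\<^bsub>H\<^esub> cls x = Coset n (z + x)"
proof -
  have "Coset n z +>\<^bsub>H\<^esub> cls x = (\<lambda>y. cls (y + x)) ` {y. y - z \<in> Below n}"
    unfolding cls_simps(3) by (auto simp: a_r_coset_def' Coset_def)
  also have "\<dots> = cls ` ((\<lambda>y. y + x) ` {y. y - z \<in> Below n})"
    by (simp only: image_image)
  also have "(\<lambda>y. y + x) ` {y. y - z \<in> Below n} = {y. y - (z + x) \<in> Below n}"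
  proof (intro equalityI subsetI)
    fix y assume "y \<in> {y. y - (z + x) \<in> Below n}"
    then have "y = (y - x) + x" "y - x \<in> {y. y - z \<in> Below n}" by (auto simp: algebra_simps)
    then show "y \<in> (\<lambda>y. y + x) ` {y. y - z \<in> Below n}" by blast
  qed (auto simp: algebra_simps)
  finally show ?thesis by (simp only: Coset_def)
qed

lemma set_add_Coset: "Coset n x <+>\<^bsub>H\<^esub> Coset n y = Coset n (x + y)"
proof (intro equalityI subsetI)
  fix X assume "X \<in> Coset n x <+>\<^bsub>H\<^esub> Coset n y"
  then obtain x' y' where "X = cls (x' + y')" "x' - x \<in> Below n" "y' - y \<in> Below n"
    by (auto simp: set_add_def' Coset_def cls_simps)
  then show "X \<in> Coset n (x + y)"
    using Below_add[of "x' - x" n "y' - y"] by (simp add: cls_mem_Coset algebra_simps)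
next
  fix X assume "X \<in> Coset n (x + y)"
  then obtain z where z: "X = cls z" "z - (x + y) \<in> Below n" by (auto simp: Coset_def)
  have "X = cls (z - y) \<oplus>\<^bsub>H\<^esub> cls y" using cls_simps(3)[of "z - y" y] z by simp
  moreover have "cls (z - y) \<in> Coset n x" "cls y \<in> Coset n y"
    using z(2) by (auto simp: cls_mem_Coset algebra_simps J_Below J.zero_mem)
  ultimately show "X \<in> Coset n x <+>\<^bsub>H\<^esub> Coset n y" by (auto simp: set_add_def')
qed

lemma gr_symbol_eq: "gr_symbol H F n (cls x) = (\<lambda>k. Coset k (if k = n then x else 0))"
  by (rule ext) (simp add: gr_symbol_def below_eq r_coset_Coset)

text \<open>Representing each element of the associated graded ring by a family of elements of the free
  algebra turns its multiplication into the convolution product.\<close>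

lemma gr_mult_Coset:
  assumes f: "\<And>i. f i \<in> Fil i" and g: "\<And>i. g i \<in> Fil i"
  shows "(\<lambda>n. Coset n (f n)) \<otimes>\<^bsub>gr H F\<^esub> (\<lambda>n. Coset n (g n)) =
         (\<lambda>n. Coset n (\<Sum>i\<le>n. f i * g (n - i)))"
proof
  fix n
  let ?fg = "\<Sum>i\<le>n. f i * g (n - i)"
  let ?M = "{(\<Oplus>\<^bsub>H\<^esub>i\<in>{..n}. x i \<otimes>\<^bsub>H\<^esub> y (n - i)) \<oplus>\<^bsub>H\<^esub> z | x y z.
     (\<forall>i\<le>n. x i \<in> Coset i (f i) \<and> y i \<in> Coset i (g i)) \<and> z \<in> below H F n}"
  have "((\<lambda>n. Coset n (f n)) \<otimes>\<^bsub>gr H F\<^esub> (\<lambda>n. Coset n (g n))) n = ?M"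
    by (simp add: gr_def)
  also have "?M = Coset n ?fg"
  proof (intro equalityI subsetI)
    fix X assume "X \<in> ?M"
    then obtain x y z where X: "X = (\<Oplus>\<^bsub>H\<^esub>i\<in>{..n}. x i \<otimes>\<^bsub>H\<^esub> y (n - i)) \<oplus>\<^bsub>H\<^esub> z"
      and xy: "\<forall>i\<le>n. x i \<in> Coset i (f i) \<and> y i \<in> Coset i (g i)" and "z \<in> below H F n"
      by blast
    then obtain z' where z': "z = cls z'" "z' \<in> Below n" by (auto simp: below_eq Coset_def)
    have "\<forall>i. \<exists>x'. i \<le> n \<longrightarrow> x i = cls x' \<and> x' - f i \<in> Below i"
      using xy unfolding Coset_def by blast
    then obtain x' where x': "\<And>i. i \<le> n \<Longrightarrow> x i = cls (x' i)" "\<And>i. i \<le> n \<Longrightarrow> x' i - f i \<in> Below i"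
      by metis
    have "\<forall>i. \<exists>y'. i \<le> n \<longrightarrow> y i = cls y' \<and> y' - g i \<in> Below i"
      using xy unfolding Coset_def by blast
    then obtain y' where y': "\<And>i. i \<le> n \<Longrightarrow> y i = cls (y' i)" "\<And>i. i \<le> n \<Longrightarrow> y' i - g i \<in> Below i"
      by metis
    have "(\<Oplus>\<^bsub>H\<^esub>i\<in>{..n}. x i \<otimes>\<^bsub>H\<^esub> y (n - i)) = (\<Oplus>\<^bsub>H\<^esub>i\<in>{..n}. cls (x' i * y' (n - i)))"
      by (rule cls.S.add.finprod_cong') (auto simp: x' y' cls_simps intro!: cls.S.m_closed cls_closed)
    then have "X = cls ((\<Sum>i\<le>n. x' i * y' (n - i)) + z')"
      by (simp add: X z' cls_simps cls_sum)
    moreover have "x' i * y' (n - i) - f i * g (n - i) \<in> Below n" if "i \<le> n" for i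
    proof -
      have "y' (n - i) \<in> Fil (n - i)"
        using Fil_add[OF Below_Fil[OF y'(2)] g, of "n - i"] that by simp
      then have "(x' i - f i) * y' (n - i) \<in> Below (i + (n - i))"
        using x'(2)[OF that] by (rule Below_mult_right[rotated])
      moreover have "f i * (y' (n - i) - g (n - i)) \<in> Below (i + (n - i))"
        by (rule Below_mult_left[OF f y'(2)]) simp
      ultimately show ?thesis
        using Below_add that by (fastforce simp: algebra_simps)
    qed
    then have "(\<Sum>i\<le>n. x' i * y' (n - i) - f i * g (n - i)) + z' \<in> Below n"
      using z' by (intro Below_add Below_sum) auto
    ultimately show "X \<in> Coset n ?fg"
      by (simp add: cls_mem_Coset sum_subtractf algebra_simps)
  next
    fix X assume "X \<in> Coset n ?fg"
    then obtain z where z: "X = cls z" "z - ?fg \<in> Below n" by (auto simp: Coset_def)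
    have "X = cls ?fg \<oplus>\<^bsub>H\<^esub> cls (z - ?fg)" using cls_simps(3)[of ?fg "z - ?fg"] z by simp
    also have "cls ?fg = (\<Oplus>\<^bsub>H\<^esub>i\<in>{..n}. cls (f i) \<otimes>\<^bsub>H\<^esub> cls (g (n - i)))"
      by (simp add: cls_sum cls_simps)
    finally have X: "X = (\<Oplus>\<^bsub>H\<^esub>i\<in>{..n}. cls (f i) \<otimes>\<^bsub>H\<^esub> cls (g (n - i))) \<oplus>\<^bsub>H\<^esub> cls (z - ?fg)" .
    have "cls (z - ?fg) \<in> below H F n"
      using z by (simp add: below_eq cls_mem_Coset)
    moreover have "\<forall>i\<le>n. cls (f i) \<in> Coset i (f i) \<and> cls (g i) \<in> Coset i (g i)"
      by (simp add: cls_mem_Coset J_Below J.zero_mem)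
    ultimately show "X \<in> ?M" unfolding mem_Collect_eq
      by (intro exI[of _ "\<lambda>i. cls (f i)"] exI[of _ "\<lambda>i. cls (g i)"] exI[of _ "cls (z - ?fg)"] conjI X)
  qed
  finally show "((\<lambda>n. Coset n (f n)) \<otimes>\<^bsub>gr H F\<^esub> (\<lambda>n. Coset n (g n))) n = Coset n ?fg" .
qed

definition grmap :: "('v \<times> 'a, 'k) free_alg \<Rightarrow> nat \<Rightarrow> ('v \<times> 'a, 'k) free_alg set set set" where
  "grmap x = (\<lambda>n. Coset n (component n x))"

lemma grmap_eq_iff: "grmap x = grmap y \<longleftrightarrow> (\<forall>n. component n (x - y) \<in> Below n)"
  by (simp add: grmap_def fun_eq_iff Coset_eq_iff)

lemma grmap_mult: "grmap (x * y) = grmap x \<otimes>\<^bsub>gr H F\<^esub> grmap y"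
  unfolding grmap_def by (subst gr_mult_Coset) (simp_all add: component_Fil component_mult)

lemma grmap_add: "grmap (x + y) = grmap x \<oplus>\<^bsub>gr H F\<^esub> grmap y"
  by (simp add: grmap_def gr_def set_add_Coset)

lemma grmap_one: "grmap 1 = \<one>\<^bsub>gr H F\<^esub>"
proof -
  have "\<one>\<^bsub>gr H F\<^esub> = gr_symbol H F 0 (cls 1)"
    by (auto simp: gr_def gr_symbol_def cls_simps)
  then show ?thesis by (simp add: grmap_def gr_symbol_eq)
qed

lemma grmap_homogeneous: "homogeneous k x \<Longrightarrow> grmap x = gr_symbol H F k (cls x)"
  unfolding grmap_def gr_symbol_eq fun_eq_iff Coset_eq_iff homogeneous_def Lin.equ_def
  using Lin_J J_Below by blast

lemma carrier_gr:
  "carrier (gr H F) = {g. (\<forall>n. \<exists>x\<in>Fil n. g n = Coset n x) \<and> finite {n. g n \<noteq> Coset n 0}}"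
  by (simp add: gr_def F_eq below_eq r_coset_Coset)

lemma grmap_carrier: "grmap x \<in> carrier (gr H F)"
proof -
  obtain N where "\<forall>M\<ge>N. component (Suc M) x = 0" using component_sum_equ[of x] by blast
  then have "component n x = 0" if "n > N" for n using that by (cases n) auto
  then have "{n. grmap x n \<noteq> Coset n 0} \<subseteq> {..N}" by (auto simp: grmap_def not_less[symmetric])
  then show ?thesis
    using component_Fil finite_subset by (fastforce simp: carrier_gr grmap_def)
qed

text \<open>Each rule that generates the filtration also produces a leading part: products of leading parts
  are leading parts of products, and an element of lower degree has leading part zero.\<close>

lemma Fil_leading_part:
  assumes "x \<in> Fil n" shows "\<exists>y. homogeneous n y \<and> x - y \<in> Below n"
proof -
  have "x \<in> Fil n \<and> (\<exists>y. homogeneous n y \<and> x - y \<in> Below n)"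
    using assms
  proof (induction rule: Fil_induct)
    case (equ n x y)
    then obtain z where "homogeneous n z" "x - z \<in> Below n" by blast
    moreover have "J.equ (x - z) (y - z)" using equ(1) by (simp add: J.equ_def)
    ultimately show ?case using equ Fil_cong Below_cong by blast
  next
    case one
    then show ?case
      using Fil_one homogeneous_scalar[of 1] J_Below[OF J.zero_mem] by (intro conjI exI[of _ 1]) auto
  next
    case (letA a)
    then show ?case using Fil_letA homogeneous_letA J_Below[OF J.zero_mem] by (intro conjI exI[of _ "letA a"]) auto
  next
    case (letV v)
    then show ?case using Fil_letV homogeneous_letV J_Below[OF J.zero_mem] by (intro conjI exI[of _ "letV v"]) auto
  next
    case (Suc n x)
    then show ?case
      using Fil_Suc homogeneous_zero by (intro conjI exI[of _ 0]) (auto simp: Below_def)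
  next
    case (uminus n x)
    then obtain y where "homogeneous n y" "x - y \<in> Below n" by blast
    then show ?case
      using uminus Fil_uminus Below_uminus[of "x - y" n] homogeneous_diff[OF homogeneous_zero, of n y]
      by (intro conjI exI[of _ "- y"]) auto
  next
    case (add n x x')
    then obtain y y' where "homogeneous n y" "x - y \<in> Below n" "homogeneous n y'" "x' - y' \<in> Below n"
      by blast
    then show ?case
      using add Fil_add Below_add[of "x - y" n "x' - y'"] homogeneous_add[of n y y']
      by (intro conjI exI[of _ "y + y'"]) (auto simp: algebra_simps)
  next
    case (mult n k x x')
    then obtain y y' where y: "homogeneous n y" "x - y \<in> Below n" "homogeneous k y'" "x' - y' \<in> Below k"
      by blast
    have "(x - y) * x' \<in> Below (n + k)" "y * (x' - y') \<in> Below (n + k)"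
      using Below_mult_right[OF y(2)] Below_mult_left[OF homogeneous_Fil[OF y(1)] y(4)] mult(2) by auto
    then have "x * x' - y * y' \<in> Below (n + k)"
      using Below_add[of "(x - y) * x'" "n + k" "y * (x' - y')"] by (simp add: algebra_simps)
    then show ?case
      using mult Fil_mult homogeneous_mult[OF y(1,3)] by blast
  qed
  then show ?thesis by blast
qed

lemma grmap_surj:
  assumes "g \<in> carrier (gr H F)" shows "\<exists>x. g = grmap x"
proof -
  have "\<exists>y. homogeneous n y \<and> g n = Coset n y" for n
  proof -
    obtain x where x: "x \<in> Fil n" "g n = Coset n x" using assms by (auto simp: carrier_gr)
    then show ?thesis using Fil_leading_part[of x n] Coset_eq_iff by blast
  qed
  then obtain y where y: "\<And>n. homogeneous n (y n)" "\<And>n. g n = Coset n (y n)" by metis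
  let ?S = "{n. g n \<noteq> Coset n 0}"
  have fin: "finite ?S" using assms by (simp add: carrier_gr)
  have "g n = grmap (sum y ?S) n" for n
  proof -
    have "Lin.equ (component n (sum y ?S)) (\<Sum>k\<in>?S. if n = k then y k else 0)"
      using y(1) unfolding component_simps homogeneous_def by (intro Lin.equ_sum) blast
    also have "(\<Sum>k\<in>?S. if n = k then y k else 0) = (if n \<in> ?S then y n else 0)"
      using fin by simp
    finally have "component n (sum y ?S) - (if n \<in> ?S then y n else 0) \<in> Below n"
      using Lin_J J_Below unfolding Lin.equ_def by blast
    then have "Coset n (component n (sum y ?S)) = Coset n (if n \<in> ?S then y n else 0)"
      unfolding Coset_eq_iff .
    then show ?thesis using y(2) unfolding grmap_def by (cases "n \<in> ?S") auto
  qed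
  then show ?thesis by blast
qed

text \<open>The natural map sends the class of \<open>x\<close> to the family of the classes of the components of
  \<open>x\<close>. It is always a well-defined surjective homomorphism, and there is no other candidate
  because the values on generators are prescribed. So the PBW property is injectivity.\<close>

theorem PBW_iff_injective:
  "PBW sA sV act \<Delta> \<kappa>V \<kappa>A \<longleftrightarrow> (\<forall>x. (\<forall>n. component n x \<in> Below n) \<longrightarrow> x \<in> J0)"
proof -
  interpret zero: H_deformation sA sV act \<Delta> "\<lambda>_ _. 0" "\<lambda>_ _. 0" by unfold_locales
  have grmap_cong: "grmap x = grmap y" if "J0.equ x y" for x y
    using that J0_component_Below[of "x - y"] by (simp add: grmap_eq_iff J0.equ_def)
  have PBW: "PBW sA sV act \<Delta> \<kappa>V \<kappa>A \<longleftrightarrow> (\<exists>\<phi> \<in> ring_iso H0 (gr H F).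
      (\<forall>a. \<phi> (cls0 (letA a)) = grmap (letA a)) \<and> (\<forall>v. \<phi> (cls0 (letV v)) = grmap (letV v)))"
    by (simp add: PBW_def Let_def grmap_homogeneous[OF homogeneous_letA] grmap_homogeneous[OF homogeneous_letV])
  show ?thesis
  proof
    assume "PBW sA sV act \<Delta> \<kappa>V \<kappa>A"
    then obtain \<phi> where iso: "\<phi> \<in> ring_iso H0 (gr H F)"
      and A: "\<And>a. \<phi> (cls0 (letA a)) = grmap (letA a)" and V: "\<And>v. \<phi> (cls0 (letV v)) = grmap (letV v)"
      unfolding PBW by blast
    have hom: "\<phi> (cls0 (x * y)) = \<phi> (cls0 x) \<otimes>\<^bsub>gr H F\<^esub> \<phi> (cls0 y)"
      "\<phi> (cls0 (x + y)) = \<phi> (cls0 x) \<oplus>\<^bsub>gr H F\<^esub> \<phi> (cls0 y)" for x y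
      using ring_iso_memE(2,3)[OF iso, of "cls0 x" "cls0 y"]
      by (simp_all add: zero.cls_simps zero.carrier_H)
    have eq: "\<phi> (cls0 x) = grmap x" for x
    proof (induction x rule: free_alg_induct)
      case (scalar c)
      have "\<phi> (cls0 (scalar c)) = \<phi> (cls0 (letA (sA c 1)))"
        by (rule arg_cong[of _ _ \<phi>]) (simp only: zero.cls_eq_iff zero.scalar_J)
      then show ?case using A grmap_cong[OF zero.scalar_J] by simp
    next
      case (add x y)
      then show ?case by (simp only: hom grmap_add)
    next
      case (mult_letter l x)
      obtain v a where l: "l = (v, a)" by (cases l)
      have *: "J0.equ (letter l) (letV v + letA a)"
        unfolding l by (rule zero.Lin_equ_J[OF letter_split])
      then have "cls0 (letter l) = cls0 (letV v + letA a)"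
        by (simp add: zero.cls_eq_iff)
      then have "\<phi> (cls0 (letter l)) = grmap (letter l)"
        using grmap_cong[OF *] by (simp only: hom A V grmap_add)
      then show ?case by (simp only: hom mult_letter grmap_mult)
    qed
    show "\<forall>x. (\<forall>n. component n x \<in> Below n) \<longrightarrow> x \<in> J0"
    proof (intro allI impI)
      fix x assume "\<forall>n. component n x \<in> Below n"
      then have "grmap x = grmap 0" by (simp add: grmap_eq_iff)
      then have "\<phi> (cls0 x) = \<phi> (cls0 0)" by (simp only: eq)
      then have "cls0 x = cls0 0"
        using ring_iso_memE(5)[OF iso] by (auto simp: bij_betw_def inj_on_def zero.carrier_H)
      then show "x \<in> J0" by (simp add: zero.cls_eq_iff J0.equ_zero_iff)
    qed
  next
    assume inj: "\<forall>x. (\<forall>n. component n x \<in> Below n) \<longrightarrow> x \<in> J0"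
    define \<phi> where "\<phi> X = grmap (SOME x. cls0 x = X)" for X
    have \<phi>: "\<phi> (cls0 x) = grmap x" for x
      unfolding \<phi>_def
      by (rule grmap_cong) (metis (mono_tags, lifting) someI zero.cls_eq_iff)
    have "\<phi> \<in> ring_iso H0 (gr H F)"
    proof (rule ring_iso_memI)
      show "\<phi> X \<in> carrier (gr H F)" for X by (simp add: \<phi>_def grmap_carrier)
      show "\<phi> \<one>\<^bsub>H0\<^esub> = \<one>\<^bsub>gr H F\<^esub>" by (simp add: \<phi> grmap_one flip: zero.cls_simps(1))
      show "bij_betw \<phi> (carrier H0) (carrier (gr H F))"
      proof (rule bij_betwI')
        fix X Y assume "X \<in> carrier H0" "Y \<in> carrier H0"
        then obtain x y where "X = cls0 x" "Y = cls0 y" by (auto simp: zero.carrier_H)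
        then show "(\<phi> X = \<phi> Y) = (X = Y)"
          using inj J0_component_Below[of "x - y"]
          by (auto simp: \<phi> grmap_eq_iff zero.cls_eq_iff J0.equ_def)
      next
        show "\<phi> X \<in> carrier (gr H F)" for X by (simp add: \<phi>_def grmap_carrier)
      next
        fix g assume "g \<in> carrier (gr H F)"
        then obtain x where "g = \<phi> (cls0 x)" using grmap_surj \<phi> by metis
        then show "\<exists>X\<in>carrier H0. g = \<phi> X" by (auto simp: zero.carrier_H)
      qed
    next
      fix X Y assume "X \<in> carrier H0" "Y \<in> carrier H0"
      then obtain x y where XY: "X = cls0 x" "Y = cls0 y" by (auto simp: zero.carrier_H)
      show "\<phi> (X \<otimes>\<^bsub>H0\<^esub> Y) = \<phi> X \<otimes>\<^bsub>gr H F\<^esub> \<phi> Y"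
        by (simp add: XY \<phi> grmap_mult flip: zero.cls_simps)
      show "\<phi> (X \<oplus>\<^bsub>H0\<^esub> Y) = \<phi> X \<oplus>\<^bsub>gr H F\<^esub> \<phi> Y"
        by (simp add: XY \<phi> grmap_add flip: zero.cls_simps)
    qed
    then show "PBW sA sV act \<Delta> \<kappa>V \<kappa>A" unfolding PBW using \<phi> by blast
  qed
qed

end

context H_setup begin

text \<open>For \<open>\<kappa> = 0\<close> the algebra is graded, so no component can drop to a lower degree.\<close>

theorem PBW_zero: "PBW sA sV act \<Delta> (\<lambda>_ _. 0) (\<lambda>_ _. 0)"
proof -
  interpret zero: H_deformation sA sV act \<Delta> "\<lambda>_ _. 0" "\<lambda>_ _. 0" by unfold_locales
  have high: "component n x \<in> zero.J" if "x \<in> zero.Fil k" "k < n" for k n x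
    using that
  proof (induction arbitrary: n rule: zero.Fil_induct)
    case (equ k x y)
    have "component n (x - y) \<in> zero.J"
      by (rule zero.J0_component_J0) (use equ(1) in \<open>simp add: zero.J.equ_def\<close>)
    then show ?case
      using zero.J.diff_mem[OF equ(2)[OF equ(3)]] by fastforce
  next
    case (mult k l x y)
    have "component i x * component (n - i) y \<in> zero.J" if "i \<le> n" for i
      using mult that
      by (cases "k < i") (auto intro: zero.J.mult_mem_left zero.J.mult_mem_right)
    then show ?case by (auto simp: component_mult intro: zero.J.sum_mem)
  qed (use zero.Lin_J letter_zero in \<open>auto simp: component_letter zero.J.zero_mem zero.J.uminus_mem zero.J.add_mem\<close>)
  have Below: "component n x \<in> zero.J" if "x \<in> zero.Below n" for n x
    using that high[of x "n - 1" n] zero.J0_component_J0[of x n]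
    by (cases n) (auto simp: zero.Below_def)
  show ?thesis
    unfolding zero.PBW_iff_injective
  proof (intro allI impI)
    fix x assume x: "\<forall>n. component n x \<in> zero.Below n"
    have "component n x \<in> zero.J" for n
    proof -
      have "Lin.equ (component n (component n x)) (component n x)"
        using homogeneous_component[of n x, unfolded homogeneous_def, THEN spec, of n] by simp
      then show ?thesis
        using zero.J.mem_cong[OF _] Below x zero.Lin_equ_J by (metis zero.J.equ_def)
    qed
    then show "x \<in> zero.J" by (rule zero.J0_from_components)
  qed
qed

end

section \<open>Generalized nil-Coxeter algebras in low degree\<close>

lemma length_alternating [simp]: "length (alternating n i j) = n"
  by (induction n i j rule: alternating.induct) auto

abbreviation coeff_word :: "('x, 'k::field) free_alg \<Rightarrow> 'x list \<Rightarrow> 'k" where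
  "coeff_word x w \<equiv> Poly_Mapping.lookup x (Word w)"

lemma coeff_word_mult_Nil:
  fixes x y :: "('x, 'k::field) free_alg"
  shows "coeff_word (x * y) [] =
    coeff_word x [] * coeff_word y []"
proof (induction x rule: poly_mapping_add_induct)
  case (add_single x t a)
  have "coeff_word (Poly_Mapping.single t a * y) [] =
    coeff_word (Poly_Mapping.single t a) [] * coeff_word y []"
  proof (induction y rule: poly_mapping_add_induct)
    case (add_single y s b)
    then show ?case
      by (cases t; cases s) (auto simp: distrib_left lookup_add mult_single lookup_single when_def)
  qed simp
  then show ?case using add_single by (simp add: distrib_right lookup_add)
qed simp

lemma coeff_word_mult_singleton:
  fixes x y :: "('x, 'k::field) free_alg"
  shows "coeff_word (x * y) [i] =
    coeff_word x [] * coeff_word y [i] +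
    coeff_word x [i] * coeff_word y []"
proof (induction x rule: poly_mapping_add_induct)
  case (add_single x t a)
  have "coeff_word (Poly_Mapping.single t a * y) [i] =
    coeff_word (Poly_Mapping.single t a) [] * coeff_word y [i] +
    coeff_word (Poly_Mapping.single t a) [i] * coeff_word y []"
  proof (induction y rule: poly_mapping_add_induct)
    case (add_single y s b)
    then show ?case
      by (cases t; cases s)
         (auto simp: distrib_left lookup_add mult_single lookup_single when_def append_eq_Cons_conv)
  qed simp
  then show ?case using add_single by (simp add: algebra_simps lookup_add)
qed simp

text \<open>All relators are combinations of words of length at least two; this is where the entries of
  the Coxeter matrix and the exponents have to be at least two. Such combinations form an ideal.\<close>

lemma nil_coxeter_ideal_coeff_word:
  fixes m :: "'i \<Rightarrow> 'i \<Rightarrow> enat" and x :: "('i, 'k::field) free_alg"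
  assumes "coxeter_matrix m" and "\<And>i. 2 \<le> d i"
    and "x \<in> nil_coxeter_ideal m d" and "length w \<le> 1"
  shows "coeff_word x w = 0"
proof -
  let ?D = "{x :: ('i, 'k) free_alg. coeff_word x [] = 0 \<and>
    (\<forall>i. coeff_word x [i] = 0)}"
  have "two_sided ?D"
    by unfold_locales (auto simp: lookup_add coeff_word_mult_Nil coeff_word_mult_singleton)
  moreover have "nil_coxeter_rels m d \<subseteq> ?D"
  proof
    fix r :: "('i, 'k) free_alg"
    assume "r \<in> nil_coxeter_rels m d"
    moreover have long: "word_elt u \<in> ?D" if "2 \<le> length u" for u
      using that by (auto simp: word_elt_def lookup_single when_def)
    ultimately show "r \<in> ?D"
    proof cases
      case (braid i j n)
      then have "2 \<le> enat n" using assms(1) by (metis coxeter_matrix_def)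
      then have "2 \<le> n" by (simp add: numeral_eq_enat)
      then show ?thesis
        using long[of "alternating n i j"] long[of "alternating n j i"]
        unfolding braid by (auto simp: lookup_minus)
    next
      case (nilpotent i)
      then show ?thesis using assms(2) long[of "replicate (d i) i"] by simp
    qed
  qed
  ultimately have "nil_coxeter_ideal m d \<subseteq> ?D"
    unfolding nil_coxeter_ideal_def by (rule Idl_type_ring_minimal)
  then show ?thesis using assms(3,4) by (cases w) auto
qed

abbreviation word_prod :: "('i \<Rightarrow> 'a::ring_1) \<Rightarrow> 'i list \<Rightarrow> 'a" where
  "word_prod T w \<equiv> prod_list (map T w)"

text \<open>What the argument needs from the algebra: the words in the generators span it, long words vanish,
  and the generators stay linearly independent modulo products of two generators. The last point is
  expressed by the augmentation \<open>e\<close> and by the coefficient functionals \<open>c i\<close> of the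
  generators, which are derivations with respect to \<open>e\<close>.\<close>

locale nil_generators = k_algebra sA
  for sA :: "'k::field \<Rightarrow> 'a::ring_1 \<Rightarrow> 'a" +
  fixes T :: "'i \<Rightarrow> 'a" and e :: "'a \<Rightarrow> 'k" and c :: "'i \<Rightarrow> 'a \<Rightarrow> 'k"
  assumes words_span: "a \<in> span (range (word_prod T))"
    and e_add: "e (a + b) = e a + e b" and e_scale: "e (sA k a) = k * e a"
    and e_mult: "e (a * b) = e a * e b" and e_one: "e 1 = 1" and e_T: "e (T i) = 0"
    and c_add: "c i (a + b) = c i a + c i b" and c_scale: "c i (sA k a) = k * c i a"
    and c_mult: "c i (a * b) = e a * c i b + c i a * e b"
    and c_T: "c i (T j) = (if i = j then 1 else 0)"
    and words_nilpotent: "\<exists>N. \<forall>w. N \<le> length w \<longrightarrow> word_prod T w = 0"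

text \<open>The functionals are the coefficients, at words of length at most one, of a preimage in the free
  algebra. They do not depend on the preimage.\<close>

lemma nil_coxeter_nil_generators:
  fixes m :: "'i \<Rightarrow> 'i \<Rightarrow> enat" and sA :: "'k::field \<Rightarrow> 'a::ring_1 \<Rightarrow> 'a"
  assumes coxeter: "coxeter_matrix m"
    and exponents: "\<And>i. 2 \<le> d i"
    and A: "is_nil_coxeter_algebra m d sA T"
    and nilpotent: "nilpotent_ideal (Idl\<^bsub>type_ring\<^esub> (range T))"
  obtains e c where "nil_generators sA T e c"
proof -
  let ?I = "nil_coxeter_ideal m d :: ('i, 'k) free_alg set"
  let ?q = "\<lambda>x :: ('i, 'k) free_alg. ?I +>\<^bsub>type_ring\<^esub> x"
  interpret k_algebra sA using A by (simp add: is_nil_coxeter_algebra_def)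
  obtain \<phi> where iso: "\<phi> \<in> ring_iso (NC m d :: ('i, 'k) free_alg set ring) type_ring"
    and T: "\<And>i. \<phi> (?q (letter i)) = T i" and scal: "\<And>k. \<phi> (?q (scalar k)) = sA k 1"
    using A by (auto simp: is_nil_coxeter_algebra_def)
  have I: "two_sided ?I" unfolding nil_coxeter_ideal_def by (rule two_sided_Idl)
  then have ideal: "ideal ?I type_ring" by (simp add: ideal_type_ring_iff)
  interpret q: ring_hom_ring type_ring "NC m d :: ('i, 'k) free_alg set ring" ?q
    unfolding NC_def by (rule ideal.rcos_ring_hom_ring[OF ideal])
  have carrier: "carrier (NC m d :: ('i, 'k) free_alg set ring) = range ?q"
    by (simp add: NC_def carrier_Quot)
  define ev where "ev x = \<phi> (?q x)" for x
  have ev_add: "ev (x + y) = ev x + ev y" and ev_mult: "ev (x * y) = ev x * ev y" for x y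
    using ring_iso_memE(2,3)[OF iso, of "?q x" "?q y"] q.hom_add[of x y] q.hom_mult[of x y]
    by (simp_all add: ev_def carrier)
  have ev_T: "ev (letter i) = T i" and ev_scalar: "ev (scalar k) = sA k 1" for i k
    by (simp_all add: ev_def T scal)
  have ev_eq: "x - y \<in> ?I" if "ev x = ev y" for x y
  proof -
    have "?q x = ?q y"
      using that ring_iso_memE(5)[OF iso] by (auto simp: ev_def bij_betw_def inj_on_def carrier)
    then show ?thesis using ideal.rcos_eq_iff[OF ideal, of x y] by (simp add: a_minus_def)
  qed
  have ev_surj: "\<exists>x. ev x = a" for a
  proof -
    have "a \<in> \<phi> ` range ?q"
      using bij_betw_imp_surj_on[OF ring_iso_memE(5)[OF iso]] by (simp add: carrier)
    then show ?thesis by (auto simp: ev_def)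
  qed
  define rep where "rep a = (SOME x. ev x = a)" for a
  have rep: "ev (rep a) = a" for a
    unfolding rep_def using ev_surj[of a] by (rule someI_ex)
  define co where "co w a = coeff_word (rep a) w" for w a
  have co_ev: "co w (ev x) = coeff_word x w" if "length w \<le> 1" for w x
    using nil_coxeter_ideal_coeff_word[OF coxeter exponents ev_eq that, of "rep (ev x)" x] rep[of "ev x"]
    by (simp add: co_def lookup_minus)
  have ev_scale: "ev (scalar k * x) = sA k (ev x)" for k x
    by (simp add: ev_mult ev_scalar flip: scale_mult_left)
  have co_scale: "co w (sA k a) = k * co w a" if "length w \<le> 1" for w k a
  proof -
    have lookup: "coeff_word (scalar k * x) w = k * coeff_word x w"
      for x :: "('i, 'k) free_alg" and w
      by (induction x rule: poly_mapping_add_induct)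
         (auto simp: distrib_left lookup_add mult_single lookup_single when_def)
    show ?thesis
      using co_ev[OF that, of "scalar k * rep a"] lookup[of "rep a" w]
      by (simp add: ev_scale rep co_def)
  qed
  have co_add: "co w (a + b) = co w a + co w b" if "length w \<le> 1" for w a b
    using co_ev[OF that, of "rep a + rep b"] by (simp add: ev_add rep co_def lookup_add)
  have "nil_generators sA T (co []) (\<lambda>i. co [i])"
  proof
    fix a b :: 'a and k :: 'k and i j :: 'i
    have "ev x \<in> span (range (word_prod T))" for x
    proof (induction x rule: free_alg_induct)
      case (scalar k)
      have "1 \<in> range (word_prod T)" by (rule range_eqI[of _ _ "[]"]) simp
      then show ?case unfolding ev_scalar by (intro span_scale span_base)
    next
      case (add x y)
      then show ?case by (simp add: ev_add span_add)
    next
      case (mult_letter i x)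
      have "T i * a \<in> span (range (word_prod T))" if "a \<in> span (range (word_prod T))" for a
        using that
      proof (induction rule: span_induct_alt)
        case (step k a b)
        then obtain w where "a = word_prod T w" by auto
        then have "T i * a = word_prod T (i # w)" by simp
        then have "T i * a \<in> span (range (word_prod T))" by (blast intro: span_base)
        then show ?case
          using step by (simp add: distrib_left span_add span_scale flip: scale_mult_right)
      qed (simp add: span_zero)
      then show ?case using mult_letter by (simp add: ev_mult ev_T)
    qed
    then show "a \<in> span (range (word_prod T))" using ev_surj by metis
    show "co [] (a + b) = co [] a + co [] b" "co [i] (a + b) = co [i] a + co [i] b"
      "co [] (sA k a) = k * co [] a" "co [i] (sA k a) = k * co [i] a"
      by (simp_all add: co_add co_scale)
    show "co [] (a * b) = co [] a * co [] b"
      "co [i] (a * b) = co [] a * co [i] b + co [i] a * co [] b"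
      using co_ev[of _ "rep a * rep b"]
      by (simp_all add: ev_mult rep co_def coeff_word_mult_Nil coeff_word_mult_singleton)
    show "co [] 1 = 1"
      using co_ev[of "[]" "scalar 1"] ev_scalar[of 1] by (simp add: lookup_single flip: zero_word_def)
    show "co [] (T i) = 0" "co [i] (T j) = (if i = j then 1 else 0)"
      using co_ev[of "[]" "letter i", unfolded ev_T] co_ev[of "[i]" "letter j", unfolded ev_T]
      by (auto simp: word_elt_def lookup_single when_def)
    obtain N where N: "\<And>xs. length xs = N \<Longrightarrow> set xs \<subseteq> Idl\<^bsub>type_ring\<^esub> (range T) \<Longrightarrow> prod_list xs = 0"
      using nilpotent by (auto simp: nilpotent_ideal_def)
    have "word_prod T w = 0" if "N \<le> length w" for w
    proof -
      have "set (take N (map T w)) \<subseteq> Idl\<^bsub>type_ring\<^esub> (range T)"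
        using Idl_type_ring_self[of "range T"] set_take_subset[of N "map T w"] by fastforce
      then have "prod_list (take N (map T w)) = 0" using that by (intro N) auto
      moreover have "word_prod T w = prod_list (take N (map T w)) * prod_list (drop N (map T w))"
        by (simp flip: prod_list.append)
      ultimately show ?thesis by simp
    qed
    then show "\<exists>N. \<forall>w. N \<le> length w \<longrightarrow> word_prod T w = 0" by blast
  qed
  then show thesis by (rule that)
qed

section \<open>The coproduct and the Sweedler relations\<close>

text \<open>Bilinearity is only required modulo a subspace, so that maps into a quotient can be given by
  representatives.\<close>

locale bilinear_modulo = vector_space sW
  for sW :: "'k::field \<Rightarrow> 'w::ab_group_add \<Rightarrow> 'w" +
  fixes sA :: "'k \<Rightarrow> 'a::ring_1 \<Rightarrow> 'a" and W0 :: "'w set"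
  assumes k_algebra: "k_algebra sA"
    and W0: "subspace W0"
begin

definition bilin :: "('a \<Rightarrow> 'a \<Rightarrow> 'w) \<Rightarrow> bool" where
  "bilin b \<longleftrightarrow> (\<forall>x x' y y' k. b (x + x') y - b x y - b x' y \<in> W0 \<and> b x (y + y') - b x y - b x y' \<in> W0
     \<and> b (sA k x) y - sW k (b x y) \<in> W0 \<and> b x (sA k y) - sW k (b x y) \<in> W0)"

definition contract :: "('a \<Rightarrow> 'a \<Rightarrow> 'w) \<Rightarrow> ('a pure_tensor \<Rightarrow>\<^sub>0 'k) \<Rightarrow> 'w" where
  "contract b p = lin_ext sW (\<lambda>t. b (left t) (right t)) p"

lemma contract_simps [simp]:
  "contract b 0 = 0" "contract b (p + q) = contract b p + contract b q"
  "contract b (p - q) = contract b p - contract b q"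
  "contract b (scalar k * p) = sW k (contract b p)"
  "contract b (sum f S) = (\<Sum>s\<in>S. contract b (f s))"
  "contract b (Poly_Mapping.single t k) = sW k (b (left t) (right t))"
  by (simp_all add: contract_def)

lemma contract_single_mult:
  "contract b (Poly_Mapping.single t k * p) = sW k (contract (\<lambda>x y. b (left t * x) (right t * y)) p)"
  by (induction p rule: poly_mapping_add_induct)
     (simp_all add: distrib_left mult_single plus_pure_tensor_def scale_right_distrib)

lemma contract_mult_single:
  "contract b (p * Poly_Mapping.single t k) = sW k (contract (\<lambda>x y. b (x * left t) (y * right t)) p)"
  by (induction p rule: poly_mapping_add_induct)
     (simp_all add: distrib_right mult_single plus_pure_tensor_def scale_right_distrib mult.commute)

lemma bilin_mult:
  assumes "bilin b"
  shows "bilin (\<lambda>x y. b (u * x) (v * y))" "bilin (\<lambda>x y. b (x * u) (y * v))"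
  using assms
  by (simp_all add: bilin_def distrib_left distrib_right flip: k_algebra.scale_mult_left[OF k_algebra]
        k_algebra.scale_mult_right[OF k_algebra])

text \<open>A bilinear map factors through the tensor square: the elements that every bilinear map
  contracts to zero form an ideal, because \<open>(x, y) \<mapsto> b (u x, v y)\<close> is again bilinear.\<close>

lemma contract_bilinear_ideal:
  assumes "p \<in> bilinear_ideal sA" "bilin b"
  shows "contract b p \<in> W0"
proof -
  let ?K = "{p. \<forall>b. bilin b \<longrightarrow> contract b p \<in> W0}"
  note W0_simps = subspace_0[OF W0] subspace_add[OF W0] subspace_scale[OF W0] subspace_diff[OF W0]
  have "two_sided ?K"
  proof
    show "0 \<in> ?K" by (simp add: W0_simps)
    show "x + y \<in> ?K" if "x \<in> ?K" "y \<in> ?K" for x y using that by (simp add: W0_simps)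
    show "r * x \<in> ?K" if "x \<in> ?K" for x r
      using that by (induction r rule: poly_mapping_add_induct)
        (simp_all add: W0_simps distrib_right contract_single_mult bilin_mult)
    show "x * r \<in> ?K" if "x \<in> ?K" for x r
      using that by (induction r rule: poly_mapping_add_induct)
        (simp_all add: W0_simps distrib_left contract_mult_single bilin_mult)
  qed
  moreover have "bilinear_rels sA \<subseteq> ?K"
  proof
    fix r assume "r \<in> bilinear_rels sA"
    then show "r \<in> ?K" by cases (simp_all add: bilin_def)
  qed
  ultimately have "bilinear_ideal sA \<subseteq> ?K"
    unfolding bilinear_ideal_def by (rule Idl_type_ring_minimal)
  then show ?thesis using assms by auto
qed

end

locale nil_coproduct = nil_generators sA T e c
  for sA :: "'k::field \<Rightarrow> 'a::ring_1 \<Rightarrow> 'a" and T :: "'i \<Rightarrow> 'a" and e c +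
  fixes \<Delta> :: "'a \<Rightarrow> ('a pure_tensor \<Rightarrow>\<^sub>0 'k) set"
  assumes coproduct: "is_coproduct sA T \<Delta>"
begin

abbreviation "AA \<equiv> tensor_square sA"

abbreviation "tens \<equiv> \<lambda>x. bilinear_ideal sA +>\<^bsub>type_ring\<^esub> x"

lemma ideal_bilinear: "ideal (bilinear_ideal sA) type_ring"
  by (simp add: bilinear_ideal_def ideal_type_ring_iff two_sided_Idl)

lemma tens_add: "tens x \<oplus>\<^bsub>AA\<^esub> tens y = tens (x + y)"
  and tens_mult: "tens x \<otimes>\<^bsub>AA\<^esub> tens y = tens (x * y)"
  and tens_one: "\<one>\<^bsub>AA\<^esub> = tens 1"
proof -
  interpret q: ring_hom_ring type_ring "AA" tens
    unfolding tensor_square_def by (rule ideal.rcos_ring_hom_ring[OF ideal_bilinear])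
  show "tens x \<oplus>\<^bsub>AA\<^esub> tens y = tens (x + y)"
    "tens x \<otimes>\<^bsub>AA\<^esub> tens y = tens (x * y)"
    "\<one>\<^bsub>AA\<^esub> = tens 1"
    using q.hom_add[of x y] q.hom_mult[of x y] q.hom_one by simp_all
qed

lemma \<Delta>_word: "\<Delta> (word_prod T w) = tens (pure (word_prod T w) (word_prod T w))"
proof (induction w)
  case Nil
  have "\<Delta> 1 = \<one>\<^bsub>AA\<^esub>"
    using coproduct ring_hom_one[of \<Delta> type_ring "AA"] by (simp add: is_coproduct_def)
  moreover have "pure (1 :: 'a) 1 = (1 :: 'a pure_tensor \<Rightarrow>\<^sub>0 'k)"
    by (simp flip: zero_pure_tensor_def)
  ultimately show ?case by (simp add: tens_one)
next
  case (Cons i w)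
  have "\<Delta> (T i * word_prod T w) = \<Delta> (T i) \<otimes>\<^bsub>AA\<^esub> \<Delta> (word_prod T w)"
    using coproduct ring_hom_mult[of \<Delta> type_ring "AA" "T i" "word_prod T w"]
    by (simp add: is_coproduct_def)
  then show ?case
    using coproduct Cons by (simp add: is_coproduct_def tens_mult mult_single plus_pure_tensor_def)
qed

lemma \<Delta>_add: "\<Delta> (a + b) = \<Delta> a \<oplus>\<^bsub>AA\<^esub> \<Delta> b"
  using coproduct ring_hom_add[of \<Delta> type_ring "AA" a b]
  by (simp add: is_coproduct_def)

lemma \<Delta>_word_sum:
  "\<Delta> (\<Sum>s\<in>S. sA (k s) (word_prod T (u s))) =
   tens (\<Sum>s\<in>S. scalar (k s) * pure (word_prod T (u s)) (word_prod T (u s)))"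
proof -
  have scale: "\<Delta> (sA r a) = tens (scalar r) \<otimes>\<^bsub>AA\<^esub> \<Delta> a" for r a
    using coproduct by (simp add: is_coproduct_def)
  have zero: "\<Delta> 0 = tens 0"
    using scale[of 0 1] \<Delta>_word[of "[]"] by (simp add: tens_mult)
  show ?thesis
    by (induction S rule: infinite_finite_induct)
       (simp_all add: zero \<Delta>_add scale \<Delta>_word tens_mult tens_add)
qed

lemma coproduct_representative:
  assumes "p \<in> \<Delta> (\<Sum>s\<in>S. sA (k s) (word_prod T (u s)))"
  shows "p - (\<Sum>s\<in>S. scalar (k s) * pure (word_prod T (u s)) (word_prod T (u s))) \<in> bilinear_ideal sA"
  using assms unfolding \<Delta>_word_sum by (auto simp: a_r_coset_def')

lemma coproduct_word_mem: "pure (word_prod T w) (word_prod T w) \<in> \<Delta> (word_prod T w)"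
proof -
  have "0 \<in> bilinear_ideal sA"
    using two_sided.zero_mem[OF two_sided_Idl] by (simp add: bilinear_ideal_def)
  then show ?thesis by (force simp: \<Delta>_word a_r_coset_def')
qed

lemma word_sum:
  obtains S :: "'a set" and k u where "finite S" "a = (\<Sum>s\<in>S. sA (k s) (word_prod T (u s)))"
proof -
  obtain S r where S: "finite S" "S \<subseteq> range (word_prod T)" "a = (\<Sum>s\<in>S. sA (r s) s)"
    using words_span[of a] unfolding span_explicit by blast
  then have "\<forall>s\<in>S. \<exists>w. s = word_prod T w" by blast
  then obtain u where "\<forall>s\<in>S. s = word_prod T (u s)" by metis
  then have "a = (\<Sum>s\<in>S. sA (r s) (word_prod T (u s)))"
    using S(3) by (metis (mono_tags, lifting) sum.cong)
  then show thesis using that S(1) by blast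
qed

definition basis :: "'a set" where
  "basis = (SOME B. B \<subseteq> range (word_prod T) \<and> independent B \<and> range (word_prod T) \<subseteq> span B)"

definition coord :: "'a \<Rightarrow> 'a \<Rightarrow> 'k" where
  "coord b a = representation basis a b"

lemma basis: "basis \<subseteq> range (word_prod T)" "independent basis" "span basis = UNIV"
proof -
  have "\<exists>B. B \<subseteq> range (word_prod T) \<and> independent B \<and> range (word_prod T) \<subseteq> span B"
    by (metis maximal_independent_subset)
  then have *: "basis \<subseteq> range (word_prod T) \<and> independent basis \<and> range (word_prod T) \<subseteq> span basis"
    unfolding basis_def by (rule someI_ex)
  then have "span (range (word_prod T)) \<subseteq> span basis" by (simp add: span_minimal)
  then show "basis \<subseteq> range (word_prod T)" "independent basis" "span basis = UNIV"
    using * words_span by auto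
qed

lemma coord_add: "coord b (x + y) = coord b x + coord b y"
  and coord_scale: "coord b (sA k x) = k * coord b x"
  unfolding coord_def by (simp_all add: representation_add representation_scale basis)

lemma coord_basis: "b \<in> basis \<Longrightarrow> coord b' b = (if b = b' then 1 else 0)"
  unfolding coord_def by (simp add: representation_basis basis)

lemma coord_expansion: "finite {b. coord b a \<noteq> 0}" "(\<Sum>b | coord b a \<noteq> 0. sA (coord b a) b) = a"
  unfolding coord_def by (simp_all add: finite_representation sum_nonzero_representation_eq basis)

lemma coord_nonzero_basis: "coord b a \<noteq> 0 \<Longrightarrow> b \<in> basis"
  unfolding coord_def by (rule representation_ne_zero)

text \<open>The words are grouplike, so the nonzero ones are linearly independent: comparing
  coordinates in \<open>\<Delta> g = g \<otimes> g\<close> for \<open>g = \<Sum> r\<^sub>b b\<close> gives \<open>r\<^sub>b r\<^sub>c = 0\<close> for \<open>b \<noteq> c\<close> and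
  \<open>r\<^sub>b r\<^sub>b = r\<^sub>b\<close>.\<close>

lemma word_basis: "word_prod T w = 0 \<or> word_prod T w \<in> basis"
proof (cases "word_prod T w = 0")
  case False
  let ?g = "word_prod T w" and ?r = "\<lambda>b. coord b (word_prod T w)"
  let ?S = "{b. ?r b \<noteq> 0}"
  have "\<forall>b\<in>?S. \<exists>v. word_prod T v = b" using coord_nonzero_basis basis(1) by blast
  then obtain u where u: "\<And>b. b \<in> ?S \<Longrightarrow> word_prod T (u b) = b" by metis
  have "(\<Sum>b\<in>?S. sA (?r b) (word_prod T (u b))) = (\<Sum>b\<in>?S. sA (?r b) b)"
    by (rule sum.cong) (simp_all add: u)
  then have g: "(\<Sum>b\<in>?S. sA (?r b) (word_prod T (u b))) = ?g"
    using coord_expansion(2)[of ?g] by simp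
  have mem: "pure ?g ?g - (\<Sum>b\<in>?S. scalar (?r b) * pure (word_prod T (u b)) (word_prod T (u b)))
      \<in> bilinear_ideal sA"
    by (rule coproduct_representative) (simp only: g coproduct_word_mem)
  have eq: "?r b * ?r b' = (if b = b' then ?r b else 0)" for b b'
  proof -
    interpret scalars: vector_space "(*) :: 'k \<Rightarrow> _"
      by (rule vector_space.intro) (simp_all only: distrib_left distrib_right mult.assoc mult_1_left)
    interpret scalars: bilinear_modulo "(*) :: 'k \<Rightarrow> _" sA "{0}"
      by unfold_locales (simp add: scalars.subspace_def)
    have "scalars.bilin (\<lambda>x y. coord b x * coord b' y)"
      by (simp add: scalars.bilin_def coord_add coord_scale distrib_left distrib_right mult_ac
            del: scalars.scale_scale)
    from scalars.contract_bilinear_ideal[OF mem this]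
    have "?r b * ?r b' = (\<Sum>s\<in>?S. ?r s * (coord b (word_prod T (u s)) * coord b' (word_prod T (u s))))"
      by simp
    also have "\<dots> = (\<Sum>s\<in>?S. if s = b then (if b = b' then ?r b else 0) else 0)"
    proof (rule sum.cong)
      fix s assume "s \<in> ?S"
      then have "word_prod T (u s) = s" "s \<in> basis" using u coord_nonzero_basis by auto
      then show "?r s * (coord b (word_prod T (u s)) * coord b' (word_prod T (u s))) =
          (if s = b then (if b = b' then ?r b else 0) else 0)"
        by (simp add: coord_basis)
    qed simp
    also have "\<dots> = (if b = b' then ?r b else 0)"
      using coord_expansion(1)[of ?g] by auto
    finally show ?thesis .
  qed
  obtain b where b: "?r b \<noteq> 0"
  proof (rule ccontr)
    assume "\<not> thesis"
    then have "?S = {}" using that by blast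
    then have "(\<Sum>b\<in>?S. sA (?r b) b) = 0" by (simp only: sum.empty)
    then have "?g = 0" by (rule trans[OF coord_expansion(2)[of ?g, symmetric]])
    with False show False by contradiction
  qed
  have "?r b = 1" using eq[of b b] b by simp
  moreover have "b' = b" if "?r b' \<noteq> 0" for b' using eq[of b b'] b that by (cases "b' = b") auto
  then have "?S = {b}" using b by blast
  ultimately have "?g = b" using coord_expansion(2)[of ?g] by simp
  then show ?thesis using coord_nonzero_basis[OF b] by simp
qed simp

end

locale nil_module = nil_coproduct sA T e c \<Delta> + H_setup sA sV act \<Delta>
  for sA :: "'k::field \<Rightarrow> 'a::ring_1 \<Rightarrow> 'a" and sV :: "'k \<Rightarrow> 'v::ab_group_add \<Rightarrow> 'v" and act \<Delta>
    and T :: "'i \<Rightarrow> 'a" and e c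
begin

lemma act_zero_left [simp]: "act 0 v = 0"
  using act_add_left[of 0 0 v] by simp

lemma act_zero_right [simp]: "act a 0 = 0"
  using act_add_right[of a 0 0] by simp

lemma words_induct [case_names zero add scale word]:
  assumes "P 0" "\<And>a b. P a \<Longrightarrow> P b \<Longrightarrow> P (a + b)" "\<And>k a. P a \<Longrightarrow> P (sA k a)"
    and "\<And>w. P (word_prod T w)"
  shows "P a"
  using words_span[of a]
  by (induction rule: span_induct_alt) (use assms in auto)

text \<open>Modulo the multiplication of \<open>A\<close>, the Sweedler relations of the generators imply all others:
  they give those of the words, and both sides are linear in the element of \<open>A\<close> because its
  coproduct enters through a bilinear map.\<close>

lemma sweedler_from_generators:
  assumes I: "two_sided I" and Lin: "Lin \<subseteq> I" and unit: "letA 1 - 1 \<in> I"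
    and mult: "\<And>a b. letA a * letA b - letA (a * b) \<in> I"
    and gens: "\<And>i v. letA (T i) * letV v - letV (act (T i) v) * letA (T i) \<in> I"
    and p: "p \<in> \<Delta> a"
  shows "letA a * letV v -
     (\<Sum>t \<in> Poly_Mapping.keys p. scalar (Poly_Mapping.lookup p t) * letV (act (left t) v) * letA (right t)) \<in> I"
proof -
  interpret I: two_sided I by (rule I)
  have Lin_I: "Lin.equ x y \<Longrightarrow> I.equ x y" for x y
    using Lin by (auto simp: Lin.equ_def I.equ_def)
  have word: "I.equ (letA (word_prod T w) * letV v) (letV (act (word_prod T w) v) * letA (word_prod T w))"
    for w v
  proof (induction w arbitrary: v)
    case Nil
    have one: "I.equ (letA 1) 1" using unit by (simp add: I.equ_def)
    have "I.equ (letA 1 * letV v) (1 * letV v)" by (rule I.equ_mult_right[OF one])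
    also have "1 * letV v = letV v * 1" by simp
    also have "I.equ \<dots> (letV v * letA 1)" by (rule I.equ_mult_left[OF I.equ_sym[OF one]])
    finally show ?case by (simp add: act_one)
  next
    case (Cons i w)
    let ?g = "word_prod T w"
    have m: "I.equ (letA (T i) * letA ?g) (letA (T i * ?g))" using mult by (simp add: I.equ_def)
    have "I.equ (letA (T i * ?g) * letV v) (letA (T i) * letA ?g * letV v)"
      by (rule I.equ_mult_right[OF I.equ_sym[OF m]])
    also have "\<dots> = letA (T i) * (letA ?g * letV v)" by (simp add: mult.assoc)
    also have "I.equ \<dots> (letA (T i) * (letV (act ?g v) * letA ?g))" by (rule I.equ_mult_left[OF Cons])
    also have "\<dots> = letA (T i) * letV (act ?g v) * letA ?g" by (simp add: mult.assoc)
    also have "I.equ \<dots> (letV (act (T i) (act ?g v)) * letA (T i) * letA ?g)"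
      by (rule I.equ_mult_right) (simp add: I.equ_def gens)
    also have "\<dots> = letV (act (T i * ?g) v) * (letA (T i) * letA ?g)"
      by (simp add: act_mult mult.assoc)
    also have "I.equ \<dots> (letV (act (T i * ?g) v) * letA (T i * ?g))"
      by (rule I.equ_mult_left[OF m])
    finally show ?case by simp
  qed
  interpret b: bilinear_modulo "\<lambda>c. (*) (scalar c :: ('v \<times> 'a, 'k) free_alg)" sA I
    by unfold_locales (auto simp: free.subspace_def I.zero_mem I.add_mem I.mult_mem_left)
  let ?b = "\<lambda>x y. letV (act x v) * letA y"
  have bilin: "b.bilin ?b"
    unfolding b.bilin_def
  proof (intro allI conjI)
    fix x x' y y' k
    have "I.equ (?b (x + x') y) ((letV (act x v) + letV (act x' v)) * letA y)"
      unfolding act_add_left by (intro I.equ_mult_right Lin_I letV_add)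
    then show "?b (x + x') y - ?b x y - ?b x' y \<in> I" by (simp add: I.equ_def algebra_simps)
    have "I.equ (?b x (y + y')) (letV (act x v) * (letA y + letA y'))"
      by (intro I.equ_mult_left Lin_I letA_add)
    then show "?b x (y + y') - ?b x y - ?b x y' \<in> I" by (simp add: I.equ_def algebra_simps)
    have "I.equ (?b (sA k x) y) (scalar k * letV (act x v) * letA y)"
      unfolding act_scale_left by (intro I.equ_mult_right Lin_I letV_scale)
    then show "?b (sA k x) y - scalar k * ?b x y \<in> I" by (simp add: I.equ_def mult.assoc)
    have "I.equ (?b x (sA k y)) (letV (act x v) * (scalar k * letA y))"
      by (intro I.equ_mult_left Lin_I letA_scale)
    then show "?b x (sA k y) - scalar k * ?b x y \<in> I" by (simp add: I.equ_def scalar_mult_left_commute)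
  qed
  obtain S :: "'a set" and k u where S: "finite S" "a = (\<Sum>s\<in>S. sA (k s) (word_prod T (u s)))"
    by (rule word_sum)
  let ?g = "\<lambda>s. word_prod T (u s)"
  have "b.contract ?b (p - (\<Sum>s\<in>S. scalar (k s) * pure (?g s) (?g s))) \<in> I"
    by (rule b.contract_bilinear_ideal[OF coproduct_representative bilin]) (use p S in simp)
  then have rhs: "I.equ (b.contract ?b p) (\<Sum>s\<in>S. scalar (k s) * (letV (act (?g s) v) * letA (?g s)))"
    by (simp add: I.equ_def)
  have "I.equ (letA a) (\<Sum>s\<in>S. scalar (k s) * letA (?g s))"
  proof -
    have "I.equ (letA a) (\<Sum>s\<in>S. letA (sA (k s) (?g s)))"
      unfolding S(2) by (rule Lin_I[OF letA_sum])
    also have "I.equ \<dots> (\<Sum>s\<in>S. scalar (k s) * letA (?g s))"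
      by (intro I.equ_sum Lin_I letA_scale)
    finally show ?thesis .
  qed
  then have "I.equ (letA a * letV v) ((\<Sum>s\<in>S. scalar (k s) * letA (?g s)) * letV v)"
    by (rule I.equ_mult_right)
  also have "\<dots> = (\<Sum>s\<in>S. scalar (k s) * (letA (?g s) * letV v))"
    by (simp add: sum_distrib_right mult.assoc)
  also have "I.equ \<dots> (\<Sum>s\<in>S. scalar (k s) * (letV (act (?g s) v) * letA (?g s)))"
    by (intro I.equ_sum I.equ_mult_left word)
  also have "I.equ \<dots> (b.contract ?b p)" by (rule I.equ_sym[OF rhs])
  also have "b.contract ?b p =
     (\<Sum>t \<in> Poly_Mapping.keys p. scalar (Poly_Mapping.lookup p t) * letV (act (left t) v) * letA (right t))"
    by (simp add: b.contract_def lin_ext_def mult.assoc)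
  finally show ?thesis by (simp add: I.equ_def)
qed

end

section \<open>Representations of the deformed algebras\<close>

text \<open>Linearity is only asked for on an invariant subspace \<open>C\<close>, which below singles out the maps that
  encode tensors.\<close>

locale letter_action = vector_space sM
  for sM :: "'k::field \<Rightarrow> 'm::ab_group_add \<Rightarrow> 'm" +
  fixes C :: "'m set" and f :: "'x \<Rightarrow> 'm \<Rightarrow> 'm"
  assumes C: "subspace C"
    and f_closed: "m \<in> C \<Longrightarrow> f l m \<in> C"
    and f_add: "\<lbrakk>m \<in> C; n \<in> C\<rbrakk> \<Longrightarrow> f l (m + n) = f l m + f l n"
    and f_scale: "m \<in> C \<Longrightarrow> f l (sM k m) = sM k (f l m)"
begin

definition run :: "('x, 'k) free_alg \<Rightarrow> 'm \<Rightarrow> 'm" where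
  "run x m = lin_ext sM (\<lambda>w. foldr f (case w of Word u \<Rightarrow> u) m) x"

lemma run_simps [simp]:
  "run 0 m = 0" "run (x + y) m = run x m + run y m" "run (x - y) m = run x m - run y m"
  "run (sum g S) m = (\<Sum>s\<in>S. run (g s) m)" "run (scalar k * x) m = sM k (run x m)"
  "run (scalar k) m = sM k m" "run 1 m = m" "run (letter l) m = f l m"
proof -
  show "run (scalar k) m = sM k m" for k
    by (simp add: run_def zero_word_def)
  from this[of 1] show "run 1 m = m" by simp
qed (simp_all add: run_def word_elt_def)

lemma f_zero: "f l 0 = 0"
  using f_scale[of 0 l 0] subspace_0[OF C] by simp

lemma run_closed_letter_mult:
  assumes "m \<in> C"
  shows "run x m \<in> C \<and> run (letter l * x) m = f l (run x m)"
proof (induction x rule: poly_mapping_add_induct)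
  case zero
  then show ?case by (simp add: f_zero subspace_0[OF C])
next
  case (add_single x t k)
  obtain w where t: "t = Word w" by (cases t)
  have w: "foldr f w m \<in> C" by (induction w) (simp_all add: assms f_closed)
  have "run (Poly_Mapping.single t k) m = sM k (foldr f w m)"
    "run (letter l * Poly_Mapping.single t k) m = sM k (f l (foldr f w m))"
    by (simp_all add: run_def t word_elt_def mult_single)
  then show ?case
    using add_single w by (simp add: distrib_left f_add f_scale C subspace_add subspace_scale)
qed

lemma run_closed: "m \<in> C \<Longrightarrow> run x m \<in> C"
  using run_closed_letter_mult by blast

lemma run_mult: "m \<in> C \<Longrightarrow> run (x * y) m = run x (run y m)"
proof (induction x rule: free_alg_induct)
  case (mult_letter l x)
  then show ?case
    using run_closed_letter_mult[of m "x * y" l] run_closed_letter_mult[of "run y m" x l]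
    by (simp add: mult.assoc run_closed)
qed (simp_all add: distrib_right)

lemma run_zero: "run x 0 = 0"
  by (induction x rule: free_alg_induct)
     (use run_closed_letter_mult[of 0] f_zero subspace_0[OF C] in simp_all)

lemma two_sided_annihilator: "two_sided {x. \<forall>m\<in>C. run x m = 0}"
  by unfold_locales (simp_all add: run_mult run_zero run_closed)

end

locale nil_deformation = nil_module sA sV act \<Delta> T e c + H_deformation sA sV act \<Delta> \<kappa>V \<kappa>A
  for sA :: "'k::field \<Rightarrow> 'a::ring_1 \<Rightarrow> 'a" and sV :: "'k \<Rightarrow> 'v::ab_group_add \<Rightarrow> 'v" and act \<Delta>
    and T :: "'i \<Rightarrow> 'a" and e c \<kappa>V \<kappa>A

text \<open>The data of a module over the deformed algebra. The Sweedler relation is only asked for the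
  generators, which suffices by \<open>sweedler_from_generators\<close>.\<close>

locale H_representation = nil_deformation sA sV act \<Delta> T e c \<kappa>V \<kappa>A + M: vector_space sM
  for sA :: "'k::field \<Rightarrow> 'a::ring_1 \<Rightarrow> 'a" and sV :: "'k \<Rightarrow> 'v::ab_group_add \<Rightarrow> 'v" and act \<Delta>
    and T :: "'i \<Rightarrow> 'a" and e c \<kappa>V \<kappa>A
    and sM :: "'k \<Rightarrow> 'm::ab_group_add \<Rightarrow> 'm" +
  fixes C :: "'m set" and fA :: "'a \<Rightarrow> 'm \<Rightarrow> 'm" and fV :: "'v \<Rightarrow> 'm \<Rightarrow> 'm"
  assumes C_subspace: "M.subspace C"
    and fA_closed: "m \<in> C \<Longrightarrow> fA a m \<in> C" and fV_closed: "m \<in> C \<Longrightarrow> fV v m \<in> C"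
    and fA_add_right: "\<lbrakk>m \<in> C; n \<in> C\<rbrakk> \<Longrightarrow> fA a (m + n) = fA a m + fA a n"
    and fV_add_right: "\<lbrakk>m \<in> C; n \<in> C\<rbrakk> \<Longrightarrow> fV v (m + n) = fV v m + fV v n"
    and fA_scale_right: "m \<in> C \<Longrightarrow> fA a (sM k m) = sM k (fA a m)"
    and fV_scale_right: "m \<in> C \<Longrightarrow> fV v (sM k m) = sM k (fV v m)"
    and fA_add_left: "m \<in> C \<Longrightarrow> fA (a + b) m = fA a m + fA b m"
    and fV_add_left: "m \<in> C \<Longrightarrow> fV (v + w) m = fV v m + fV w m"
    and fA_scale_left: "m \<in> C \<Longrightarrow> fA (sA k a) m = sM k (fA a m)"
    and fV_scale_left: "m \<in> C \<Longrightarrow> fV (sV k v) m = sM k (fV v m)"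
    and fA_one: "m \<in> C \<Longrightarrow> fA 1 m = m"
    and fA_mult: "m \<in> C \<Longrightarrow> fA (a * b) m = fA a (fA b m)"
    and fA_T_fV: "m \<in> C \<Longrightarrow> fA (T i) (fV v m) = fV (act (T i) v) (fA (T i) m)"
    and fV_commutator: "m \<in> C \<Longrightarrow> fV v (fV w m) - fV w (fV v m) = fV (\<kappa>V v w) m + fA (\<kappa>A v w) m"
begin

definition rep_op :: "'v \<times> 'a \<Rightarrow> 'm \<Rightarrow> 'm" where
  "rep_op l m = fV (fst l) m + fA (snd l) m"

sublocale rep: letter_action sM C rep_op
  unfolding letter_action_def letter_action_axioms_def rep_op_def
proof (intro conjI allI impI)
  show "vector_space sM" by (rule M.vector_space_axioms)
  show "M.subspace C" by (rule C_subspace)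
  fix m n :: 'm and l :: "'v \<times> 'a" and k :: 'k assume m: "m \<in> C"
  show "fV (fst l) m + fA (snd l) m \<in> C"
    using m by (intro M.subspace_add[OF C_subspace] fA_closed fV_closed)
  show "fV (fst l) (sM k m) + fA (snd l) (sM k m) = sM k (fV (fst l) m + fA (snd l) m)"
    using m by (simp add: fA_scale_right fV_scale_right M.scale_right_distrib)
  assume n: "n \<in> C"
  show "fV (fst l) (m + n) + fA (snd l) (m + n) =
      fV (fst l) m + fA (snd l) m + (fV (fst l) n + fA (snd l) n)"
    using m n by (simp add: fA_add_right fV_add_right)
qed

lemma rep_letA: "m \<in> C \<Longrightarrow> rep.run (letA a) m = fA a m"
  using fV_scale_left[of m 0 0] by (simp add: rep_op_def)

lemma rep_letV: "m \<in> C \<Longrightarrow> rep.run (letV v) m = fV v m"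
  using fA_scale_left[of m 0 0] by (simp add: rep_op_def)

theorem J_annihilates:
  assumes "x \<in> J" "m \<in> C" shows "rep.run x m = 0"
proof -
  let ?I = "{x. \<forall>m\<in>C. rep.run x m = 0}"
  have I: "two_sided ?I" by (rule rep.two_sided_annihilator)
  have "linear_rels sA sV \<subseteq> ?I"
  proof
    fix r assume "r \<in> linear_rels sA sV"
    then show "r \<in> ?I"
      by cases (simp_all add: rep_op_def fA_add_left fV_add_left fA_scale_left fV_scale_left M.scale_right_distrib)
  qed
  then have Lin: "Lin \<subseteq> ?I" unfolding linear_ideal_def by (rule Idl_type_ring_minimal[OF I])
  note rep_simps = rep.run_mult rep_letA rep_letV fA_closed fV_closed fA_one fA_mult
  have unit: "letA 1 - 1 \<in> ?I" by (simp add: rep_simps del: rep.run_simps(8))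
  have mult: "letA a * letA b - letA (a * b) \<in> ?I" for a b
    by (simp add: rep_simps del: rep.run_simps(8))
  have gens: "letA (T i) * letV v - letV (act (T i) v) * letA (T i) \<in> ?I" for i v
    by (simp add: rep_simps fA_T_fV del: rep.run_simps(8))
  have "H_rels act \<Delta> \<kappa>V \<kappa>A \<subseteq> ?I"
  proof
    fix r assume "r \<in> H_rels act \<Delta> \<kappa>V \<kappa>A"
    then show "r \<in> ?I"
    proof cases
      case unit
      then show ?thesis using \<open>letA 1 - 1 \<in> ?I\<close> by simp
    next
      case (mult a b)
      then show ?thesis using \<open>letA a * letA b - letA (a * b) \<in> ?I\<close> by simp
    next
      case (sweedler p a v)
      show ?thesis
        unfolding sweedler(1) by (rule sweedler_from_generators[OF I Lin unit mult gens sweedler(2)])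
    next
      case (commutator v w)
      have "rep.run (letter (\<kappa>V v w, \<kappa>A v w)) m = fV (\<kappa>V v w) m + fA (\<kappa>A v w) m" for m
        by (simp add: rep_op_def)
      then show ?thesis
        unfolding commutator by (simp add: rep_simps fV_commutator del: rep.run_simps(8))
    qed
  qed
  then have "J \<subseteq> ?I"
    using J_minimal[OF I \<open>linear_rels sA sV \<subseteq> ?I\<close>] by blast
  then show ?thesis using assms by blast
qed

end

section \<open>The part of degree at most one of the undeformed algebra\<close>

context nil_module begin

definition expand :: "('k \<Rightarrow> 'w::ab_group_add \<Rightarrow> 'w) \<Rightarrow> ('a \<Rightarrow> 'w) \<Rightarrow> 'a \<Rightarrow> 'w" where
  "expand sW g = vector_space_pair.construct sA sW basis g"

lemma linear_expand:
  assumes "vector_space sW"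
  shows "expand sW g (a + b) = expand sW g a + expand sW g b"
    and "expand sW g (sA k a) = sW k (expand sW g a)"
    and "b' \<in> basis \<Longrightarrow> expand sW g b' = g b'"
proof -
  interpret P: vector_space_pair sA sW
    using assms vector_space_axioms by (simp add: vector_space_pair_def)
  have lin: "Vector_Spaces.linear sA sW (expand sW g)"
    unfolding expand_def by (rule P.linear_construct[OF basis(2)])
  show "expand sW g (a + b) = expand sW g a + expand sW g b"
    using P.linear_add[OF lin] .
  show "expand sW g (sA k a) = sW k (expand sW g a)"
    using P.linear_scale[OF lin] .
  show "b' \<in> basis \<Longrightarrow> expand sW g b' = g b'"
    unfolding expand_def by (rule P.construct_basis[OF basis(2)])
qed

lemma expand_word:
  assumes "vector_space sW" "g 0 = 0"
  shows "expand sW g (word_prod T w) = g (word_prod T w)"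
proof -
  interpret W: vector_space sW by (rule assms(1))
  have "expand sW g 0 = 0" using linear_expand(2)[OF assms(1), of g 0 0] by simp
  then show ?thesis using word_basis[of w] linear_expand(3)[OF assms(1)] assms(2) by metis
qed

lemma vector_space_field: "vector_space ((*) :: 'k \<Rightarrow> 'k \<Rightarrow> 'k)"
  by (rule vector_space.intro) (simp_all only: distrib_left distrib_right mult.assoc mult_1_left)

abbreviation ext_functional :: "('a \<Rightarrow> 'k) \<Rightarrow> 'a \<Rightarrow> 'k" where
  "ext_functional l \<equiv> expand (*) l"

lemmas ext_functional_simps = linear_expand(1,2)[OF vector_space_field]

lemma ext_functional_linear:
  assumes "\<And>a b. l (a + b) = l a + l b" "\<And>k a. l (sA k a) = k * l a"
  shows "ext_functional l = l"
proof
  have zero: "l 0 = 0" using assms(2)[of 0 0] by simp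
  show "ext_functional l a = l a" for a
  proof (induction a rule: words_induct)
    case zero
    then show ?case using ext_functional_simps(2)[of l 0 0] \<open>l 0 = 0\<close> by simp
  next
    case (word w)
    then show ?case using expand_word[OF vector_space_field, of l] \<open>l 0 = 0\<close> by simp
  qed (simp_all add: ext_functional_simps assms)
qed

lemma ext_functional_translate:
  "ext_functional (\<lambda>x. ext_functional l (a * x)) = (\<lambda>x. ext_functional l (a * x))"
  by (rule ext_functional_linear)
     (simp_all add: distrib_left ext_functional_simps flip: scale_mult_right)

text \<open>An element \<open>\<Sum> v \<otimes> a\<close> of \<open>V \<otimes> A\<close> is encoded as the map \<open>l \<mapsto> \<Sum> l(a) v\<close> on linear functionals
  \<open>l\<close>. As these do not form a type, the map is defined on all functions \<open>l\<close> and required to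
  see only the linear extension of the values of \<open>l\<close> on the basis.\<close>

definition tensors :: "(('a \<Rightarrow> 'k) \<Rightarrow> 'v) set" where
  "tensors = {X. \<forall>l. X (ext_functional l) = X l}"

definition tensor_act :: "'a \<Rightarrow> (('a \<Rightarrow> 'k) \<Rightarrow> 'v) \<Rightarrow> ('a \<Rightarrow> 'k) \<Rightarrow> 'v" where
  "tensor_act a X l = expand sV (\<lambda>b. act b (X (\<lambda>x. ext_functional l (b * x)))) a"

lemma tensor_act_simps:
  "tensor_act (a + b) X l = tensor_act a X l + tensor_act b X l"
  "tensor_act (sA k a) X l = sV k (tensor_act a X l)"
  "tensor_act (word_prod T w) X l =
     act (word_prod T w) (X (\<lambda>x. ext_functional l (word_prod T w * x)))"
  unfolding tensor_act_def using V.vector_space_axioms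
  by (simp_all add: linear_expand expand_word)

lemma tensor_act_zero: "tensor_act 0 X l = 0"
  using tensor_act_simps(2)[of 0 0 X l] by simp

lemma tensor_act_add_right: "tensor_act a (\<lambda>l. X l + Y l) l = tensor_act a X l + tensor_act a Y l"
  by (induction a rule: words_induct)
     (simp_all add: tensor_act_zero tensor_act_simps act_add_right V.scale_right_distrib)

lemma tensor_act_scale_right: "tensor_act a (\<lambda>l. sV k (X l)) l = sV k (tensor_act a X l)"
  by (induction a rule: words_induct)
     (simp_all add: tensor_act_zero tensor_act_simps act_scale_right V.scale_right_distrib
        V.scale_left_commute)

lemma tensor_act_mult: "tensor_act (a * b) X l = tensor_act a (tensor_act b X) l"
proof (induction a rule: words_induct)
  case (word w)
  let ?g = "word_prod T w"
  show ?case
  proof (induction b rule: words_induct)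
    case zero
    have "tensor_act 0 X = (\<lambda>_. 0)" by (simp add: fun_eq_iff tensor_act_zero)
    moreover have "tensor_act ?g (\<lambda>_. 0) l = 0"
      using tensor_act_scale_right[of ?g 0 X l] by simp
    ultimately show ?case by (simp add: tensor_act_zero)
  next
    case (add a b)
    have "tensor_act (a + b) X = (\<lambda>l. tensor_act a X l + tensor_act b X l)"
      by (simp add: fun_eq_iff tensor_act_simps)
    then show ?case using add by (simp add: tensor_act_simps tensor_act_add_right distrib_left)
  next
    case (scale k a)
    have "tensor_act (sA k a) X = (\<lambda>l. sV k (tensor_act a X l))"
      by (simp add: fun_eq_iff tensor_act_simps)
    then show ?case
      using scale by (simp add: tensor_act_simps tensor_act_scale_right flip: scale_mult_right)
  next
    case (word u)
    have "?g * word_prod T u = word_prod T (w @ u)" by simp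
    then have "tensor_act (?g * word_prod T u) X l =
        act (?g * word_prod T u) (X (\<lambda>x. ext_functional l (?g * word_prod T u * x)))"
      using tensor_act_simps(3)[of "w @ u" X l] by simp
    then show ?case
      by (simp add: tensor_act_simps act_mult ext_functional_translate mult.assoc)
  qed
qed (simp_all add: tensor_act_zero tensor_act_simps distrib_right flip: scale_mult_left)

lemma tensor_act_one: "X \<in> tensors \<Longrightarrow> tensor_act 1 X = X"
  using tensor_act_simps(3)[of "[]" X] by (auto simp: tensors_def act_one)

lemma tensor_act_closed: "tensor_act a X \<in> tensors"
proof -
  have "ext_functional (ext_functional l) = ext_functional l" for l
    by (rule ext_functional_linear) (simp_all add: ext_functional_simps)
  then show ?thesis by (simp add: tensors_def tensor_act_def)
qed

text \<open>Modulo its elements of degree at least two the undeformed algebra becomes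
  \<open>A \<oplus> (V \<otimes> A)\<close>, on which it acts by left multiplication.\<close>

lemma degree_one_representation:
  "H_representation sA sV act \<Delta> T e c (\<lambda>_ _. 0) (\<lambda>_ _. 0)
     (\<lambda>k (\<alpha>, X). (sA k \<alpha>, \<lambda>l. sV k (X l))) (UNIV \<times> tensors)
     (\<lambda>a (\<alpha>, X). (a * \<alpha>, tensor_act a X))
     (\<lambda>v (\<alpha>, X). (0, \<lambda>l. sV (ext_functional l \<alpha>) v))"
proof -
  have idem: "ext_functional (ext_functional l) = ext_functional l" for l
    by (rule ext_functional_linear) (simp_all add: ext_functional_simps)
  interpret M: vector_space "\<lambda>k (\<alpha>, X :: ('a \<Rightarrow> 'k) \<Rightarrow> 'v). (sA k \<alpha>, \<lambda>l. sV k (X l))"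
    by (rule vector_space.intro)
       (auto simp: fun_eq_iff scale_right_distrib V.scale_right_distrib scale_left_distrib V.scale_left_distrib)
  have zero: "ext_functional l 0 = 0" for l using ext_functional_simps(2)[of l 0 0] by simp
  show ?thesis
  proof
    show "M.subspace (UNIV \<times> tensors)"
      by (auto simp: M.subspace_def tensors_def zero_prod_def)
  qed (auto simp: tensor_act_closed[unfolded tensors_def, simplified] tensor_act_zero plus_fun_def tensors_def idem tensor_act_add_right tensor_act_scale_right
      distrib_left distrib_right tensor_act_simps ext_functional_simps fun_eq_iff zero_prod_def
      V.scale_left_distrib V.scale_right_distrib V.scale_left_commute tensor_act_mult mult.assoc zero
      tensor_act_one[unfolded fun_eq_iff tensors_def] act_scale_right
      tensor_act_simps(3)[of "[i]" for i, simplified] ext_functional_translate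
      simp flip: scale_mult_left scale_mult_right)
qed

abbreviation "kernel0 \<equiv> H_kernel sA sV act \<Delta> (\<lambda>_ _. 0) (\<lambda>_ _. 0)"

interpretation degree_one: H_representation sA sV act \<Delta> T e c "\<lambda>_ _. 0" "\<lambda>_ _. 0"
    "\<lambda>k (\<alpha>, X). (sA k \<alpha>, \<lambda>l. sV k (X l))" "UNIV \<times> tensors"
    "\<lambda>a (\<alpha>, X). (a * \<alpha>, tensor_act a X)" "\<lambda>v (\<alpha>, X). (0, \<lambda>l. sV (ext_functional l \<alpha>) v)"
  by (rule degree_one_representation)

lemma J0_letA:
  assumes "letA a \<in> kernel0" shows "a = 0"
proof -
  have C: "(1, \<lambda>_. 0) \<in> UNIV \<times> tensors" by (simp add: tensors_def)
  show ?thesis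
    using degree_one.J_annihilates[OF assms C] degree_one.rep_letA[OF C, of a] by (simp add: zero_prod_def)
qed

text \<open>The coefficient in \<open>V\<close> at a basis word \<open>b\<close> of the part in \<open>V \<otimes> A\<close>: let the algebra act on
  \<open>1\<close> and evaluate the resulting tensor at the coordinate functional of \<open>b\<close>.\<close>

lemma J0_degree_one_functional:
  assumes b: "b \<in> basis"
  obtains G where "\<And>x y. G (x + y) = G x + G y" "\<And>x y. G (x - y) = G x - G y"
    and "\<And>x. x \<in> kernel0 \<Longrightarrow> G x = 0"
    and "\<And>a v. G (letA a * letV v) = sV (coord b a) (act b v)"
    and "\<And>a v. G (letV v * letA a) = sV (coord b a) v"
proof -
  have C: "(1, \<lambda>_. 0) \<in> UNIV \<times> tensors" by (simp add: tensors_def)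
  have zero: "(\<lambda>_. 0) \<in> tensors" by (simp add: tensors_def)
  have coord: "ext_functional (coord b) = coord b"
    by (rule ext_functional_linear) (simp_all add: coord_add coord_scale)
  define G where "G x = snd (degree_one.rep.run x (1, \<lambda>_. 0)) (coord b)" for x
  have "G (x + y) = G x + G y" "G (x - y) = G x - G y" for x y
    by (simp_all add: G_def)
  moreover have "G x = 0" if "x \<in> kernel0" for x
    using degree_one.J_annihilates[OF that C] by (simp add: G_def zero_prod_def)
  moreover have "G (letA a * letV v) = sV (coord b a) (act b v)" for a v
  proof -
    have "tensor_act a (\<lambda>l. sV (ext_functional l 1) v) (coord b) = sV (coord b a) (act b v)"
    proof (induction a rule: words_induct)
      case zero
      then show ?case using coord_scale[of b 0 0] by (simp add: tensor_act_zero)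
    next
      case (word w)
      show ?case
        using word_basis[of w] coord_scale[of b 0 0]
        by (auto simp: tensor_act_simps coord ext_functional_translate[of "coord b", unfolded coord]
            act_scale_right coord_basis[of _ b] split: if_splits)
    qed (simp_all add: tensor_act_simps coord_add coord_scale V.scale_left_distrib)
    then show ?thesis
      using degree_one.fV_closed[OF C, of v] by (simp add: G_def degree_one.rep.run_mult[OF C] degree_one.rep_letA degree_one.rep_letV zero
          del: degree_one.rep.run_simps(8))
  qed
  moreover have "G (letV v * letA a) = sV (coord b a) v" for a v
    using degree_one.fA_closed[OF C, of a]
    by (simp add: G_def degree_one.rep.run_mult[OF C] degree_one.rep_letA degree_one.rep_letV zero coord
          del: degree_one.rep.run_simps(8))
  ultimately show thesis by (rule that)
qed

lemma T_basis: "T i \<in> basis"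
proof -
  have "c i 0 = 0" using c_scale[of i 0 0] by simp
  then have "T i \<noteq> 0" using c_T[of i i] by auto
  then show ?thesis using word_basis[of "[i]"] by simp
qed

end

section \<open>Necessity of the conditions\<close>

context nil_deformation begin

lemma PBW_homogeneous:
  assumes "PBW sA sV act \<Delta> \<kappa>V \<kappa>A" "homogeneous n x" "x \<in> Below n"
  shows "x \<in> J0"
proof -
  have "component m x \<in> Below m" for m
  proof -
    have "J.equ (component m x) (if m = n then x else 0)"
      using assms(2) by (simp add: homogeneous_def Lin_equ_J)
    then show ?thesis
      using Below_cong[of "component m x" "if m = n then x else 0" m] assms(3) J_Below[OF J.zero_mem]
      by (cases "m = n") auto
  qed
  then show ?thesis using assms(1) by (simp add: PBW_iff_injective)
qed

lemma generator_commutation: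
  "J.equ (letA (T i) * letV v) (letV (act (T i) v) * letA (T i))"
proof -
  have "pure (T i) (T i) \<in> \<Delta> (T i)" using coproduct_word_mem[of "[i]"] by simp
  from H_rels.sweedler[of "pure (T i) (T i)" \<Delta> "T i" v act \<kappa>V \<kappa>A, OF this] show ?thesis
    using H_rels_J by (auto simp: J.equ_def)
qed

lemma commutator_J:
  "J.equ (letV v * letV w - letV w * letV v) (letV (\<kappa>V v w) + letA (\<kappa>A v w))"
proof -
  have "J.equ (letV v * letV w - letV w * letV v) (letter (\<kappa>V v w, \<kappa>A v w))"
    unfolding J.equ_def by (rule subsetD[OF H_rels_J H_rels.commutator])
  also have "J.equ \<dots> (letV (\<kappa>V v w) + letA (\<kappa>A v w))"
    by (rule Lin_equ_J[OF letter_split])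
  finally show ?thesis .
qed

text \<open>Moving \<open>T\<^sub>i\<close> across the commutator of \<open>v\<close> and \<open>w\<close> gives the equivariance
  \<open>T\<^sub>i \<kappa>(v, w) = \<kappa>(T\<^sub>i v, T\<^sub>i w) T\<^sub>i\<close> in the deformed algebra.\<close>

lemma generator_kappa:
  fixes i v w
  defines "v' \<equiv> act (T i) v" and "w' \<equiv> act (T i) w"
  shows "J.equ (letA (T i) * (letV (\<kappa>V v w) + letA (\<kappa>A v w)))
    ((letV (\<kappa>V v' w') + letA (\<kappa>A v' w')) * letA (T i))"
proof -
  let ?t = "letA (T i)"
  have two: "J.equ (?t * (letV x * letV y)) (letV (act (T i) x) * letV (act (T i) y) * ?t)" for x y
  proof -
    have "?t * (letV x * letV y) = (?t * letV x) * letV y" by (simp add: mult.assoc)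
    also have "J.equ \<dots> ((letV (act (T i) x) * ?t) * letV y)"
      by (rule J.equ_mult_right[OF generator_commutation])
    also have "\<dots> = letV (act (T i) x) * (?t * letV y)" by (simp add: mult.assoc)
    also have "J.equ \<dots> (letV (act (T i) x) * (letV (act (T i) y) * ?t))"
      by (rule J.equ_mult_left[OF generator_commutation])
    finally show ?thesis by (simp add: mult.assoc)
  qed
  have "J.equ (?t * (letV (\<kappa>V v w) + letA (\<kappa>A v w))) (?t * (letV v * letV w - letV w * letV v))"
    by (rule J.equ_mult_left[OF J.equ_sym[OF commutator_J]])
  also have "\<dots> = ?t * (letV v * letV w) - ?t * (letV w * letV v)" by (rule right_diff_distrib)
  also have "J.equ \<dots> (letV v' * letV w' * ?t - letV w' * letV v' * ?t)"
    unfolding v'_def w'_def by (intro J.equ_diff two)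
  also have "\<dots> = (letV v' * letV w' - letV w' * letV v') * ?t" by (simp add: left_diff_distrib)
  also have "J.equ \<dots> ((letV (\<kappa>V v' w') + letA (\<kappa>A v' w')) * ?t)"
    by (rule J.equ_mult_right[OF commutator_J])
  finally show ?thesis .
qed

lemma PBW_letA_zero:
  assumes "PBW sA sV act \<Delta> \<kappa>V \<kappa>A" "letA a \<in> J" shows "a = 0"
proof -
  have "letA a \<in> J0"
    by (rule PBW_homogeneous[OF assms(1) homogeneous_letA]) (simp add: Below_def assms(2))
  then show ?thesis by (rule J0_letA)
qed

text \<open>If the right-hand side of \<open>T\<^sub>i \<kappa>(v, w) = \<kappa>(T\<^sub>i v, T\<^sub>i w) T\<^sub>i\<close> vanishes, then the left-hand side
  vanishes in the algebra, and the PBW property separates its parts in degrees one and zero.\<close>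

lemma PBW_kappa_primitive:
  assumes PBW: "PBW sA sV act \<Delta> \<kappa>V \<kappa>A"
    and zero: "\<kappa>V (act (T i) v) (act (T i) w) = 0" "\<kappa>A (act (T i) v) (act (T i) w) = 0"
  shows "act (T i) (\<kappa>V v w) = 0" "T i * \<kappa>A v w = 0"
proof -
  let ?t = "letA (T i)"
  have letter0: "letter (0, 0) \<in> J" using letter_zero Lin_J by blast
  have "J.equ (?t * (letV (\<kappa>V v w) + letA (\<kappa>A v w))) ((letter (0, 0) + letter (0, 0)) * ?t)"
    using generator_kappa[of i v w] by (simp add: zero)
  then have "J.equ (?t * (letV (\<kappa>V v w) + letA (\<kappa>A v w))) 0"
    using J.mem_cong[of "?t * (letV (\<kappa>V v w) + letA (\<kappa>A v w))"] letter0
    by (simp add: J.equ_def J.mult_mem_right J.add_mem J.diff_mem)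
  then have sum: "?t * letV (\<kappa>V v w) + ?t * letA (\<kappa>A v w) \<in> J"
    by (simp add: J.equ_zero_iff distrib_left)
  have A: "?t * letA (\<kappa>A v w) \<in> Fil 0" using Fil_mult[OF Fil_letA Fil_letA] by simp
  have "?t * letV (\<kappa>V v w) \<in> Below 1"
    using Fil_diff[OF J_Fil[OF sum] A] by (simp add: Below_def)
  moreover have "homogeneous 1 (?t * letV (\<kappa>V v w))"
    using homogeneous_mult[OF homogeneous_letA homogeneous_letV] by simp
  ultimately have J0: "?t * letV (\<kappa>V v w) \<in> J0" by (rule PBW_homogeneous[OF PBW, rotated])
  obtain G where G: "\<And>x. x \<in> J0 \<Longrightarrow> G x = 0"
    "\<And>a v. G (letA a * letV v) = sV (coord (T i) a) (act (T i) v)"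
    by (rule J0_degree_one_functional[OF T_basis[of i]]) blast
  show V: "act (T i) (\<kappa>V v w) = 0"
    using G(1)[OF J0] by (simp add: G(2) coord_basis T_basis)
  have "J.equ (?t * letV (\<kappa>V v w)) (letter (0, 0) * ?t)"
    using generator_commutation[of i "\<kappa>V v w"] by (simp add: V)
  then have "?t * letV (\<kappa>V v w) \<in> J"
    using J.mem_cong J.mult_mem_right[OF letter0] by (auto simp: J.equ_def)
  then have "?t * letA (\<kappa>A v w) \<in> J"
    using J.diff_mem[OF sum] by fastforce
  then have "letA (T i * \<kappa>A v w) \<in> J"
    using letA_mult[of "T i" "\<kappa>A v w"] J.mem_cong by (auto simp: J.equ_def)
  then show "T i * \<kappa>A v w = 0" by (rule PBW_letA_zero[OF PBW])
qed

lemma PBW_kappaA_equivariant: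
  assumes PBW: "PBW sA sV act \<Delta> \<kappa>V \<kappa>A" and \<kappa>V: "\<And>v w. \<kappa>V v w = 0"
  shows "T i * \<kappa>A v w = \<kappa>A (act (T i) v) (act (T i) w) * T i"
proof -
  let ?t = "letA (T i)" and ?\<kappa>' = "\<kappa>A (act (T i) v) (act (T i) w)"
  have zero: "J.equ (letter (0, 0) + x) x" for x
    using letter_zero Lin_J by (auto simp: J.equ_def)
  have "J.equ (letA (T i * \<kappa>A v w)) (?t * letA (\<kappa>A v w))"
    by (rule J.equ_sym[OF letA_mult])
  also have "J.equ \<dots> (?t * (letter (0, 0) + letA (\<kappa>A v w)))"
    by (rule J.equ_mult_left[OF J.equ_sym[OF zero]])
  also have "J.equ \<dots> ((letter (0, 0) + letA ?\<kappa>') * ?t)"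
    using generator_kappa[of i v w] by (simp only: \<kappa>V)
  also have "J.equ \<dots> (letA ?\<kappa>' * ?t)" by (rule J.equ_mult_right[OF zero])
  also have "J.equ \<dots> (letA (?\<kappa>' * T i))" by (rule letA_mult)
  finally have eq: "J.equ (letA (T i * \<kappa>A v w)) (letA (?\<kappa>' * T i))" .
  have "J.equ (letA (T i * \<kappa>A v w)) (letA (T i * \<kappa>A v w - ?\<kappa>' * T i) + letA (?\<kappa>' * T i))"
    using Lin_equ_J[OF letA_add[of "T i * \<kappa>A v w - ?\<kappa>' * T i" "?\<kappa>' * T i"]] by simp
  then have "J.equ (letA (T i * \<kappa>A v w - ?\<kappa>' * T i) + letA (?\<kappa>' * T i)) (letA (?\<kappa>' * T i))"
    using eq J.equ_trans J.equ_sym by blast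
  then have "letA (T i * \<kappa>A v w - ?\<kappa>' * T i) \<in> J"
    by (simp add: J.equ_def)
  then have "T i * \<kappa>A v w - ?\<kappa>' * T i = 0" by (rule PBW_letA_zero[OF PBW])
  then show ?thesis by simp
qed

text \<open>In the associative deformed algebra the double commutators of three elements of \<open>V\<close> sum to zero
  cyclically. With \<open>[x, y] = \<kappa>\<^sub>A(x, y)\<close> this becomes a relation in degree one, which the PBW property
  transports to \<open>V \<otimes> A\<close>; the claim is its coordinate at the basis word \<open>b\<close>.\<close>

lemma PBW_jacobi:
  assumes PBW: "PBW sA sV act \<Delta> \<kappa>V \<kappa>A" and \<kappa>V: "\<And>v w. \<kappa>V v w = 0" and b: "b \<in> basis"
  defines "u \<equiv> \<lambda>x y z. sV (coord b (\<kappa>A x y)) z"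
  shows "act b (u v\<^sub>1 v\<^sub>2 v\<^sub>3 + u v\<^sub>2 v\<^sub>3 v\<^sub>1 + u v\<^sub>3 v\<^sub>1 v\<^sub>2) = u v\<^sub>1 v\<^sub>2 v\<^sub>3 + u v\<^sub>2 v\<^sub>3 v\<^sub>1 + u v\<^sub>3 v\<^sub>1 v\<^sub>2"
proof -
  let ?D = "\<lambda>x y z. letA (\<kappa>A x y) * letV z - letV z * letA (\<kappa>A x y)"
  let ?C = "\<lambda>x y. letV x * letV y - letV y * letV x"
  have comm: "J.equ (?C x y) (letA (\<kappa>A x y))" for x y
  proof -
    have "J.equ (?C x y) (letter (0, 0) + letA (\<kappa>A x y))"
      using commutator_J[of x y] by (simp only: \<kappa>V)
    also have "J.equ \<dots> (letA (\<kappa>A x y))" using letter_zero Lin_J by (auto simp: J.equ_def)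
    finally show ?thesis .
  qed
  have D: "J.equ (?C x y * letV z - letV z * ?C x y) (?D x y z)" for x y z
    by (intro J.equ_diff J.equ_mult_left J.equ_mult_right comm)
  let ?X = "?D v\<^sub>1 v\<^sub>2 v\<^sub>3 + ?D v\<^sub>2 v\<^sub>3 v\<^sub>1 + ?D v\<^sub>3 v\<^sub>1 v\<^sub>2"
  have "J.equ ((?C v\<^sub>1 v\<^sub>2 * letV v\<^sub>3 - letV v\<^sub>3 * ?C v\<^sub>1 v\<^sub>2) + (?C v\<^sub>2 v\<^sub>3 * letV v\<^sub>1 - letV v\<^sub>1 * ?C v\<^sub>2 v\<^sub>3)
      + (?C v\<^sub>3 v\<^sub>1 * letV v\<^sub>2 - letV v\<^sub>2 * ?C v\<^sub>3 v\<^sub>1)) ?X"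
    by (intro J.equ_add D)
  then have "J.equ 0 ?X" by (simp add: algebra_simps)
  then have "?X \<in> J" using J.equ_sym J.equ_zero_iff by blast
  moreover have "homogeneous 1 (?D x y z)" for x y z
    using homogeneous_mult[OF homogeneous_letA homogeneous_letV, of "\<kappa>A x y" z]
      homogeneous_mult[OF homogeneous_letV homogeneous_letA, of z "\<kappa>A x y"]
    by (simp add: homogeneous_diff)
  then have "homogeneous 1 ?X" by (intro homogeneous_add)
  ultimately have J0: "?X \<in> J0" using PBW_homogeneous[OF PBW _ J_Below] by blast
  obtain G where G: "\<And>x y. G (x + y) = G x + G y" "\<And>x y. G (x - y) = G x - G y"
      "\<And>x. x \<in> J0 \<Longrightarrow> G x = 0"
      "\<And>a v. G (letA a * letV v) = sV (coord b a) (act b v)" "\<And>a v. G (letV v * letA a) = sV (coord b a) v"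
    by (rule J0_degree_one_functional[OF b]) blast
  show ?thesis
    using G(3)[OF J0] unfolding G(1,2,4,5) by (simp add: u_def act_add_right act_scale_right algebra_simps)
qed

text \<open>The vector fixed by \<open>b\<close> in the Jacobi identity vanishes unless \<open>b = 1\<close>, as nonempty words are
  nilpotent. So \<open>\<kappa>\<^sub>A(v, w)\<close> is a multiple of \<open>1\<close>, and equivariance kills its augmentation.\<close>

theorem PBW_kappaA_zero:
  assumes PBW: "PBW sA sV act \<Delta> \<kappa>V \<kappa>A" and \<kappa>V: "\<And>v w. \<kappa>V v w = 0"
    and \<kappa>A: "alternating_bilinear sV sA \<kappa>A"
    and dim: "\<not> dim_at_most sV 2"
  shows "\<kappa>A v w = 0"
proof -
  obtain N where N: "\<And>u. N \<le> length u \<Longrightarrow> word_prod T u = 0" using words_nilpotent by blast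
  have \<kappa>A_zero: "\<kappa>A 0 x = 0" for x
  proof -
    have "Vector_Spaces.linear sV sA (\<lambda>v. \<kappa>A v x)" using \<kappa>A by (simp add: alternating_bilinear_def)
    then interpret Vector_Spaces.linear sV sA "\<lambda>v. \<kappa>A v x" .
    show ?thesis by (rule zero)
  qed
  have e_zero: "e 0 = 0" using e_scale[of 0 0] by simp
  have augmentation: "e (\<kappa>A v w) = 0" for v w
  proof -
    fix i :: 'i
    \<comment> \<open>The coefficient of \<open>T\<^sub>i\<close> in \<open>T\<^sub>i a\<close> and in \<open>a T\<^sub>i\<close> is the augmentation of \<open>a\<close>.\<close>
    have step: "e (\<kappa>A x y) = e (\<kappa>A (act (T i) x) (act (T i) y))" for x y
      using arg_cong[OF PBW_kappaA_equivariant[OF PBW \<kappa>V, of i x y], of "c i"]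
      by (simp add: c_mult e_T c_T)
    have "e (\<kappa>A v w) = e (\<kappa>A (act (word_prod T (replicate n i)) v) (act (word_prod T (replicate n i)) w))" for n
    proof (induction n)
      case (Suc n)
      then show ?case using step by (simp add: act_mult)
    qed (simp add: act_one)
    moreover have "word_prod T (replicate N i) = 0" by (rule N) simp
    ultimately show ?thesis by (metis act_zero_left \<kappa>A_zero e_zero)
  qed
  have "V.span {v, w} \<noteq> UNIV"
  proof
    assume span: "V.span {v, w} = UNIV"
    obtain B where B: "B \<subseteq> {v, w}" "V.independent B" "{v, w} \<subseteq> V.span B"
      using V.maximal_independent_subset[of "{v, w}"] by blast
    then have "V.span B = UNIV" using span V.span_minimal[OF B(3)] by auto
    moreover have "card B \<le> 2" "finite B"
      using card_mono[OF _ B(1)] card_insert_le_m1[of 2 "{w}" v] finite_subset[OF B(1)] by auto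
    ultimately show False using dim B(2) by (auto simp: dim_at_most_def)
  qed
  then obtain z where z: "z \<notin> V.span {v, w}" by blast
  have coord: "coord b (\<kappa>A v w) = 0" if b: "b \<in> basis" "b \<noteq> 1" for b
  proof -
    let ?u = "sV (coord b (\<kappa>A v w)) z + sV (coord b (\<kappa>A w z)) v + sV (coord b (\<kappa>A z v)) w"
    obtain g where g: "b = word_prod T g" using b basis(1) by auto
    then have len: "length g \<ge> 1" using b(2) by (cases g) auto
    have fixed: "act b ?u = ?u" by (rule PBW_jacobi[OF PBW \<kappa>V b(1)])
    have "act (word_prod T (concat (replicate n g))) ?u = ?u" for n
      by (induction n) (simp_all add: act_one act_mult fixed flip: g)
    moreover have "N \<le> length (concat (replicate N g))"
      using len by (simp add: length_concat sum_list_replicate)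
    ultimately have "?u = 0" using N[of "concat (replicate N g)"] by (metis act_zero_left)
    then have "sV (coord b (\<kappa>A v w)) z = - (sV (coord b (\<kappa>A w z)) v + sV (coord b (\<kappa>A z v)) w)"
      unfolding eq_neg_iff_add_eq_0 by (simp only: add.assoc)
    also have "\<dots> \<in> V.span {v, w}"
      by (intro V.span_neg V.span_add V.span_scale V.span_base) auto
    finally have "sV (coord b (\<kappa>A v w)) z \<in> V.span {v, w}" .
    then show ?thesis
      using z V.span_scale[of _ "{v, w}" "inverse (coord b (\<kappa>A v w))"]
      by (cases "coord b (\<kappa>A v w) = 0") force+
  qed
  have "\<kappa>A v w = sA (coord 1 (\<kappa>A v w)) 1"
  proof -
    have "{b. coord b (\<kappa>A v w) \<noteq> 0} \<subseteq> {1}" using coord coord_nonzero_basis by blast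
    then have "(\<Sum>b | coord b (\<kappa>A v w) \<noteq> 0. sA (coord b (\<kappa>A v w)) b) =
        (\<Sum>b\<in>{1}. sA (coord b (\<kappa>A v w)) b)"
      by (intro sum.mono_neutral_left) auto
    then show ?thesis using coord_expansion(2)[of "\<kappa>A v w"] by simp
  qed
  moreover from this have "coord 1 (\<kappa>A v w) = 0"
    using augmentation[of v w] e_scale[of "coord 1 (\<kappa>A v w)" 1] by (simp add: e_one)
  ultimately show ?thesis by simp
qed

end

section \<open>A representation on formal monomials in dimension two\<close>

text \<open>\<open>V\<close> has the basis \<open>v\<^sub>1, v\<^sub>2\<close> with coordinate functions \<open>cx, cy\<close>. As the generators act
  nilpotently on \<open>V\<close>, a basis can be chosen in which they act by \<open>v\<^sub>1 \<mapsto> 0\<close> and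
  \<open>v\<^sub>2 \<mapsto> \<gamma> v\<^sub>1\<close>.\<close>

locale plane_deformation = nil_deformation sA sV act \<Delta> T e c \<kappa>V \<kappa>A
  for sA :: "'k::field \<Rightarrow> 'a::ring_1 \<Rightarrow> 'a" and sV :: "'k \<Rightarrow> 'v::ab_group_add \<Rightarrow> 'v" and act \<Delta>
    and T :: "'i::finite \<Rightarrow> 'a" and e c \<kappa>V \<kappa>A +
  fixes v\<^sub>1 v\<^sub>2 :: 'v and cx cy :: "'v \<Rightarrow> 'k" and \<gamma> :: "'i \<Rightarrow> 'k" and lam :: 'k and q :: 'a
  assumes expansion: "v = sV (cx v) v\<^sub>1 + sV (cy v) v\<^sub>2"
    and x_add: "cx (v + w) = cx v + cx w" and x_scale: "cx (sV k v) = k * cx v"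
    and y_add: "cy (v + w) = cy v + cy w" and y_scale: "cy (sV k v) = k * cy v"
    and xy_basis: "cx v\<^sub>1 = 1" "cy v\<^sub>1 = 0" "cx v\<^sub>2 = 0" "cy v\<^sub>2 = 1"
    and T_v1: "act (T i) v\<^sub>1 = 0" and T_v2: "act (T i) v\<^sub>2 = sV (\<gamma> i) v\<^sub>1"
    and \<kappa>V_eq: "\<kappa>V v w = sV ((cx v * cy w - cx w * cy v) * lam) v\<^sub>1"
    and \<kappa>A_eq: "\<kappa>A v w = sA (cx v * cy w - cx w * cy v) q"
    and T_q: "T i * q = 0" and e_q: "e q = 0"
begin

text \<open>The correction term in \<open>a v\<^sub>2\<^sup>j = e(a) v\<^sub>2\<^sup>j + v\<^sub>1\<^sup>j tau\<^sub>j(a)\<close> for \<open>j > 0\<close>. Words of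
  length at least two do not contribute: \<open>T\<^sub>k T\<^sub>l v\<^sub>2\<^sup>j\<close> is a multiple of
  \<open>T\<^sub>k v\<^sub>1\<^sup>j T\<^sub>l = 0\<close>.\<close>

definition tau :: "nat \<Rightarrow> 'a \<Rightarrow> 'a" where
  "tau j a = (\<Sum>i\<in>UNIV. sA (c i a * \<gamma> i ^ j) (T i))"

text \<open>A function \<open>f\<close> stands for the formal sum of the \<open>v\<^sub>1\<^sup>i v\<^sub>2\<^sup>j f(i, j)\<close>. The action of
  \<open>a\<close> is forced by \<open>a v\<^sub>1 = e(a) v\<^sub>1\<close> and \<open>T\<^sub>k v\<^sub>2\<^sup>j = \<gamma>\<^sub>k\<^sup>j v\<^sub>1\<^sup>j T\<^sub>k\<close>. The action of
  \<open>v\<^sub>2\<close> deforms the shift in the second variable by the commutators that arise when \<open>v\<^sub>2\<close> is moved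
  across \<open>v\<^sub>1\<^sup>i\<close>; \<open>opQ\<close> collects their \<open>A\<close>-parts, of which only \<open>v\<^sub>1\<^sup>i\<^sup>-\<^sup>1 q v\<^sub>2\<^sup>j\<close>
  survives because \<open>q v\<^sub>1 = 0\<close>.\<close>

definition opA :: "'a \<Rightarrow> (nat \<Rightarrow> nat \<Rightarrow> 'a) \<Rightarrow> nat \<Rightarrow> nat \<Rightarrow> 'a" where
  "opA a f i j = (if i = 0 \<and> j = 0 then a * f 0 0 else
     sA (e a) (f i j) + (if j = 0 then tau i a * f 0 i else 0))"

definition op1 :: "(nat \<Rightarrow> nat \<Rightarrow> 'a) \<Rightarrow> nat \<Rightarrow> nat \<Rightarrow> 'a" where
  "op1 f i j = (if i = 0 then 0 else f (i - 1) j)"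

definition opQ :: "(nat \<Rightarrow> nat \<Rightarrow> 'a) \<Rightarrow> nat \<Rightarrow> nat \<Rightarrow> 'a" where
  "opQ f i j = (if j = 0 then q * f (Suc i) 0 + (\<Sum>s=1..i. tau s q * f (Suc i - s) s) else 0)"

definition op2 :: "(nat \<Rightarrow> nat \<Rightarrow> 'a) \<Rightarrow> nat \<Rightarrow> nat \<Rightarrow> 'a" where
  "op2 f i j = (if j = 0 then 0 else f i (j - 1)) - sA (lam * of_nat i) (f i j) - opQ f i j"

definition opV :: "'v \<Rightarrow> (nat \<Rightarrow> nat \<Rightarrow> 'a) \<Rightarrow> nat \<Rightarrow> nat \<Rightarrow> 'a" where
  "opV v f i j = sA (cx v) (op1 f i j) + sA (cy v) (op2 f i j)"

definition op_scale :: "'k \<Rightarrow> (nat \<Rightarrow> nat \<Rightarrow> 'a) \<Rightarrow> nat \<Rightarrow> nat \<Rightarrow> 'a" where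
  "op_scale k f i j = sA k (f i j)"

lemma tau_add: "tau j (a + b) = tau j a + tau j b"
  by (simp add: tau_def c_add distrib_right scale_left_distrib sum.distrib)

lemma tau_scale: "tau j (sA k a) = sA k (tau j a)"
  by (simp add: tau_def c_scale scale_sum_right mult.assoc)

lemma tau_mult: "tau j (a * b) = sA (e a) (tau j b) + sA (e b) (tau j a)"
  by (simp add: tau_def c_mult scale_left_distrib sum.distrib scale_sum_right algebra_simps)

lemma tau_T: "tau j (T i) = sA (\<gamma> i ^ j) (T i)"
proof -
  have "tau j (T i) = (\<Sum>k\<in>UNIV. if k = i then sA (\<gamma> i ^ j) (T i) else 0)"
    unfolding tau_def by (rule sum.cong) (auto simp: c_T)
  then show ?thesis by simp
qed

lemma tau_one: "tau j 1 = 0"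
  using tau_mult[of j 1 1] by (simp add: e_one)

lemma op_add:
  "opA (a + b) f i j = opA a f i j + opA b f i j"
  "opA a (\<lambda>i j. f i j + g i j) i j = opA a f i j + opA a g i j"
  "op1 (\<lambda>i j. f i j + g i j) i j = op1 f i j + op1 g i j"
  "opQ (\<lambda>i j. f i j + g i j) i j = opQ f i j + opQ g i j"
  "op2 (\<lambda>i j. f i j + g i j) i j = op2 f i j + op2 g i j"
proof -
  show Q: "opQ (\<lambda>i j. f i j + g i j) i j = opQ f i j + opQ g i j"
    by (simp add: opQ_def distrib_left sum.distrib algebra_simps)
  show "op2 (\<lambda>i j. f i j + g i j) i j = op2 f i j + op2 g i j"
    by (simp add: op2_def Q scale_right_distrib algebra_simps)
qed (simp_all add: opA_def op1_def e_add tau_add distrib_left distrib_right scale_left_distrib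
      scale_right_distrib algebra_simps)

lemma op_scaled:
  "opA (sA k a) f i j = sA k (opA a f i j)"
  "opA a (\<lambda>i j. sA k (f i j)) i j = sA k (opA a f i j)"
  "op1 (\<lambda>i j. sA k (f i j)) i j = sA k (op1 f i j)"
  "opQ (\<lambda>i j. sA k (f i j)) i j = sA k (opQ f i j)"
  "op2 (\<lambda>i j. sA k (f i j)) i j = sA k (op2 f i j)"
proof -
  show Q: "opQ (\<lambda>i j. sA k (f i j)) i j = sA k (opQ f i j)"
    by (simp add: opQ_def scale_right_distrib scale_sum_right flip: scale_mult_right)
  show "op2 (\<lambda>i j. sA k (f i j)) i j = sA k (op2 f i j)"
    by (simp add: op2_def Q scale_right_diff_distrib mult_ac)
qed (simp_all add: opA_def op1_def e_scale tau_scale scale_right_distrib mult_ac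
      flip: scale_mult_left scale_mult_right)

lemma opA_one: "opA 1 f = f"
  by (auto simp: opA_def fun_eq_iff e_one tau_one)

lemma opA_mult: "opA (a * b) f i j = opA a (opA b f) i j"
  by (simp add: opA_def e_mult tau_mult scale_right_distrib distrib_left distrib_right mult.assoc
        mult.commute[of "e a"] flip: scale_mult_left scale_mult_right)

lemma opA_T_op1: "opA (T i) (op1 f) m n = 0"
  by (simp add: opA_def op1_def e_T)

lemma opA_T_op2: "opA (T i) (op2 f) m n = sA (\<gamma> i) (op1 (opA (T i) f) m n)"
proof (cases "n = 0 \<and> m \<noteq> 0")
  case False
  have "T i * op2 f 0 0 = - (T i * q * f 1 0)"
    by (simp add: op2_def opQ_def algebra_simps)
  then show ?thesis using False by (auto simp: opA_def op1_def e_T T_q)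
next
  case True
  then obtain m' where m: "m = Suc m'" by (cases m) auto
  have "op2 f 0 (Suc m') = f 0 m'" by (simp add: op2_def opQ_def)
  then show ?thesis
    using True by (cases m') (simp_all add: m opA_def op1_def e_T tau_T flip: scale_mult_left)
qed

text \<open>Apart from the scalar term this compares \<open>opQ\<close> for \<open>v\<^sub>1 f\<close> at \<open>(i, 0)\<close> and for \<open>f\<close> at
  \<open>(i - 1, 0)\<close>. The sums differ only by the summand with \<open>s = i\<close>, which is the correction term in
  the action of \<open>q\<close>.\<close>

lemma op_commutator: "op1 (op2 f) i j - op2 (op1 f) i j = sA lam (op1 f i j) + opA q f i j"
proof (cases i)
  case 0
  then show ?thesis by (simp add: op1_def op2_def opQ_def opA_def e_q)
next
  case (Suc m)
  have "opQ (op1 f) (Suc m) j - opQ f m j = (if j = 0 then tau (Suc m) q * f 0 (Suc m) else 0)"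
  proof (cases "j = 0")
    case True
    have "(\<Sum>s=1..Suc m. tau s q * op1 f (Suc (Suc m) - s) s) = (\<Sum>s=1..Suc m. tau s q * f (Suc m - s) s)"
      by (rule sum.cong) (auto simp: op1_def Suc_diff_le)
    then show ?thesis using True by (simp add: opQ_def op1_def)
  qed (simp add: opQ_def)
  then have "opQ (op1 f) (Suc m) j = opQ f m j + (if j = 0 then tau (Suc m) q * f 0 (Suc m) else 0)"
    by (simp add: algebra_simps)
  then show ?thesis
    by (simp add: Suc op1_def[of "op2 f"] op2_def opA_def e_q)
       (simp add: op1_def algebra_simps)
qed

lemma plane_representation:
  "H_representation sA sV act \<Delta> T e c \<kappa>V \<kappa>A op_scale UNIV opA opV"
proof -
  have x_T: "cx (act (T i) v) = cy v * \<gamma> i" and y_T: "cy (act (T i) v) = 0" for i v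
  proof -
    have "act (T i) v = sV (cy v * \<gamma> i) v\<^sub>1"
      by (subst expansion[of v]) (simp add: act_add_right act_scale_right T_v1 T_v2)
    then show "cx (act (T i) v) = cy v * \<gamma> i" "cy (act (T i) v) = 0"
      by (simp_all add: x_scale y_scale xy_basis)
  qed
  interpret M: vector_space op_scale
    by (rule vector_space.intro)
       (auto simp: op_scale_def fun_eq_iff plus_fun_def scale_right_distrib scale_left_distrib)
  have opV_opV: "opV v (opV w f) i j =
      sA (cx v) (sA (cx w) (op1 (op1 f) i j) + sA (cy w) (op1 (op2 f) i j)) +
      sA (cy v) (sA (cx w) (op2 (op1 f) i j) + sA (cy w) (op2 (op2 f) i j))" for v w f i j
    unfolding opV_def[abs_def] by (simp only: op_add op_scaled)
  show ?thesis
  proof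
    show "M.subspace UNIV" by simp
  next
    fix i v and f :: "nat \<Rightarrow> nat \<Rightarrow> 'a"
    show "opA (T i) (opV v f) = opV (act (T i) v) (opA (T i) f)"
    proof (intro ext)
      fix m n
      have "opA (T i) (opV v f) m n = sA (cx v) (opA (T i) (op1 f) m n) + sA (cy v) (opA (T i) (op2 f) m n)"
        unfolding opV_def[abs_def] by (simp only: op_add op_scaled)
      then show "opA (T i) (opV v f) m n = opV (act (T i) v) (opA (T i) f) m n"
        by (simp add: opA_T_op1 opA_T_op2) (simp add: opV_def x_T y_T)
    qed
  next
    fix v w and f :: "nat \<Rightarrow> nat \<Rightarrow> 'a"
    show "opV v (opV w f) - opV w (opV v f) = opV (\<kappa>V v w) f + opA (\<kappa>A v w) f"
    proof (intro ext)
      fix i j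
      let ?D = "cx v * cy w - cx w * cy v"
      have "(opV v (opV w f) - opV w (opV v f)) i j = sA ?D (op1 (op2 f) i j - op2 (op1 f) i j)"
        by (simp add: opV_opV scale_right_distrib scale_right_diff_distrib scale_left_diff_distrib mult.commute)
      also have "\<dots> = (opV (\<kappa>V v w) f + opA (\<kappa>A v w) f) i j"
        by (simp add: op_commutator op_scaled opV_def \<kappa>V_eq \<kappa>A_eq x_scale y_scale xy_basis scale_right_distrib)
      finally show "(opV v (opV w f) - opV w (opV v f)) i j = (opV (\<kappa>V v w) f + opA (\<kappa>A v w) f) i j" .
    qed
  qed (auto simp: fun_eq_iff plus_fun_def op_scale_def[abs_def] op_add op_scaled opA_one opA_mult opV_def[abs_def]
      x_add y_add x_scale y_scale scale_left_distrib scale_right_distrib mult_ac)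
qed

sublocale plane: H_representation sA sV act \<Delta> T e c \<kappa>V \<kappa>A op_scale UNIV opA opV
  by (rule plane_representation)

definition degree_at_most :: "nat \<Rightarrow> (nat \<Rightarrow> nat \<Rightarrow> 'a) set" where
  "degree_at_most n = {f. \<forall>i j. n < i + j \<longrightarrow> f i j = 0}"

lemma degree_at_mostD: "f \<in> degree_at_most n \<Longrightarrow> n < i + j \<Longrightarrow> f i j = 0"
  by (simp add: degree_at_most_def)

lemma degree_at_most_opA: "f \<in> degree_at_most n \<Longrightarrow> opA a f \<in> degree_at_most n"
  by (auto simp: degree_at_most_def opA_def)

lemma degree_at_most_opV:
  assumes f: "f \<in> degree_at_most n" shows "opV v f \<in> degree_at_most (Suc n)"
  unfolding degree_at_most_def
proof (intro CollectI allI impI)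
  fix i j assume ij: "Suc n < i + j"
  have "opQ f i j = 0"
  proof (cases "j = 0")
    case True
    have "f (Suc i - s) s = 0" if "s \<le> i" for s
      by (rule degree_at_mostD[OF f]) (use ij that True in simp)
    then have "(\<Sum>s=1..i. tau s q * f (Suc i - s) s) = 0"
      by (intro sum.neutral) auto
    moreover have "f (Suc i) 0 = 0"
      by (rule degree_at_mostD[OF f]) (use ij True in simp)
    ultimately show ?thesis by (simp add: opQ_def)
  qed (simp add: opQ_def)
  then show "opV v f i j = 0"
    using ij by (auto simp: opV_def op1_def op2_def degree_at_mostD[OF f])
qed

lemma Fil_raises_degree:
  "x \<in> Fil n \<Longrightarrow> f \<in> degree_at_most k \<Longrightarrow> plane.rep.run x f \<in> degree_at_most (n + k)"
proof (induction arbitrary: f k rule: Fil_induct)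
  case (equ n x y)
  have "plane.rep.run (x - y) f = 0"
    using equ(1) by (intro plane.J_annihilates) (auto simp: J.equ_def)
  then show ?case using equ(2)[OF equ(3)] by simp
next
  case (letA a)
  then show ?case by (simp add: plane.rep_letA degree_at_most_opA del: plane.rep.run_simps(8))
next
  case (letV v)
  then show ?case by (simp add: plane.rep_letV degree_at_most_opV del: plane.rep.run_simps(8))
next
  case (Suc n x)
  then show ?case by (fastforce simp: degree_at_most_def)
next
  case (uminus n x)
  have "plane.rep.run (- x) f = - plane.rep.run x f"
    using plane.rep.run_simps(3)[of 0 x f] by simp
  then show ?case using uminus by (simp add: degree_at_most_def)
next
  case (add n x y)
  then show ?case by (simp add: degree_at_most_def)
next
  case (mult n l x y)
  then show ?case using mult.IH(1)[OF mult.IH(2)[OF mult.prems]] by (simp add: plane.rep.run_mult add.assoc)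
qed simp

abbreviation unit_at :: "nat \<Rightarrow> nat \<Rightarrow> 'a \<Rightarrow> nat \<Rightarrow> nat \<Rightarrow> 'a" where
  "unit_at m n a \<equiv> \<lambda>i j. if i = m \<and> j = n then a else 0"

definition monomial :: "nat \<Rightarrow> nat \<Rightarrow> 'a \<Rightarrow> ('v \<times> 'a, 'k) free_alg" where
  "monomial i j a = letV v\<^sub>1 ^ i * letV v\<^sub>2 ^ j * letA a"

lemma run_monomial: "plane.rep.run (monomial i j a) (unit_at 0 0 1) = unit_at i j a"
proof -
  have A: "plane.rep.run (letA a) (unit_at 0 0 1) = unit_at 0 0 a"
    unfolding plane.rep_letA[OF UNIV_I] by (auto simp: opA_def fun_eq_iff)
  have V2: "plane.rep.run (letV v\<^sub>2) (unit_at 0 n a) = unit_at 0 (Suc n) a" for n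
    unfolding plane.rep_letV[OF UNIV_I]
    by (auto simp: opV_def op2_def opQ_def fun_eq_iff xy_basis intro!: sum.neutral)
  have V1: "plane.rep.run (letV v\<^sub>1) (unit_at m n a) = unit_at (Suc m) n a" for m n
    unfolding plane.rep_letV[OF UNIV_I]
    by (auto simp: opV_def op1_def fun_eq_iff xy_basis)
  have "plane.rep.run (letV v\<^sub>2 ^ j) (unit_at 0 0 a) = unit_at 0 j a"
    by (induction j) (simp_all add: plane.rep.run_mult V2 del: plane.rep.run_simps(8))
  moreover have "plane.rep.run (letV v\<^sub>1 ^ i) (unit_at 0 j a) = unit_at i j a"
    by (induction i) (simp_all add: plane.rep.run_mult V1 del: plane.rep.run_simps(8))
  ultimately show ?thesis
    by (simp add: monomial_def plane.rep.run_mult A del: plane.rep.run_simps(8))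
qed

end

section \<open>The PBW property in dimension two\<close>

context plane_deformation begin

text \<open>The monomials of degree \<open>n\<close> span the degree \<open>n\<close> part of the undeformed algebra. Spanning is
  enough, as the coefficients will be recovered from the representation.\<close>

definition monomial_span :: "nat \<Rightarrow> ('v \<times> 'a, 'k) free_alg set" where
  "monomial_span n = {x. \<exists>\<alpha>. J0.equ x (\<Sum>i\<le>n. monomial i (n - i) (\<alpha> i))}"

lemma letA_add_J0: "J0.equ (letA (a + b)) (letA a + letA b)"
  using letA_add Lin_J0 by (auto simp: J0.equ_def Lin.equ_def)

lemma letA_scale_J0: "J0.equ (letA (sA k a)) (scalar k * letA a)"
  using letA_scale Lin_J0 by (auto simp: J0.equ_def Lin.equ_def)

lemma letter_zero_J0: "letter (0, 0) \<in> J0"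
  using letter_zero Lin_J0 by blast

lemma monomial_zero: "monomial i j 0 \<in> J0"
  unfolding monomial_def by (rule J0.mult_mem_left[OF letter_zero_J0])

lemma monomial_span_equ: "J0.equ x y \<Longrightarrow> y \<in> monomial_span n \<Longrightarrow> x \<in> monomial_span n"
  unfolding monomial_span_def using J0.equ_trans by blast

lemma monomial_span_mem: "monomial i j a \<in> monomial_span (i + j)"
proof -
  let ?\<alpha> = "\<lambda>k. if k = i then a else 0"
  have "J0.equ (\<Sum>k\<le>i + j. monomial k (i + j - k) (?\<alpha> k))
      (\<Sum>k\<le>i + j. if k = i then monomial i j a else 0)"
    using monomial_zero by (intro J0.equ_sum) (auto simp: J0.equ_zero_iff)
  then have "J0.equ (\<Sum>k\<le>i + j. monomial k (i + j - k) (?\<alpha> k)) (monomial i j a)" by simp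
  then show ?thesis
    unfolding monomial_span_def by (intro CollectI exI[of _ ?\<alpha>]) (rule J0.equ_sym)
qed

lemma monomial_span_add:
  assumes "x \<in> monomial_span n" "y \<in> monomial_span n" shows "x + y \<in> monomial_span n"
proof -
  obtain \<alpha> \<beta> where "J0.equ x (\<Sum>i\<le>n. monomial i (n - i) (\<alpha> i))" "J0.equ y (\<Sum>i\<le>n. monomial i (n - i) (\<beta> i))"
    using assms by (auto simp: monomial_span_def)
  then have "J0.equ (x + y) (\<Sum>i\<le>n. monomial i (n - i) (\<alpha> i) + monomial i (n - i) (\<beta> i))"
    unfolding sum.distrib by (rule J0.equ_add)
  also have "J0.equ \<dots> (\<Sum>i\<le>n. monomial i (n - i) (\<alpha> i + \<beta> i))"
    unfolding monomial_def distrib_left[symmetric]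
    by (intro J0.equ_sum J0.equ_mult_left J0.equ_sym[OF letA_add_J0])
  finally show ?thesis by (auto simp: monomial_span_def)
qed

lemma monomial_span_scalar:
  assumes "x \<in> monomial_span n" shows "scalar k * x \<in> monomial_span n"
proof -
  obtain \<alpha> where "J0.equ x (\<Sum>i\<le>n. monomial i (n - i) (\<alpha> i))"
    using assms by (auto simp: monomial_span_def)
  then have "J0.equ (scalar k * x) (scalar k * (\<Sum>i\<le>n. monomial i (n - i) (\<alpha> i)))"
    by (rule J0.equ_mult_left)
  also have "\<dots> = (\<Sum>i\<le>n. letV v\<^sub>1 ^ i * letV v\<^sub>2 ^ (n - i) * (scalar k * letA (\<alpha> i)))"
    unfolding sum_distrib_left monomial_def
    by (simp only: scalar_mult_left_commute)
  also have "J0.equ \<dots> (\<Sum>i\<le>n. monomial i (n - i) (sA k (\<alpha> i)))"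
    unfolding monomial_def by (intro J0.equ_sum J0.equ_mult_left J0.equ_sym[OF letA_scale_J0])
  finally show ?thesis by (auto simp: monomial_span_def)
qed

lemma monomial_span_J0: "x \<in> J0 \<Longrightarrow> x \<in> monomial_span n"
  using monomial_span_equ[of x "monomial 0 n 0" n] monomial_span_mem[of 0 n 0]
    J0.diff_mem[OF _ monomial_zero] by (simp add: J0.equ_def)

lemma monomial_span_sum:
  "(\<And>s. s \<in> S \<Longrightarrow> f s \<in> monomial_span n) \<Longrightarrow> sum f S \<in> monomial_span n"
  by (induction S rule: infinite_finite_induct)
     (auto intro: monomial_span_add monomial_span_J0[OF J0.zero_mem])

lemma monomial_span_mult:
  assumes mono: "\<And>i j a. i + j = n \<Longrightarrow> z * monomial i j a \<in> monomial_span k"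
    and x: "x \<in> monomial_span n"
  shows "z * x \<in> monomial_span k"
proof -
  obtain \<alpha> where "J0.equ x (\<Sum>i\<le>n. monomial i (n - i) (\<alpha> i))"
    using x by (auto simp: monomial_span_def)
  then have "J0.equ (z * x) (\<Sum>i\<le>n. z * monomial i (n - i) (\<alpha> i))"
    unfolding sum_distrib_left[symmetric] by (rule J0.equ_mult_left)
  then show ?thesis by (rule monomial_span_equ) (auto intro!: monomial_span_sum mono)
qed

text \<open>In the undeformed algebra \<open>v\<^sub>1\<close> and \<open>v\<^sub>2\<close> commute, and the generators move to the right by
  \<open>T\<^sub>i v\<^sub>1 = 0\<close> and \<open>T\<^sub>i v\<^sub>2\<^sup>n = \<gamma>\<^sub>i\<^sup>n v\<^sub>1\<^sup>n T\<^sub>i\<close>.\<close>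

lemma component_monomial_span: "component n z \<in> monomial_span n"
proof -
  interpret zero: nil_deformation sA sV act \<Delta> T e c "\<lambda>_ _. 0" "\<lambda>_ _. 0" by unfold_locales
  let ?V1 = "letV v\<^sub>1" and ?V2 = "letV v\<^sub>2"
  have V1: "?V1 * x \<in> monomial_span (Suc n)" if "x \<in> monomial_span n" for x n
  proof (rule monomial_span_mult[OF _ that])
    show "?V1 * monomial i j a \<in> monomial_span (Suc n)" if "i + j = n" for i j a
      using monomial_span_mem[of "Suc i" j a] that by (simp add: monomial_def mult.assoc)
  qed
  have swap: "J0.equ (?V2 * ?V1) (?V1 * ?V2)"
  proof -
    have "J0.equ (?V2 * ?V1 - ?V1 * ?V2) (letter (0, 0) + letter (0, 0))"
      by (rule zero.commutator_J)
    then show ?thesis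
      using J0.mem_cong J0.add_mem[OF letter_zero_J0 letter_zero_J0] by (auto simp: J0.equ_def)
  qed
  have swap_power: "J0.equ (?V2 * ?V1 ^ i) (?V1 ^ i * ?V2)" for i
  proof (induction i)
    case (Suc i)
    have "J0.equ (?V2 * ?V1 * ?V1 ^ i) (?V1 * ?V2 * ?V1 ^ i)" by (rule J0.equ_mult_right[OF swap])
    also have "\<dots> = ?V1 * (?V2 * ?V1 ^ i)" by (simp add: mult.assoc)
    also have "J0.equ \<dots> (?V1 * (?V1 ^ i * ?V2))" by (rule J0.equ_mult_left[OF Suc])
    finally show ?case by (simp add: mult.assoc)
  qed simp
  have V2: "?V2 * x \<in> monomial_span (Suc n)" if "x \<in> monomial_span n" for x n
  proof (rule monomial_span_mult[OF _ that])
    fix i j a assume "i + j = n"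
    then have "monomial i (Suc j) a \<in> monomial_span (Suc n)" using monomial_span_mem[of i "Suc j" a] by simp
    moreover have "J0.equ (?V2 * monomial i j a) (monomial i (Suc j) a)"
      using J0.equ_mult_right[OF swap_power[of i], of "?V2 ^ j * letA a"]
      by (simp add: monomial_def mult.assoc)
    ultimately show "?V2 * monomial i j a \<in> monomial_span (Suc n)" by (rule monomial_span_equ[rotated])
  qed
  have V: "letV v * x \<in> monomial_span (Suc n)" if "x \<in> monomial_span n" for v x n
  proof -
    have "J0.equ (letV v) (letV (sV (cx v) v\<^sub>1) + letV (sV (cy v) v\<^sub>2))"
      by (subst expansion[of v]) (rule zero.Lin_equ_J[OF letV_add])
    also have "J0.equ \<dots> (scalar (cx v) * ?V1 + scalar (cy v) * ?V2)"
      by (intro J0.equ_add zero.Lin_equ_J[OF letV_scale])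
    finally have "J0.equ (letV v * x) ((scalar (cx v) * ?V1 + scalar (cy v) * ?V2) * x)"
      by (rule J0.equ_mult_right)
    then show ?thesis
      by (rule monomial_span_equ)
         (simp add: distrib_right mult.assoc monomial_span_add monomial_span_scalar V1 V2 that)
  qed
  have T_V2: "J0.equ (letA (T i) * ?V2 ^ n) (scalar (\<gamma> i ^ n) * (?V1 ^ n * letA (T i)))" for i n
  proof (induction n)
    case (Suc n)
    let ?t = "letA (T i)"
    have "?t * ?V2 ^ Suc n = ?t * ?V2 * ?V2 ^ n" by (simp add: mult.assoc)
    also have "J0.equ \<dots> (letV (sV (\<gamma> i) v\<^sub>1) * ?t * ?V2 ^ n)"
      using J0.equ_mult_right[OF zero.generator_commutation[of i v\<^sub>2]] by (simp add: T_v2)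
    also have "J0.equ \<dots> (scalar (\<gamma> i) * ?V1 * ?t * ?V2 ^ n)"
      by (intro J0.equ_mult_right zero.Lin_equ_J[OF letV_scale])
    also have "\<dots> = scalar (\<gamma> i) * ?V1 * (?t * ?V2 ^ n)" by (simp add: mult.assoc)
    also have "J0.equ \<dots> (scalar (\<gamma> i) * ?V1 * (scalar (\<gamma> i ^ n) * (?V1 ^ n * ?t)))"
      by (rule J0.equ_mult_left[OF Suc])
    also have "\<dots> = scalar (\<gamma> i) * (?V1 * scalar (\<gamma> i ^ n)) * (?V1 ^ n * ?t)" by (simp add: mult.assoc)
    also have "\<dots> = scalar (\<gamma> i ^ Suc n) * (?V1 ^ Suc n * ?t)"
      unfolding scalar_mult_commute[symmetric] by (simp add: mult_single flip: mult.assoc)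
    finally show ?case .
  qed simp
  have T: "letA (T k) * x \<in> monomial_span n" if "x \<in> monomial_span n" for k x n
  proof (rule monomial_span_mult[OF _ that])
    fix i j a assume ij: "i + j = n"
    let ?t = "letA (T k)"
    show "?t * monomial i j a \<in> monomial_span n"
    proof (cases i)
      case 0
      have "?t * monomial i j a = ?t * ?V2 ^ j * letA a" by (simp add: monomial_def 0 mult.assoc)
      also have "J0.equ \<dots> (scalar (\<gamma> k ^ j) * (?V1 ^ j * letA (T k)) * letA a)"
        by (rule J0.equ_mult_right[OF T_V2])
      also have "\<dots> = scalar (\<gamma> k ^ j) * (?V1 ^ j * (letA (T k) * letA a))" by (simp add: mult.assoc)
      also have "J0.equ \<dots> (scalar (\<gamma> k ^ j) * (?V1 ^ j * letA (T k * a)))"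
        by (intro J0.equ_mult_left zero.letA_mult)
      also have "\<dots> = scalar (\<gamma> k ^ j) * monomial j 0 (T k * a)" by (simp add: monomial_def)
      finally show ?thesis
        using monomial_span_mem[of j 0 "T k * a"] ij 0
        by (auto intro: monomial_span_equ monomial_span_scalar)
    next
      case (Suc i')
      have "J0.equ (?t * ?V1) (letter (0, 0) * ?t)"
        using zero.generator_commutation[of k v\<^sub>1] by (simp add: T_v1)
      then have "?t * ?V1 \<in> J0"
        using J0.mem_cong J0.mult_mem_right[OF letter_zero_J0] by (auto simp: J0.equ_def)
      from J0.mult_mem_right[OF this, of "?V1 ^ i' * ?V2 ^ j * letA a"] show ?thesis
        by (intro monomial_span_J0) (simp add: monomial_def Suc mult.assoc)
    qed
  qed
  have A: "letA a * x \<in> monomial_span n" if x: "x \<in> monomial_span n" for a x n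
  proof (induction a rule: words_induct)
    case zero
    then show ?case by (intro monomial_span_J0 J0.mult_mem_right letter_zero_J0)
  next
    case (add a b)
    have "J0.equ (letA (a + b) * x) ((letA a + letA b) * x)"
      by (rule J0.equ_mult_right[OF letA_add_J0])
    then show ?case
      by (rule monomial_span_equ) (simp add: distrib_right monomial_span_add add)
  next
    case (scale k a)
    have "J0.equ (letA (sA k a) * x) (scalar k * letA a * x)"
      by (rule J0.equ_mult_right[OF letA_scale_J0])
    then show ?case
      by (rule monomial_span_equ) (simp add: mult.assoc monomial_span_scalar scale)
  next
    case (word w)
    show ?case
    proof (induction w)
      case Nil
      have "J0.equ (letA 1 * x) (1 * x)" by (rule J0.equ_mult_right[OF zero.letA_one])
      then show ?case using x by (auto intro: monomial_span_equ)
    next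
      case (Cons i w)
      have "J0.equ (letA (T i * word_prod T w) * x) (letA (T i) * letA (word_prod T w) * x)"
        by (rule J0.equ_mult_right[OF J0.equ_sym[OF zero.letA_mult]])
      then show ?case
        using T[OF Cons, of i] by (auto simp: mult.assoc intro: monomial_span_equ)
    qed
  qed
  show ?thesis
  proof (induction z arbitrary: n rule: free_alg_induct)
    case (scalar k)
    have "J0.equ (scalar k) (monomial 0 0 (sA k 1))"
      using zero.scalar_J by (simp add: monomial_def)
    then have "scalar k \<in> monomial_span 0" using monomial_span_mem[of 0 0] monomial_span_equ by fastforce
    then show ?case using monomial_span_J0[OF J0.zero_mem] by simp
  next
    case (add x y)
    then show ?case by (simp add: monomial_span_add)
  next
    case (mult_letter l x)
    obtain v a where l: "l = (v, a)" by (cases l)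
    show ?case by (cases n) (simp_all add: l component_letter_mult A V mult_letter monomial_span_add)
  qed
qed

text \<open>If the \<open>n\<close>-th component of an element drops to a lower degree in the deformed algebra, then so
  does its expression in monomials of degree \<open>n\<close>. Applied to \<open>1\<close> in the representation, this
  expression gives back its own coefficients in degree \<open>n\<close>, which therefore vanish.\<close>

theorem PBW_plane: "PBW sA sV act \<Delta> \<kappa>V \<kappa>A"
  unfolding PBW_iff_injective
proof (intro allI impI)
  fix z assume z: "\<forall>n. component n z \<in> Below n"
  have "component n z \<in> J0" for n
  proof -
    obtain \<alpha> where \<alpha>: "J0.equ (component n z) (\<Sum>i\<le>n. monomial i (n - i) (\<alpha> i))"
      using component_monomial_span[of n z] by (auto simp: monomial_span_def)
    let ?y = "\<Sum>i\<le>n. monomial i (n - i) (\<alpha> i)"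
    have hom: "homogeneous i (letV v ^ i)" for v i
      by (induction i) (use homogeneous_scalar[of 1] homogeneous_mult[OF homogeneous_letV] in auto)
    have "homogeneous n (monomial i (n - i) a)" if "i \<le> n" for i a
      using homogeneous_mult[OF homogeneous_mult[OF hom[of i v\<^sub>1] hom[of "n - i" v\<^sub>2]] homogeneous_letA[of a]] that
      by (simp add: monomial_def)
    then have hom: "homogeneous n (component n z - ?y)"
      by (intro homogeneous_diff homogeneous_component homogeneous_sum) auto
    have "Lin.equ (component n (component n z - ?y)) (component n z - ?y)"
      using hom[unfolded homogeneous_def, THEN spec, of n] by (simp del: component_simps)
    moreover have "component n (component n z - ?y) \<in> Below n"
      using \<alpha> by (intro J0_component_Below) (simp add: J0.equ_def)
    ultimately have "component n z - ?y \<in> Below n"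
      using Below_cong[OF Lin_equ_J] by blast
    then have y: "?y \<in> Below n"
      using Below_diff[of "component n z" n "component n z - ?y"] z by simp
    have apply_sum: "sum g S a b = (\<Sum>s\<in>S. g s a b)" for g :: "nat \<Rightarrow> nat \<Rightarrow> nat \<Rightarrow> 'a" and S a b
      by (induction S rule: infinite_finite_induct) simp_all
    have run: "plane.rep.run ?y (unit_at 0 0 1) k (n - k) = \<alpha> k" if "k \<le> n" for k
    proof -
      have "plane.rep.run ?y (unit_at 0 0 1) k (n - k) = (\<Sum>i\<le>n. unit_at i (n - i) (\<alpha> i)) k (n - k)"
        by (simp add: run_monomial)
      also have "\<dots> = (\<Sum>i\<le>n. unit_at i (n - i) (\<alpha> i) k (n - k))"
        by (rule apply_sum)
      also have "\<dots> = (\<Sum>i\<le>n. if k = i then \<alpha> k else 0)" by (rule sum.cong) auto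
      finally show ?thesis using that by simp
    qed
    have "\<alpha> k = 0" if "k \<le> n" for k
    proof (cases n)
      case 0
      then have "plane.rep.run ?y (unit_at 0 0 1) = 0" using y by (simp add: Below_def plane.J_annihilates)
      then show ?thesis using run[OF that] by simp
    next
      case (Suc l)
      have "unit_at 0 0 1 \<in> degree_at_most 0" by (simp add: degree_at_most_def)
      then have "plane.rep.run ?y (unit_at 0 0 1) \<in> degree_at_most l"
        using Fil_raises_degree[of ?y l _ 0] y by (simp add: Below_def Suc)
      from degree_at_mostD[OF this, of k "n - k"] show ?thesis using run[OF that] that Suc by simp
    qed
    then have "?y \<in> J0" using monomial_zero by (intro J0.sum_mem) auto
    then show ?thesis using J0.mem_cong[of "component n z" ?y] \<alpha> by (simp add: J0.equ_def)
  qed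
  then show "z \<in> J0" by (rule J0_from_components)
qed

end

section \<open>Modules of dimension at most two\<close>

context nil_module begin

lemma V_pair: "vector_space sW \<Longrightarrow> vector_space_pair sV sW"
  using V.vector_space_axioms by (simp add: vector_space_pair_def)

lemma alternating_expand:
  assumes sW: "vector_space sW" and \<kappa>: "alternating_bilinear sV sW \<kappa>"
  shows "\<kappa> (sV a u + sV b w) (sV a' u + sV b' w) = sW (a * b' - a' * b) (\<kappa> u w)"
proof -
  interpret W: vector_space sW by (rule sW)
  have l: "Vector_Spaces.linear sV sW (\<lambda>v. \<kappa> v z)" and r: "Vector_Spaces.linear sV sW (\<kappa> z)" for z
    using \<kappa> by (auto simp: alternating_bilinear_def)
  interpret P: vector_space_pair sV sW by (rule V_pair[OF sW])
  have zero: "\<kappa> z z = 0" for z using \<kappa> by (simp add: alternating_bilinear_def)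
  have "\<kappa> (u + w) (u + w) = \<kappa> u u + \<kappa> w u + (\<kappa> u w + \<kappa> w w)"
    by (simp only: P.linear_add[OF l] P.linear_add[OF r])
  then have skew: "\<kappa> w u = - \<kappa> u w" by (simp add: zero add_eq_0_iff)
  show ?thesis
    by (simp add: P.linear_add[OF l] P.linear_add[OF r] P.linear_scale[OF l] P.linear_scale[OF r]
        zero skew W.scale_left_diff_distrib mult.commute)
qed

lemma alternating_line:
  assumes "vector_space sW" "alternating_bilinear sV sW \<kappa>" "v \<in> V.span {u}" "w \<in> V.span {u}"
  shows "\<kappa> v w = 0"
proof -
  interpret W: vector_space sW by (rule assms(1))
  obtain a b where "v = sV a u" "w = sV b u" using assms(3,4) by (auto simp: V.span_singleton)
  then have "\<kappa> v w = sW (a * 0 - b * 0) (\<kappa> u u)"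
    using alternating_expand[OF assms(1,2), of a u 0 u b 0] by simp
  then show ?thesis by simp
qed

text \<open>A longest word that does not kill \<open>v\<close> maps it to a primitive vector.\<close>

lemma exists_primitive:
  assumes "(v :: 'v) \<noteq> 0" shows "\<exists>u. u \<noteq> 0 \<and> u \<in> Prim T act"
proof -
  obtain N where N: "\<And>u. N \<le> length u \<Longrightarrow> word_prod T u = 0" using words_nilpotent by blast
  let ?P = "\<lambda>n. \<forall>w. length w = n \<longrightarrow> act (word_prod T w) v = 0"
  have "?P N" using N by simp
  moreover have "\<not> ?P 0" using assms by (simp add: act_one)
  ultimately obtain n where n: "\<not> ?P n" "?P (Suc n)" using ex_least_nat_less[of ?P N] by blast
  then obtain w where w: "length w = n" "act (word_prod T w) v \<noteq> 0" by blast
  have "act (T i) (act (word_prod T w) v) = 0" for i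
    using n(2)[rule_format, of "i # w"] w(1) by (simp add: act_mult)
  then show ?thesis using w(2) by (auto simp: Prim_def)
qed

text \<open>In dimension two the nilpotent action is strictly triangular, and a given primitive vector
  may be taken as the first basis vector up to a scalar.\<close>

lemma dim_two_basis:
  assumes dim: "dim_at_most sV 2" and line: "\<And>u. V.span {u} \<noteq> UNIV" and p: "p \<in> Prim T act"
  obtains v\<^sub>1 v\<^sub>2 \<gamma> lam where "v\<^sub>1 \<noteq> v\<^sub>2" "V.independent {v\<^sub>1, v\<^sub>2}" "V.span {v\<^sub>1, v\<^sub>2} = UNIV"
    and "v\<^sub>1 \<in> Prim T act" "\<And>i. act (T i) v\<^sub>2 = sV (\<gamma> i) v\<^sub>1" "p = sV lam v\<^sub>1"
proof -
  obtain B where B: "V.independent B" "V.span B = UNIV" "finite B" "card B \<le> 2"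
    using dim by (auto simp: dim_at_most_def)
  have "\<not> card B \<le> 1"
  proof
    assume "card B \<le> 1"
    then obtain u where "B \<subseteq> {u}" using B(3) by (metis card_le_Suc0_iff_eq One_nat_def subsetI singleton_iff)
    then show False using V.span_mono[of B "{u}"] B(2) line[of u] by auto
  qed
  then have card: "card B = 2" using B(4) by simp
  obtain u :: 'v where "u \<noteq> 0" using line[of 0] by (auto simp: V.span_singleton)
  then obtain v\<^sub>1 where v1: "v\<^sub>1 \<noteq> 0" "v\<^sub>1 \<in> Prim T act" "\<exists>lam. p = sV lam v\<^sub>1"
  proof (cases "p = 0")
    case True
    then show ?thesis using exists_primitive[OF \<open>u \<noteq> 0\<close>] that by (metis V.scale_zero_left)
  next
    case False
    then show ?thesis using that[of p] p by (metis V.scale_one)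
  qed
  then have "V.independent {v\<^sub>1}" by simp
  then obtain B' where B': "{v\<^sub>1} \<subseteq> B'" "V.independent B'" "UNIV \<subseteq> V.span B'"
    using V.maximal_independent_subset_extend[of "{v\<^sub>1}" UNIV] by auto
  then have span': "V.span B' = UNIV" by blast
  have "card B' = card B"
    using V.dim_eq_card[OF _ B'(2)] V.dim_eq_card[OF _ B(1), of B'] span' B(2) by simp
  then obtain v\<^sub>2 where v2: "B' = {v\<^sub>1, v\<^sub>2}" "v\<^sub>1 \<noteq> v\<^sub>2"
    using card B'(1) by (metis card_2_iff insert_subset insertE insert_commute singletonD)
  have notin: "v\<^sub>2 \<notin> V.span {v\<^sub>1}"
    using B'(2) v2 V.dependent_def[of "{v\<^sub>1, v\<^sub>2}"] by (auto simp: insert_Diff_if)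
  obtain N where N: "\<And>u. N \<le> length u \<Longrightarrow> word_prod T u = 0" using words_nilpotent by blast
  have "\<exists>g. act (T i) v\<^sub>2 = sV g v\<^sub>1" for i
  proof -
    have "act (T i) v\<^sub>2 \<in> V.span {v\<^sub>1, v\<^sub>2}" using span' v2 by simp
    then obtain b where b: "act (T i) v\<^sub>2 - sV b v\<^sub>2 \<in> V.span {v\<^sub>1}"
      using V.span_breakdown_eq[of _ v\<^sub>2 "{v\<^sub>1}"] by (auto simp: insert_commute)
    have T1: "act (T i) z = 0" if "z \<in> V.span {v\<^sub>1}" for z
      using that v1(2) by (auto simp: V.span_singleton act_scale_right Prim_def)
    have "act (word_prod T (replicate n i)) v\<^sub>2 - sV (b ^ n) v\<^sub>2 \<in> V.span {v\<^sub>1}" for n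
    proof (induction n)
      case (Suc n)
      let ?z = "act (word_prod T (replicate n i)) v\<^sub>2"
      have "act (T i) (?z - sV (b ^ n) v\<^sub>2) = 0" by (rule T1[OF Suc])
      moreover have "act (T i) ?z = act (T i) (?z - sV (b ^ n) v\<^sub>2) + act (T i) (sV (b ^ n) v\<^sub>2)"
        by (simp flip: act_add_right)
      ultimately have "act (T i) ?z - sV (b ^ Suc n) v\<^sub>2 = sV (b ^ n) (act (T i) v\<^sub>2 - sV b v\<^sub>2)"
        by (simp add: act_scale_right V.scale_right_diff_distrib mult.commute)
      then show ?case using V.span_scale[OF b] by (simp add: act_mult)
    qed (simp add: act_one V.span_zero)
    from this[of N] have "sV (b ^ N) v\<^sub>2 \<in> V.span {v\<^sub>1}"
      using N[of "replicate N i"] V.span_neg by force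
    then have "b = 0"
      using notin V.span_scale[of "sV (b ^ N) v\<^sub>2" "{v\<^sub>1}" "inverse (b ^ N)"]
      by (cases "b = 0") auto
    then show ?thesis using b by (auto simp: V.span_singleton)
  qed
  then obtain \<gamma> where "\<And>i. act (T i) v\<^sub>2 = sV (\<gamma> i) v\<^sub>1" by metis
  then show thesis using that[of v\<^sub>1 v\<^sub>2 \<gamma>] v1 v2 B'(2) span' by blast
qed

lemma Prim_subspace: "V.subspace (Prim T act)" "subspace (Prim T (\<lambda>a b. a * b))"
  by (auto simp: V.subspace_def subspace_def Prim_def act_add_right act_scale_right distrib_left
      simp flip: scale_mult_right)

lemma wedge_image_subset_Prim_iff:
  "wedge_image sV \<kappa>V \<subseteq> Prim T act \<longleftrightarrow> (\<forall>i v w. act (T i) (\<kappa>V v w) = 0)"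
  "wedge_image sA \<kappa>A \<subseteq> Prim T (\<lambda>a b. a * b) \<longleftrightarrow> (\<forall>i v w. T i * \<kappa>A v w = 0)"
proof -
  have "wedge_image sV \<kappa>V \<subseteq> Prim T act \<longleftrightarrow> {\<kappa>V v v' | v v'. True} \<subseteq> Prim T act"
    unfolding wedge_image_def
    using V.span_minimal[OF _ Prim_subspace(1)] order_trans[OF V.span_superset] by metis
  then show "wedge_image sV \<kappa>V \<subseteq> Prim T act \<longleftrightarrow> (\<forall>i v w. act (T i) (\<kappa>V v w) = 0)"
    by (auto simp: Prim_def)
  have "wedge_image sA \<kappa>A \<subseteq> Prim T (\<lambda>a b. a * b) \<longleftrightarrow> {\<kappa>A v v' | v v'. True} \<subseteq> Prim T (\<lambda>a b. a * b)"
    unfolding wedge_image_def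
    using span_minimal[OF _ Prim_subspace(2)] order_trans[OF span_superset] by metis
  then show "wedge_image sA \<kappa>A \<subseteq> Prim T (\<lambda>a b. a * b) \<longleftrightarrow> (\<forall>i v w. T i * \<kappa>A v w = 0)"
    by (auto simp: Prim_def)
qed

end

text \<open>A generator maps the plane into a line, on which alternating maps vanish.\<close>

theorem (in nil_deformation) PBW_dim_two_necessary:
  assumes PBW: "PBW sA sV act \<Delta> \<kappa>V \<kappa>A"
    and \<kappa>V: "alternating_bilinear sV sV \<kappa>V" and \<kappa>A: "alternating_bilinear sV sA \<kappa>A"
    and dim: "dim_at_most sV 2" and line: "\<And>u. V.span {u} \<noteq> UNIV"
  shows "act (T i) (\<kappa>V v w) = 0" "T i * \<kappa>A v w = 0"
proof -
  have "0 \<in> Prim T act" by (simp add: Prim_def)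
  from dim_two_basis[OF dim line this] obtain v\<^sub>1 v\<^sub>2 \<gamma>
    where span: "V.span {v\<^sub>1, v\<^sub>2} = UNIV" and v1: "v\<^sub>1 \<in> Prim T act"
      and v2: "\<And>i. act (T i) v\<^sub>2 = sV (\<gamma> i) v\<^sub>1"
    by metis
  have T: "act (T i) z \<in> V.span {v\<^sub>1}" for z
  proof -
    have "z \<in> V.span {v\<^sub>1, v\<^sub>2}" using span by simp
    then obtain a b where "z - sV a v\<^sub>1 = sV b v\<^sub>2"
      by (auto simp: V.span_breakdown_eq V.span_singleton)
    then have "z = sV a v\<^sub>1 + sV b v\<^sub>2" by (simp add: diff_eq_eq add.commute)
    then show ?thesis
      using v1 v2 V.span_base[of v\<^sub>1 "{v\<^sub>1}"]
      by (simp add: act_add_right act_scale_right Prim_def V.span_scale)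
  qed
  show "act (T i) (\<kappa>V v w) = 0" "T i * \<kappa>A v w = 0"
    using PBW_kappa_primitive[OF PBW alternating_line[OF V.vector_space_axioms \<kappa>V T T]
        alternating_line[OF vector_space_axioms \<kappa>A T T]] by auto
qed

text \<open>The values of \<open>\<kappa>\<^sub>V\<close> are primitive and proportional to each other, so the basis can be chosen
  such that they are multiples of its first vector.\<close>

theorem PBW_dim_two_sufficient:
  fixes T :: "'i::finite \<Rightarrow> 'a::ring_1"
  assumes "nil_deformation sA sV act \<Delta> T e c"
    and \<kappa>V: "alternating_bilinear sV sV \<kappa>V" and \<kappa>A: "alternating_bilinear sV sA \<kappa>A"
    and dim: "dim_at_most sV 2" and line: "\<And>u. Modules.module.span sV {u} \<noteq> UNIV"
    and primV: "\<And>i v w. act (T i) (\<kappa>V v w) = 0" and primA: "\<And>i v w. T i * \<kappa>A v w = 0"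
  shows "PBW sA sV act \<Delta> \<kappa>V \<kappa>A"
proof -
  interpret nil_deformation sA sV act \<Delta> T e c \<kappa>V \<kappa>A by (rule assms(1))
  obtain p where p: "p \<in> Prim T act" "\<And>v w. p = 0 \<Longrightarrow> \<kappa>V v w = 0" "\<exists>v w. p = \<kappa>V v w"
  proof (cases "\<forall>v w. \<kappa>V v w = 0")
    case True
    then show ?thesis using that[of 0] by (simp add: Prim_def)
  next
    case False
    then obtain v w where "\<kappa>V v w \<noteq> 0" by blast
    then show ?thesis using that[of "\<kappa>V v w"] primV by (auto simp: Prim_def)
  qed
  from dim_two_basis[OF dim line p(1)] obtain v\<^sub>1 v\<^sub>2 \<gamma> lam
    where ne: "v\<^sub>1 \<noteq> v\<^sub>2" and ind: "V.independent {v\<^sub>1, v\<^sub>2}" and span: "V.span {v\<^sub>1, v\<^sub>2} = UNIV"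
      and v1: "v\<^sub>1 \<in> Prim T act" and v2: "\<And>i. act (T i) v\<^sub>2 = sV (\<gamma> i) v\<^sub>1" and lam: "p = sV lam v\<^sub>1"
    by metis
  define cx where "cx v = V.representation {v\<^sub>1, v\<^sub>2} v v\<^sub>1" for v
  define cy where "cy v = V.representation {v\<^sub>1, v\<^sub>2} v v\<^sub>2" for v
  have expansion: "v = sV (cx v) v\<^sub>1 + sV (cy v) v\<^sub>2" for v
    using V.sum_representation_eq[OF ind, of v "{v\<^sub>1, v\<^sub>2}"] span ne by (simp add: cx_def cy_def)
  have \<kappa>V': "\<kappa>V v w = sV (cx v * cy w - cx w * cy v) (\<kappa>V v\<^sub>1 v\<^sub>2)" for v w
    using alternating_expand[OF V.vector_space_axioms \<kappa>V, of "cx v" v\<^sub>1 "cy v" v\<^sub>2 "cx w" "cy w"]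
    by (simp flip: expansion)
  have \<kappa>A': "\<kappa>A v w = sA (cx v * cy w - cx w * cy v) (\<kappa>A v\<^sub>1 v\<^sub>2)" for v w
    using alternating_expand[OF vector_space_axioms \<kappa>A, of "cx v" v\<^sub>1 "cy v" v\<^sub>2 "cx w" "cy w"]
    by (simp flip: expansion)
  have "\<exists>mu. \<kappa>V v\<^sub>1 v\<^sub>2 = sV mu v\<^sub>1"
  proof (cases "p = 0")
    case True
    then show ?thesis using p(2) by (intro exI[of _ 0]) simp
  next
    case False
    obtain v w where "p = \<kappa>V v w" using p(3) by blast
    then have det: "p = sV (cx v * cy w - cx w * cy v) (\<kappa>V v\<^sub>1 v\<^sub>2)" using \<kappa>V' by metis
    let ?D = "cx v * cy w - cx w * cy v"
    have "?D \<noteq> 0" using False det by auto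
    then have "\<kappa>V v\<^sub>1 v\<^sub>2 = sV (inverse ?D) p" by (subst det) simp
    then show ?thesis by (auto simp: lam)
  qed
  then obtain mu where mu: "\<kappa>V v\<^sub>1 v\<^sub>2 = sV mu v\<^sub>1" by blast
  have "e (\<kappa>A v\<^sub>1 v\<^sub>2) = 0"
  proof -
    fix i :: 'i
    have "c i (T i * \<kappa>A v\<^sub>1 v\<^sub>2) = 0" using c_scale[of i 0 0] by (simp add: primA)
    then show ?thesis by (simp add: c_mult e_T c_T)
  qed
  note e_q = this
  have coordinates: "cx (v + w) = cx v + cx w" "cx (sV k v) = k * cx v"
    "cy (v + w) = cy v + cy w" "cy (sV k v) = k * cy v" for v w k
    using span by (simp_all add: cx_def cy_def V.representation_add[OF ind] V.representation_scale[OF ind])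
  have basis: "cx v\<^sub>1 = 1" "cy v\<^sub>1 = 0" "cx v\<^sub>2 = 0" "cy v\<^sub>2 = 1"
    using ne by (simp_all add: cx_def cy_def V.representation_basis[OF ind])
  have T_v1: "act (T i) v\<^sub>1 = 0" for i using v1 by (simp add: Prim_def)
  have \<kappa>V'': "\<kappa>V v w = sV ((cx v * cy w - cx w * cy v) * mu) v\<^sub>1" for v w
    using \<kappa>V'[of v w] by (simp only: mu V.scale_scale)
  interpret plane_deformation sA sV act \<Delta> T e c \<kappa>V \<kappa>A v\<^sub>1 v\<^sub>2 cx cy \<gamma> mu "\<kappa>A v\<^sub>1 v\<^sub>2"
    by unfold_locales (rule expansion coordinates basis T_v1 v2 \<kappa>V'' \<kappa>A' primA e_q)+
  show ?thesis by (rule PBW_plane)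
qed

section \<open>The characterization\<close>

theorem theorem5p12:
  fixes m :: "'i::finite \<Rightarrow> 'i \<Rightarrow> enat"
    and d :: "'i \<Rightarrow> nat"
    and sA :: "'k::field \<Rightarrow> 'a::ring_1 \<Rightarrow> 'a"
    and T :: "'i \<Rightarrow> 'a"
    and \<Delta> :: "'a \<Rightarrow> ('a pure_tensor \<Rightarrow>\<^sub>0 'k) set"
    and sV :: "'k \<Rightarrow> 'v::ab_group_add \<Rightarrow> 'v"
    and act :: "'a \<Rightarrow> 'v \<Rightarrow> 'v"
    and \<kappa>V :: "'v \<Rightarrow> 'v \<Rightarrow> 'v"
    and \<kappa>A :: "'v \<Rightarrow> 'v \<Rightarrow> 'a"
  assumes coxeter: "coxeter_matrix m"
    and exponents: "\<And>i. 2 \<le> d i"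
    and A: "is_nil_coxeter_algebra m d sA T"
    and nilpotent: "nilpotent_ideal (Idl\<^bsub>type_ring\<^esub> (range T))"
    and coproduct: "is_coproduct sA T \<Delta>"
    and V: "algebra_module sA sV act"
    and \<kappa>V: "alternating_bilinear sV sV \<kappa>V"
    and \<kappa>A: "alternating_bilinear sV sA \<kappa>A"
  shows "(dim_at_most sV 2 \<longrightarrow>
            (PBW sA sV act \<Delta> \<kappa>V \<kappa>A \<longleftrightarrow>
               wedge_image sV \<kappa>V \<subseteq> Prim T act \<and> wedge_image sA \<kappa>A \<subseteq> Prim T (\<lambda>a b. a * b)))
       \<and> (\<not> dim_at_most sV 2 \<and> (\<forall>v v'. \<kappa>V v v' = 0) \<longrightarrow>
            (PBW sA sV act \<Delta> \<kappa>V \<kappa>A \<longleftrightarrow> (\<forall>v v'. \<kappa>A v v' = 0)))"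
proof -
  obtain e c where gens: "nil_generators sA T e c"
    using nil_coxeter_nil_generators[OF coxeter exponents A nilpotent] by blast
  have deform: "nil_deformation sA sV act \<Delta> T e c"
    using gens coproduct V
    by (simp add: nil_deformation_def nil_module_def nil_coproduct_def nil_coproduct_axioms_def
        H_deformation_def H_setup_def)
  interpret nil_deformation sA sV act \<Delta> T e c \<kappa>V \<kappa>A by (rule deform)
  have zero: "PBW sA sV act \<Delta> \<kappa>V \<kappa>A" if "\<And>v w. \<kappa>V v w = 0" "\<And>v w. \<kappa>A v w = 0"
  proof -
    have "\<kappa>V = (\<lambda>_ _. 0)" "\<kappa>A = (\<lambda>_ _. 0)" using that by (simp_all add: fun_eq_iff)
    then show ?thesis using PBW_zero by simp
  qed
  have "PBW sA sV act \<Delta> \<kappa>V \<kappa>A \<longleftrightarrow>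
      (\<forall>i v w. act (T i) (\<kappa>V v w) = 0) \<and> (\<forall>i v w. T i * \<kappa>A v w = 0)"
    if dim: "dim_at_most sV 2"
  proof (cases "\<exists>u. V.span {u} = UNIV")
    case True
    then obtain u where "V.span {u} = UNIV" by blast
    then have "\<kappa>V v w = 0" "\<kappa>A v w = 0" for v w
      using alternating_line[OF V.vector_space_axioms \<kappa>V, of v u w]
        alternating_line[OF vector_space_axioms \<kappa>A, of v u w] by auto
    then show ?thesis using zero by simp
  next
    case False
    then have line: "V.span {u} \<noteq> UNIV" for u by blast
    show ?thesis
      using PBW_dim_two_necessary[OF _ \<kappa>V \<kappa>A dim line]
        PBW_dim_two_sufficient[OF deform \<kappa>V \<kappa>A dim line] by blast
  qed
  moreover have "PBW sA sV act \<Delta> \<kappa>V \<kappa>A \<longleftrightarrow> (\<forall>v v'. \<kappa>A v v' = 0)"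
    if "\<not> dim_at_most sV 2" "\<forall>v v'. \<kappa>V v v' = 0"
    using PBW_kappaA_zero[OF _ _ \<kappa>A that(1)] that(2) zero by blast
  ultimately show ?thesis unfolding wedge_image_subset_Prim_iff by blast
qed

end
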